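(* Let $\phi:(G,g)\to(H,h)$ be a homomorphism between two Riemannian Lie groups which is a submersion, with differential $\xi:\mathfrak g\to\mathfrak h$ at the identity. Let $G_0=\ker\phi$, with Lie algebra $\mathfrak g_0=\ker\xi$, let $\overline\phi:G/G_0\to H$ be the induced isomorphism and $\overline\xi:\mathfrak g/\mathfrak g_0\to\mathfrak h$ its differential at the identity. Let $\mathrm r:\mathfrak g/\mathfrak g_0\to(\ker\xi)^\perp$ be the inverse of the restriction to $(\ker\xi)^\perp$ of the natural projection $\mathfrak g\to\mathfrak g/\mathfrak g_0$, and endow $\mathfrak g/\mathfrak g_0$ with the inner product $\mathrm r^*\langle\,,\rangle_{\mathfrak g}$. Then $$\tau(\xi)=\tau(\overline\xi)-\xi(H^{\ker\xi}),$$ where $\overline\xi$ is regarded as a homomorphism $(\mathfrak g/\mathfrak g_0,\mathrm r^*\langle\,,\rangle_{\mathfrak g})\to(\mathfrak h,\langle\,,\rangle_{\mathfrak h})$.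
   Context: All Lie groups are real and connected (except possibly $G_0$). A Riemannian Lie group is a Lie group $G$ with a left invariant Riemannian metric $g$; its Lie algebra $\mathfrak g=T_eG$ carries the inner product $\langle\,,\rangle_{\mathfrak g}=g(e)$. The Levi-Civita product $A$ of a Euclidean Lie algebra is defined by $2\langle A_uv,w\rangle=\langle[u,v],w\rangle+\langle[w,u],v\rangle+\langle[w,v],u\rangle$. For a homomorphism $\xi:\mathfrak g\to\mathfrak h$ of Euclidean Lie algebras, with $B$ the Levi-Civita product of $\mathfrak h$ and $(e_i)$ an orthonormal basis of $\mathfrak g$, $\tau(\xi)=U^\xi-\xi(U^{\mathfrak g})\in\mathfrak h$, where $U^\xi=\sum_iB_{\xi(e_i)}\xi(e_i)$ and $\langle U^{\mathfrak g},v\rangle_{\mathfrak g}=\mathrm{tr}(\mathrm{ad}_v)$ for all $v\in\mathfrak g$. (If $\xi=d_e\phi$, this is the value at $e$ of the tension field of $\phi$.) For a subalgebra $\mathfrak k\subset\mathfrak g$ with orthonormal basis $(f_i)$, the mean curvature vector $H^{\mathfrak k}\in\mathfrak k^\perp$ is $H^{\mathfrak k}=\sum_i(A_{f_i}f_i-A^0_{f_i}f_i)$, where $A$, $A^0$ are the Levi-Civita products of $\mathfrak g$ and of $\mathfrak k$ (with the restricted inner product); equivalently it is the $\mathfrak k^\perp$-component of $\sum_iA_{f_i}f_i$. *)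

theory Defs
  imports "HOL-Analysis.Analysis" "HOL-Algebra.QuotRing" "HOL-Algebra.Module"
begin

section \<open>Smooth functions on open subsets of Euclidean space\<close>

definition partial_deriv :: "nat \<Rightarrow> ((nat \<Rightarrow> real) \<Rightarrow> real) \<Rightarrow> (nat \<Rightarrow> real) \<Rightarrow> real" where
  "partial_deriv i f x = deriv (\<lambda>t. f (x(i := t))) (x i)"

primrec Ck_on :: "nat \<Rightarrow> nat \<Rightarrow> (nat \<Rightarrow> real) set \<Rightarrow> ((nat \<Rightarrow> real) \<Rightarrow> real) \<Rightarrow> bool" where
  "Ck_on 0 n V f \<longleftrightarrow> continuous_map (subtopology (Euclidean_space n) V) euclideanreal f"
| "Ck_on (Suc k) n V f \<longleftrightarrow>
     continuous_map (subtopology (Euclidean_space n) V) euclideanreal f \<and>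
     (\<forall>i<n. (\<forall>x\<in>V. (\<lambda>t. f (x(i := t))) field_differentiable at (x i)) \<and>
            Ck_on k n V (partial_deriv i f))"

definition smooth_on :: "nat \<Rightarrow> (nat \<Rightarrow> real) set \<Rightarrow> ((nat \<Rightarrow> real) \<Rightarrow> real) \<Rightarrow> bool" where
  "smooth_on n V f \<longleftrightarrow> openin (Euclidean_space n) V \<and> (\<forall>k. Ck_on k n V f)"


section \<open>Smooth manifolds\<close>

text \<open>
  A smooth structure is given by its sheaf of smooth real functions (a ``functional structure''
  in the sense of Bredon): \<open>smooth_funs X U\<close> is the set of functions that are smooth on the open
  set \<open>U\<close>, their values outside \<open>U\<close> being irrelevant.  In this form
  quotients are as easy to describe as manifolds are.
\<close>

record 'a smooth_space =
  topo :: "'a topology"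
  smooth_funs :: "'a set \<Rightarrow> ('a \<Rightarrow> real) set"

definition chart :: "nat \<Rightarrow> 'a smooth_space \<Rightarrow> 'a set \<Rightarrow> ('a \<Rightarrow> nat \<Rightarrow> real) \<Rightarrow> bool" where
  "chart n X U c \<longleftrightarrow>
     openin (topo X) U \<and> openin (Euclidean_space n) (c ` U) \<and>
     homeomorphic_map (subtopology (topo X) U) (subtopology (Euclidean_space n) (c ` U)) c \<and>
     (\<forall>W f. openin (topo X) W \<and> W \<subseteq> U \<longrightarrow>
        (f \<in> smooth_funs X W \<longleftrightarrow> smooth_on n (c ` W) (f \<circ> the_inv_into U c)))"

definition smooth_manifold :: "nat \<Rightarrow> 'a smooth_space \<Rightarrow> bool" where
  "smooth_manifold n X \<longleftrightarrow>
     Hausdorff_space (topo X) \<and> second_countable (topo X) \<and>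
     (\<forall>U f. f \<in> smooth_funs X U \<longrightarrow> openin (topo X) U) \<and>
     (\<forall>\<U> f. (\<forall>U\<in>\<U>. openin (topo X) U) \<longrightarrow>
        (f \<in> smooth_funs X (\<Union>\<U>) \<longleftrightarrow> (\<forall>U\<in>\<U>. f \<in> smooth_funs X U))) \<and>
     (\<forall>a\<in>topspace (topo X). \<exists>U c. a \<in> U \<and> chart n X U c)"

definition smooth_map :: "'a smooth_space \<Rightarrow> 'b smooth_space \<Rightarrow> ('a \<Rightarrow> 'b) \<Rightarrow> bool" where
  "smooth_map X Y \<phi> \<longleftrightarrow>
     continuous_map (topo X) (topo Y) \<phi> \<and>
     (\<forall>V. \<forall>f\<in>smooth_funs Y V. f \<circ> \<phi> \<in> smooth_funs X {x \<in> topspace (topo X). \<phi> x \<in> V})"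

text \<open>
  \<open>\<real>\<^sup>n\<^sup>+\<^sup>m\<close> is split into its first \<open>n\<close> and its remaining coordinates; a function of two variables is
  smooth if it is so in all product charts.
\<close>

definition head_coords :: "nat \<Rightarrow> (nat \<Rightarrow> real) \<Rightarrow> nat \<Rightarrow> real" where
  "head_coords n z = (\<lambda>i. if i < n then z i else 0)"

definition tail_coords :: "nat \<Rightarrow> (nat \<Rightarrow> real) \<Rightarrow> nat \<Rightarrow> real" where
  "tail_coords n z = (\<lambda>i. z (n + i))"

definition prod_space :: "'a smooth_space \<Rightarrow> 'b smooth_space \<Rightarrow> ('a \<times> 'b) smooth_space" where
  "prod_space X Y =
     \<lparr>topo = prod_topology (topo X) (topo Y),
      smooth_funs = (\<lambda>W. {F. openin (prod_topology (topo X) (topo Y)) W \<and>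
        (\<forall>n U c m V d. chart n X U c \<and> chart m Y V d \<and> U \<times> V \<subseteq> W \<longrightarrow>
           smooth_on (n + m)
             {z \<in> topspace (Euclidean_space (n + m)).
                head_coords n z \<in> c ` U \<and> tail_coords n z \<in> d ` V}
             (\<lambda>z. F (the_inv_into U c (head_coords n z), the_inv_into V d (tail_coords n z))))})\<rparr>"

text \<open>
  The quotient structure along a map \<open>p\<close>: a function is smooth iff its pullback is.  If \<open>p\<close> is a
  surjective submersion onto a manifold, this is the structure of that manifold.
\<close>

definition quotient_space :: "'a smooth_space \<Rightarrow> ('a \<Rightarrow> 'b) \<Rightarrow> 'b smooth_space" where
  "quotient_space X p =
     (let T = topology (\<lambda>V. V \<subseteq> p ` topspace (topo X) \<and>
                            openin (topo X) {x \<in> topspace (topo X). p x \<in> V})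
      in \<lparr>topo = T,
          smooth_funs = (\<lambda>V. {f. openin T V \<and>
             f \<circ> p \<in> smooth_funs X {x \<in> topspace (topo X). p x \<in> V}})\<rparr>)"


section \<open>Tangent vectors and differentials\<close>

definition smooth_at :: "'a smooth_space \<Rightarrow> 'a \<Rightarrow> ('a \<Rightarrow> real) set" where
  "smooth_at X a = {f. \<exists>U. a \<in> U \<and> f \<in> smooth_funs X U}"

text \<open>
  Tangent vectors at \<open>a\<close> are the derivations on functions smooth near \<open>a\<close>.  They are made total
  by the value \<open>0\<close> elsewhere, so that equality of tangent vectors is equality of functionals.
\<close>

type_synonym 'a tvec = "('a \<Rightarrow> real) \<Rightarrow> real"

definition tangent_space :: "'a smooth_space \<Rightarrow> 'a \<Rightarrow> 'a tvec set" where
  "tangent_space X a = {v.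
     (\<forall>f\<in>smooth_at X a. \<forall>g\<in>smooth_at X a. v (\<lambda>x. f x + g x) = v f + v g) \<and>
     (\<forall>r. \<forall>f\<in>smooth_at X a. v (\<lambda>x. r * f x) = r * v f) \<and>
     (\<forall>f\<in>smooth_at X a. \<forall>g\<in>smooth_at X a. v (\<lambda>x. f x * g x) = f a * v g + g a * v f) \<and>
     (\<forall>f. f \<notin> smooth_at X a \<longrightarrow> v f = 0)}"

definition differential ::
    "'a smooth_space \<Rightarrow> 'b smooth_space \<Rightarrow> ('a \<Rightarrow> 'b) \<Rightarrow> 'a \<Rightarrow> 'a tvec \<Rightarrow> 'b tvec" where
  "differential X Y \<phi> a v = (\<lambda>f. if f \<in> smooth_at Y (\<phi> a) then v (f \<circ> \<phi>) else 0)"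

definition submersion :: "'a smooth_space \<Rightarrow> 'b smooth_space \<Rightarrow> ('a \<Rightarrow> 'b) \<Rightarrow> bool" where
  "submersion X Y \<phi> \<longleftrightarrow> smooth_map X Y \<phi> \<and>
     (\<forall>a\<in>topspace (topo X). differential X Y \<phi> a ` tangent_space X a = tangent_space Y (\<phi> a))"

definition coord_vector ::
    "'a smooth_space \<Rightarrow> 'a set \<Rightarrow> ('a \<Rightarrow> nat \<Rightarrow> real) \<Rightarrow> nat \<Rightarrow> 'a \<Rightarrow> 'a tvec" where
  "coord_vector X U c i a =
     (\<lambda>f. if f \<in> smooth_at X a then partial_deriv i (f \<circ> the_inv_into U c) (c a) else 0)"

definition riemannian_metric ::
    "'a smooth_space \<Rightarrow> ('a \<Rightarrow> 'a tvec \<Rightarrow> 'a tvec \<Rightarrow> real) \<Rightarrow> bool" where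
  "riemannian_metric X g \<longleftrightarrow>
     (\<forall>a\<in>topspace (topo X). \<forall>u\<in>tangent_space X a. \<forall>v\<in>tangent_space X a.
        g a u v = g a v u \<and>
        (u \<noteq> (\<lambda>f. 0) \<longrightarrow> g a u u > 0) \<and>
        (\<forall>w\<in>tangent_space X a. \<forall>r. g a (\<lambda>f. u f + r * v f) w = g a u w + r * g a v w)) \<and>
     (\<forall>n U c i j. chart n X U c \<and> i < n \<and> j < n \<longrightarrow>
        (\<lambda>a. g a (coord_vector X U c i a) (coord_vector X U c j a)) \<in> smooth_funs X U)"


section \<open>Lie groups\<close>

record 'a lie_group_data = "'a monoid" +
  mfd :: "'a smooth_space"

definition lie_group :: "'a lie_group_data \<Rightarrow> bool" where
  "lie_group G \<longleftrightarrow>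
     group G \<and> (\<exists>n. smooth_manifold n (mfd G)) \<and> topspace (topo (mfd G)) = carrier G \<and>
     smooth_map (prod_space (mfd G) (mfd G)) (mfd G) (\<lambda>(a, b). a \<otimes>\<^bsub>G\<^esub> b) \<and>
     smooth_map (mfd G) (mfd G) (m_inv G)"

definition left_transport :: "'a lie_group_data \<Rightarrow> 'a \<Rightarrow> 'a \<Rightarrow> 'a tvec \<Rightarrow> 'a tvec" where
  "left_transport G a b = differential (mfd G) (mfd G) (\<lambda>x. a \<otimes>\<^bsub>G\<^esub> x) b"

definition left_invariant_field :: "'a lie_group_data \<Rightarrow> 'a tvec \<Rightarrow> 'a \<Rightarrow> 'a tvec" where
  "left_invariant_field G v a = left_transport G a \<one>\<^bsub>G\<^esub> v"

definition field_bracket ::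
    "'a smooth_space \<Rightarrow> ('a \<Rightarrow> 'a tvec) \<Rightarrow> ('a \<Rightarrow> 'a tvec) \<Rightarrow> 'a \<Rightarrow> 'a tvec" where
  "field_bracket X \<xi> \<eta> a =
     (\<lambda>f. if f \<in> smooth_at X a then \<xi> a (\<lambda>x. \<eta> x f) - \<eta> a (\<lambda>x. \<xi> x f) else 0)"

definition riemannian_lie_group ::
    "'a lie_group_data \<Rightarrow> ('a \<Rightarrow> 'a tvec \<Rightarrow> 'a tvec \<Rightarrow> real) \<Rightarrow> bool" where
  "riemannian_lie_group G g \<longleftrightarrow>
     lie_group G \<and> connected_space (topo (mfd G)) \<and> riemannian_metric (mfd G) g \<and>
     (\<forall>a\<in>carrier G. \<forall>b\<in>carrier G. \<forall>u\<in>tangent_space (mfd G) b. \<forall>v\<in>tangent_space (mfd G) b.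
        g (a \<otimes>\<^bsub>G\<^esub> b) (left_transport G a b u) (left_transport G a b v) = g b u v)"

definition quotient_lie_group :: "'a lie_group_data \<Rightarrow> 'a set \<Rightarrow> 'a set lie_group_data" where
  "quotient_lie_group G N =
     monoid.extend (G Mod N) (lie_group_data.fields (quotient_space (mfd G) (\<lambda>a. N #>\<^bsub>G\<^esub> a)))"


section \<open>Euclidean Lie algebras\<close>

text \<open>
  A Lie algebra with an inner product is a real vector space whose product \<open>u \<otimes> v\<close> is the Lie
  bracket \<open>[u, v]\<close>; there is no unit, and the field \<open>one\<close> of the underlying record is never used.
  The tangent space at the identity and its quotients by ideals are both presented in this form.
\<close>

record 'v euclidean_lie_algebra = "(real, 'v) module" +
  ip :: "'v \<Rightarrow> 'v \<Rightarrow> real"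

definition lie_algebra ::
    "'a lie_group_data \<Rightarrow> ('a \<Rightarrow> 'a tvec \<Rightarrow> 'a tvec \<Rightarrow> real) \<Rightarrow> 'a tvec euclidean_lie_algebra" where
  "lie_algebra G g =
     \<lparr>carrier = tangent_space (mfd G) \<one>\<^bsub>G\<^esub>,
      mult = (\<lambda>u v. field_bracket (mfd G) (left_invariant_field G u) (left_invariant_field G v) \<one>\<^bsub>G\<^esub>),
      one = undefined,
      zero = (\<lambda>f. 0),
      add = (\<lambda>u v f. u f + v f),
      smult = (\<lambda>r v f. r * v f),
      ip = g \<one>\<^bsub>G\<^esub>\<rparr>"

definition linear_basis :: "'v euclidean_lie_algebra \<Rightarrow> 'v set \<Rightarrow> bool" where
  "linear_basis L B \<longleftrightarrow> finite B \<and> B \<subseteq> carrier L \<and>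
     (\<forall>v\<in>carrier L. \<exists>!a. a \<in> B \<rightarrow>\<^sub>E UNIV \<and> v = (\<Oplus>\<^bsub>L\<^esub>b\<in>B. a b \<odot>\<^bsub>L\<^esub> b))"

definition basis_coord :: "'v euclidean_lie_algebra \<Rightarrow> 'v set \<Rightarrow> 'v \<Rightarrow> 'v \<Rightarrow> real" where
  "basis_coord L B v = (THE a. a \<in> B \<rightarrow>\<^sub>E UNIV \<and> v = (\<Oplus>\<^bsub>L\<^esub>b\<in>B. a b \<odot>\<^bsub>L\<^esub> b))"

definition endo_trace :: "'v euclidean_lie_algebra \<Rightarrow> ('v \<Rightarrow> 'v) \<Rightarrow> real" where
  "endo_trace L T = (let B = SOME B. linear_basis L B in \<Sum>b\<in>B. basis_coord L B (T b) b)"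

definition orthonormal_basis :: "'v euclidean_lie_algebra \<Rightarrow> 'v set \<Rightarrow> bool" where
  "orthonormal_basis L E \<longleftrightarrow> linear_basis L E \<and>
     (\<forall>e\<in>E. \<forall>f\<in>E. ip L e f = (if e = f then 1 else 0))"

definition levi_civita :: "'v euclidean_lie_algebra \<Rightarrow> 'v \<Rightarrow> 'v \<Rightarrow> 'v" where
  "levi_civita L u v = (THE a. a \<in> carrier L \<and>
     (\<forall>w\<in>carrier L. 2 * ip L a w =
        ip L (u \<otimes>\<^bsub>L\<^esub> v) w + ip L (w \<otimes>\<^bsub>L\<^esub> u) v + ip L (w \<otimes>\<^bsub>L\<^esub> v) u))"

text \<open>
  As with the choice of basis in \<open>endo_trace\<close>, the vectors \<open>U_hom\<close> and \<open>mean_curvature\<close> do not depend on the orthonormal basis chosen.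
\<close>

definition U_hom ::
    "'v euclidean_lie_algebra \<Rightarrow> 'w euclidean_lie_algebra \<Rightarrow> ('v \<Rightarrow> 'w) \<Rightarrow> 'w" where
  "U_hom L M \<xi> =
     (let E = SOME E. orthonormal_basis L E in \<Oplus>\<^bsub>M\<^esub>e\<in>E. levi_civita M (\<xi> e) (\<xi> e))"

definition U_alg :: "'v euclidean_lie_algebra \<Rightarrow> 'v" where
  "U_alg L = (THE u. u \<in> carrier L \<and>
     (\<forall>v\<in>carrier L. ip L u v = endo_trace L (\<lambda>w. v \<otimes>\<^bsub>L\<^esub> w)))"

definition tension ::
    "'v euclidean_lie_algebra \<Rightarrow> 'w euclidean_lie_algebra \<Rightarrow> ('v \<Rightarrow> 'w) \<Rightarrow> 'w" where
  "tension L M \<xi> = U_hom L M \<xi> \<ominus>\<^bsub>M\<^esub> \<xi> (U_alg L)"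

definition mean_curvature :: "'v euclidean_lie_algebra \<Rightarrow> 'v set \<Rightarrow> 'v" where
  "mean_curvature L K =
     (let L0 = L\<lparr>carrier := K\<rparr>; F = SOME F. orthonormal_basis L0 F
      in \<Oplus>\<^bsub>L\<^esub>f\<in>F. (levi_civita L f f \<ominus>\<^bsub>L\<^esub> levi_civita L0 f f))"

definition orth_complement :: "'v euclidean_lie_algebra \<Rightarrow> 'v set \<Rightarrow> 'v set" where
  "orth_complement L K = {v \<in> carrier L. \<forall>k\<in>K. ip L v k = 0}"

definition orth_lift :: "'v euclidean_lie_algebra \<Rightarrow> 'v set \<Rightarrow> 'v set \<Rightarrow> 'v" where
  "orth_lift L K = the_inv_into (orth_complement L K) (\<lambda>v. K +>\<^bsub>L\<^esub> v)"

text \<open>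
  The quotient by an ideal; its ring operations (sum and bracket of cosets) are those of
  \<^const>\<open>FactRing\<close>, its inner product is the pullback along \<open>orth_lift\<close>.
\<close>

definition quotient_lie_algebra ::
    "'v euclidean_lie_algebra \<Rightarrow> 'v set \<Rightarrow> 'v set euclidean_lie_algebra" where
  "quotient_lie_algebra L K =
     \<lparr>carrier = carrier (L Quot K),
      mult = mult (L Quot K),
      one = undefined,
      zero = zero (L Quot K),
      add = add (L Quot K),
      smult = (\<lambda>r C. \<Union>v\<in>C. K +>\<^bsub>L\<^esub> (r \<odot>\<^bsub>L\<^esub> v)),
      ip = (\<lambda>C D. ip L (orth_lift L K C) (orth_lift L K D))\<rparr>"


section \<open>The map induced on the quotient\<close>

definition induced_map ::
    "'a lie_group_data \<Rightarrow> 'b lie_group_data \<Rightarrow> ('a \<Rightarrow> 'b) \<Rightarrow> 'a set \<Rightarrow> 'b" where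
  "induced_map G H \<phi> = (\<lambda>C \<in> carrier (quotient_lie_group G (kernel G H \<phi>)). the_elem (\<phi> ` C))"

text \<open>
  The coset of \<open>v\<close> in \<open>\<gg>/\<gg>\<^sub>0\<close> is identified with the tangent vector at the identity of
  \<open>G/G\<^sub>0\<close> that is the image of \<open>v\<close> under the differential of the projection \<open>G \<rightarrow> G/G\<^sub>0\<close>.
\<close>

definition induced_differential ::
    "'a lie_group_data \<Rightarrow> 'b lie_group_data \<Rightarrow> ('a \<Rightarrow> 'b) \<Rightarrow> 'a tvec set \<Rightarrow> 'b tvec" where
  "induced_differential G H \<phi> =
     (let G0 = kernel G H \<phi>; Q = quotient_lie_group G G0;
          proj_diff = differential (mfd G) (mfd Q) (\<lambda>a. G0 #>\<^bsub>G\<^esub> a) \<one>\<^bsub>G\<^esub>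
      in (\<lambda>C. the_elem
            ((\<lambda>v. differential (mfd Q) (mfd H) (induced_map G H \<phi>) \<one>\<^bsub>Q\<^esub> (proj_diff v)) ` C)))"

end

theory Submission
  imports Defs
begin

text \<open>
  Choose an orthonormal basis of \<open>\<gg>\<close> consisting of one of \<open>\<gg>\<^sub>0 = ker \<xi>\<close> and the horizontal lift of one
  of \<open>\<gg>/\<gg>\<^sub>0\<close>.  The vectors of \<open>\<gg>\<^sub>0\<close> contribute nothing to \<open>U\<^sup>\<xi>\<close>, so it equals the corresponding vector
  for the induced map.  If \<open>v\<close> is orthogonal to \<open>\<gg>\<^sub>0\<close>, then \<open>tr (ad v)\<close> is the sum of its trace on the
  ideal \<open>\<gg>\<^sub>0\<close>, which is \<open>\<langle>H, v\<rangle>\<close>, and its trace on the quotient; so \<open>U\<close> of \<open>\<gg>\<close> projects to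
  \<open>U\<close> of the quotient plus the class of \<open>H\<close>.

  That the tangent space at the identity is a finite-dimensional Lie algebra rests on Hadamard's
  lemma: a derivation at a point is a combination of the coordinate derivatives, whence also the
  smoothness of left invariant fields.
\<close>

section \<open>Euclidean Lie algebras and their quotients\<close>

text \<open>The objects in the formula are given by definite descriptions or by an arbitrary choice
  of basis, so they cannot be computed directly. Each vector is instead characterised by its inner
  products. On the diagonal the Levi-Civita condition reads \<langle>A_u u, w\<rangle> =
  \<langle>[w, u], u\<rangle>; paired with a test vector (a normal one for the mean curvature), the
  vectors become sums of terms \<langle>[w, e], e\<rangle> or \<langle>[w, \<xi> e], \<xi>
  e\<rangle>. These are diagonal sums of bilinear forms, hence the same for every orthonormal basis,
  so an adapted basis may replace the chosen ones and the theorem becomes a comparison of finite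
  sums.

  The carriers are sets of functionals inside a larger type, so finite dimension must be a property
  of the carrier; it is expressed by a bound on the size of orthonormal sets. The algebra takes
  three facts from the groups: the tangent spaces at the identities are such algebras, \<xi> is a
  homomorphism, and the induced differential sends the coset of v to \<xi> v.\<close>

definition orthonormal_set :: "'v euclidean_lie_algebra \<Rightarrow> 'v set \<Rightarrow> bool" where
  "orthonormal_set L E \<longleftrightarrow> finite E \<and> E \<subseteq> carrier L \<and>
     (\<forall>e\<in>E. \<forall>f\<in>E. ip L e f = (if e = f then 1 else 0))"

definition linear_functional :: "'v euclidean_lie_algebra \<Rightarrow> ('v \<Rightarrow> real) \<Rightarrow> bool" where
  "linear_functional L l \<longleftrightarrow>
     (\<forall>u\<in>carrier L. \<forall>v\<in>carrier L. l (u \<oplus>\<^bsub>L\<^esub> v) = l u + l v) \<and>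
     (\<forall>r. \<forall>u\<in>carrier L. l (r \<odot>\<^bsub>L\<^esub> u) = r * l u)"

text \<open>The last axiom is finite dimension, phrased through the inner product alone. In this
  form it restricts to subspaces, passes to quotients by lifting orthonormal sets, and holds in a
  tangent space because more than n vectors there are linearly dependent.\<close>

locale euclidean_algebra = abelian_group L for L :: "'v euclidean_lie_algebra" (structure) +
  assumes smult_closed [simp, intro]: "v \<in> carrier L \<Longrightarrow> r \<odot> v \<in> carrier L"
    and smult_l_distr: "v \<in> carrier L \<Longrightarrow> (r + s) \<odot> v = r \<odot> v \<oplus> s \<odot> v"
    and smult_r_distr: "u \<in> carrier L \<Longrightarrow> v \<in> carrier L \<Longrightarrow> r \<odot> (u \<oplus> v) = r \<odot> u \<oplus> r \<odot> v"
    and smult_assoc: "v \<in> carrier L \<Longrightarrow> (r * s) \<odot> v = r \<odot> (s \<odot> v)"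
    and smult_one: "v \<in> carrier L \<Longrightarrow> 1 \<odot> v = v"
    and bracket_closed [simp, intro]: "u \<in> carrier L \<Longrightarrow> v \<in> carrier L \<Longrightarrow> u \<otimes> v \<in> carrier L"
    and bracket_add_left: "u \<in> carrier L \<Longrightarrow> v \<in> carrier L \<Longrightarrow> w \<in> carrier L \<Longrightarrow>
      (u \<oplus> v) \<otimes> w = u \<otimes> w \<oplus> v \<otimes> w"
    and bracket_add_right: "u \<in> carrier L \<Longrightarrow> v \<in> carrier L \<Longrightarrow> w \<in> carrier L \<Longrightarrow>
      w \<otimes> (u \<oplus> v) = w \<otimes> u \<oplus> w \<otimes> v"
    and bracket_smult_left: "u \<in> carrier L \<Longrightarrow> v \<in> carrier L \<Longrightarrow> (r \<odot> u) \<otimes> v = r \<odot> (u \<otimes> v)"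
    and bracket_smult_right: "u \<in> carrier L \<Longrightarrow> v \<in> carrier L \<Longrightarrow> u \<otimes> (r \<odot> v) = r \<odot> (u \<otimes> v)"
    and bracket_self: "u \<in> carrier L \<Longrightarrow> u \<otimes> u = \<zero>"
    and ip_sym: "u \<in> carrier L \<Longrightarrow> v \<in> carrier L \<Longrightarrow> ip L u v = ip L v u"
    and ip_pos: "u \<in> carrier L \<Longrightarrow> u \<noteq> \<zero> \<Longrightarrow> ip L u u > 0"
    and ip_add_left: "u \<in> carrier L \<Longrightarrow> v \<in> carrier L \<Longrightarrow> w \<in> carrier L \<Longrightarrow>
      ip L (u \<oplus> v) w = ip L u w + ip L v w"
    and ip_smult_left: "u \<in> carrier L \<Longrightarrow> w \<in> carrier L \<Longrightarrow> ip L (r \<odot> u) w = r * ip L u w"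
    and orthonormal_set_bounded: "\<exists>n. \<forall>E. orthonormal_set L E \<longrightarrow> card E \<le> n"
begin

section \<open>Additive functionals and the inner product\<close>

lemma functional_zero:
  assumes "\<And>u v. u \<in> carrier L \<Longrightarrow> v \<in> carrier L \<Longrightarrow> l (u \<oplus> v) = l u + (l v :: real)"
  shows "l \<zero> = 0"
  using assms[of \<zero> \<zero>] by simp

lemma functional_minus:
  assumes "\<And>u v. u \<in> carrier L \<Longrightarrow> v \<in> carrier L \<Longrightarrow> l (u \<oplus> v) = l u + (l v :: real)"
    and "u \<in> carrier L" "v \<in> carrier L"
  shows "l (u \<ominus> v) = l u - l v"
proof -
  have "u = (u \<ominus> v) \<oplus> v" using assms(2,3) by (simp add: minus_eq a_assoc l_neg)
  then have "l u = l (u \<ominus> v) + l v" using assms by (metis minus_closed)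
  then show ?thesis by simp
qed

lemma functional_finsum:
  assumes "\<And>u v. u \<in> carrier L \<Longrightarrow> v \<in> carrier L \<Longrightarrow> l (u \<oplus> v) = l u + (l v :: real)"
    and "finite A" "f \<in> A \<rightarrow> carrier L"
  shows "l (\<Oplus>a\<in>A. f a) = (\<Sum>a\<in>A. l (f a))"
  using assms(2,3)
proof (induction A rule: finite_induct)
  case empty
  then show ?case using functional_zero[of l] assms(1) by simp
next
  case (insert x A)
  then show ?case using assms(1) by (simp add: Pi_iff)
qed

lemma linear_functional_finsum:
  assumes "linear_functional L l" "finite A" "A \<subseteq> carrier L"
  shows "l (\<Oplus>b\<in>A. c b \<odot> b) = (\<Sum>b\<in>A. c b * l b)"
proof -
  have "l (\<Oplus>b\<in>A. c b \<odot> b) = (\<Sum>b\<in>A. l (c b \<odot> b))"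
    using assms by (intro functional_finsum) (auto simp: linear_functional_def)
  also have "\<dots> = (\<Sum>b\<in>A. c b * l b)"
    using assms by (intro sum.cong) (auto simp: linear_functional_def)
  finally show ?thesis .
qed

lemma combination_closed [simp, intro]:
  "A \<subseteq> carrier L \<Longrightarrow> (\<Oplus>b\<in>A. c b \<odot> b) \<in> carrier L"
  by (intro finsum_closed) auto

lemma minus_eq_zeroD:
  assumes "u \<in> carrier L" "v \<in> carrier L" "u \<ominus> v = \<zero>"
  shows "u = v"
proof -
  have "u = (u \<ominus> v) \<oplus> v" using assms(1,2) by (simp add: minus_eq a_assoc l_neg)
  then show ?thesis using assms by simp
qed

lemma linear_functional_ip: "w \<in> carrier L \<Longrightarrow> linear_functional L (\<lambda>u. ip L u w)"
  by (simp add: linear_functional_def ip_add_left ip_smult_left)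

lemma ip_add_right:
  "u \<in> carrier L \<Longrightarrow> v \<in> carrier L \<Longrightarrow> w \<in> carrier L \<Longrightarrow> ip L w (u \<oplus> v) = ip L w u + ip L w v"
  by (metis add.m_closed ip_add_left ip_sym)

lemma ip_smult_right:
  "u \<in> carrier L \<Longrightarrow> w \<in> carrier L \<Longrightarrow> ip L w (r \<odot> u) = r * ip L w u"
  by (metis smult_closed ip_smult_left ip_sym)

lemma ip_minus_left:
  "u \<in> carrier L \<Longrightarrow> v \<in> carrier L \<Longrightarrow> w \<in> carrier L \<Longrightarrow> ip L (u \<ominus> v) w = ip L u w - ip L v w"
  by (rule functional_minus) (auto simp: ip_add_left)

lemma ip_zero_left [simp]: "w \<in> carrier L \<Longrightarrow> ip L \<zero> w = 0"
  by (rule functional_zero) (auto simp: ip_add_left)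

lemma ip_zero_right [simp]: "w \<in> carrier L \<Longrightarrow> ip L w \<zero> = 0"
  by (rule functional_zero) (auto simp: ip_add_right)

lemma ip_self_eq_zero: "u \<in> carrier L \<Longrightarrow> ip L u u = 0 \<Longrightarrow> u = \<zero>"
  using ip_pos by force

text \<open>Positive definiteness applied to u - v. The main vector identities below are proved by
  testing against all w in this way, and so are scalar laws such as
  \<open>0 \<odot> v = \<zero>\<close>.\<close>

lemma ip_eqI:
  assumes "u \<in> carrier L" "v \<in> carrier L" "\<And>w. w \<in> carrier L \<Longrightarrow> ip L u w = ip L v w"
  shows "u = v"
proof -
  have "u \<ominus> v = \<zero>" using assms by (intro ip_self_eq_zero) (simp_all add: ip_minus_left)
  then show ?thesis using assms minus_eq_zeroD by blast
qed

section \<open>Orthonormal bases and the Riesz representation\<close>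

lemma ip_combination_orthonormal:
  assumes "orthonormal_set L E" "f \<in> E"
  shows "ip L (\<Oplus>e\<in>E. c e \<odot> e) f = c f"
proof -
  have "ip L (\<Oplus>e\<in>E. c e \<odot> e) f = (\<Sum>e\<in>E. c e * ip L e f)"
    using assms by (intro linear_functional_finsum[OF linear_functional_ip]) (auto simp: orthonormal_set_def)
  also have "\<dots> = (\<Sum>e\<in>E. if e = f then c e else 0)"
    using assms by (intro sum.cong) (auto simp: orthonormal_set_def)
  finally show ?thesis using assms by (simp add: orthonormal_set_def)
qed

text \<open>Subtracting from v its expansion with coefficients \<langle>v, e\<rangle> leaves a
  vector orthogonal to E, which must vanish. Pairing any expansion with e recovers the coefficient
  of e, so the expansion is unique.\<close>

lemma orthonormal_basisI:
  assumes E: "orthonormal_set L E"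
    and complete: "\<And>v. v \<in> carrier L \<Longrightarrow> (\<And>e. e \<in> E \<Longrightarrow> ip L v e = 0) \<Longrightarrow> v = \<zero>"
  shows "orthonormal_basis L E"
  unfolding orthonormal_basis_def linear_basis_def
proof (intro conjI ballI)
  show fin: "finite E" and sub: "E \<subseteq> carrier L" using E by (auto simp: orthonormal_set_def)
  show "ip L e f = (if e = f then 1 else 0)" if "e \<in> E" "f \<in> E" for e f
    using E that by (auto simp: orthonormal_set_def)
  fix v assume v: "v \<in> carrier L"
  show "\<exists>!a. a \<in> E \<rightarrow>\<^sub>E UNIV \<and> v = (\<Oplus>b\<in>E. a b \<odot> b)"
  proof (rule ex1I)
    \<comment> \<open>Coordinate functions in \<open>linear_basis\<close> are extensional; without
      the restriction to E they would not be unique.\<close>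
    let ?a = "restrict (\<lambda>e. ip L v e) E"
    let ?u = "\<Oplus>b\<in>E. ?a b \<odot> b"
    have "v \<ominus> ?u = \<zero>"
      using v sub by (intro complete) (auto simp: ip_minus_left ip_combination_orthonormal[OF E] subset_iff)
    then have "v = ?u" by (rule minus_eq_zeroD[OF v combination_closed[OF sub]])
    then show "?a \<in> E \<rightarrow>\<^sub>E UNIV \<and> v = ?u" by simp
    fix a assume "a \<in> E \<rightarrow>\<^sub>E UNIV \<and> v = (\<Oplus>b\<in>E. a b \<odot> b)"
    then show "a = ?a"
      using ip_combination_orthonormal[OF E, of _ a] by (intro PiE_ext[of _ E "\<lambda>_. UNIV"]) auto
  qed
qed

lemma orthonormal_basisD:
  assumes "orthonormal_basis L E"
  shows "orthonormal_set L E" "finite E" "E \<subseteq> carrier L"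
  using assms by (auto simp: orthonormal_basis_def orthonormal_set_def linear_basis_def)

lemma orthonormal_basis_expand:
  assumes "orthonormal_basis L E" "v \<in> carrier L"
  shows "(\<Oplus>e\<in>E. ip L v e \<odot> e) = v"
proof -
  note E = orthonormal_basisD[OF assms(1)]
  obtain a where a: "v = (\<Oplus>b\<in>E. a b \<odot> b)"
    using assms unfolding orthonormal_basis_def linear_basis_def by blast
  have "ip L v e = a e" if "e \<in> E" for e
    unfolding a by (rule ip_combination_orthonormal[OF E(1) that])
  then have "(\<Oplus>e\<in>E. ip L v e \<odot> e) = (\<Oplus>e\<in>E. a e \<odot> e)"
    using E by (intro finsum_cong) (auto simp: simp_implies_def)
  then show ?thesis using a by simp
qed

lemma orthonormal_basis_complete:
  assumes "orthonormal_basis L E" "v \<in> carrier L" "\<And>e. e \<in> E \<Longrightarrow> ip L v e = 0"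
  shows "v = \<zero>"
proof -
  note E = orthonormal_basisD[OF assms(1)]
  have "ip L v v = ip L (\<Oplus>e\<in>E. ip L v e \<odot> e) v" 
    using orthonormal_basis_expand[OF assms(1,2)] by simp
  also have "\<dots> = (\<Sum>e\<in>E. ip L v e * ip L e v)"
    using E assms by (intro linear_functional_finsum linear_functional_ip) auto
  also have "\<dots> = 0" using assms(3) by simp
  finally show ?thesis using assms ip_self_eq_zero by blast
qed

text \<open>An orthonormal set of maximal size is complete: a nonzero vector orthogonal to it could
  be normalised and added.\<close>

lemma orthonormal_basis_exists: "\<exists>E. orthonormal_basis L E"
proof -
  obtain n where n: "\<And>E. orthonormal_set L E \<Longrightarrow> card E \<le> n" using orthonormal_set_bounded by blast
  define E where "E = arg_max card (orthonormal_set L)"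
  have "orthonormal_set L {}" by (simp add: orthonormal_set_def)
  \<comment> \<open>The rule wants a strict upper bound on the maximised quantity, hence
    \<open>Suc n\<close>.\<close>
  then have "orthonormal_set L E \<and> (\<forall>F. orthonormal_set L F \<longrightarrow> card F \<le> card E)"
    unfolding E_def by (rule arg_max_nat_lemma[where b = "Suc n"]) (use n in \<open>auto simp: less_Suc_eq_le\<close>)
  then have E: "orthonormal_set L E"
    and max: "\<And>F. orthonormal_set L F \<Longrightarrow> card F \<le> card E" by blast+
  have fin: "finite E" and sub: "E \<subseteq> carrier L"
    and orth: "\<And>e f. e \<in> E \<Longrightarrow> f \<in> E \<Longrightarrow> ip L e f = (if e = f then 1 else 0)"
    using E by (auto simp: orthonormal_set_def)
  have "orthonormal_basis L E"
  proof (rule orthonormal_basisI[OF E], rule ccontr)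
    fix v assume v: "v \<in> carrier L" "\<And>e. e \<in> E \<Longrightarrow> ip L v e = 0" "v \<noteq> \<zero>"
    define u where "u = (1 / sqrt (ip L v v)) \<odot> v"
    have pos: "ip L v v > 0" using v ip_pos by blast
    have u: "u \<in> carrier L" "ip L u u = 1"
      using v(1) pos by (auto simp: u_def ip_smult_left ip_smult_right field_simps)
    have ue: "ip L u e = 0" "ip L e u = 0" if "e \<in> E" for e
      using v that sub by (auto simp: u_def ip_smult_left ip_smult_right ip_sym[of e v] subset_iff)
    have "u \<notin> E" using ue u by force
    moreover have "orthonormal_set L (insert u E)"
      unfolding orthonormal_set_def using fin sub u ue \<open>u \<notin> E\<close> orth by auto
    ultimately show False using max[of "insert u E"] fin by simp
  qed
  then show ?thesis by blast
qed

lemma some_orthonormal_basis: "orthonormal_basis L (SOME E. orthonormal_basis L E)"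
  using orthonormal_basis_exists by (rule someI_ex)

text \<open>The representing vector is the combination of the e with coefficients l e. The
  unique-existence form is what resolves the definite descriptions in \<open>levi_civita\<close> and
  \<open>U_alg\<close>.\<close>

lemma riesz:
  assumes "linear_functional L l"
  shows "\<exists>!u. u \<in> carrier L \<and> (\<forall>w\<in>carrier L. ip L u w = l w)"
proof (rule ex_ex1I)
  obtain E where E: "orthonormal_basis L E" using orthonormal_basis_exists by blast
  note E' = orthonormal_basisD[OF E]
  let ?u = "\<Oplus>e\<in>E. l e \<odot> e"
  have "ip L ?u w = l w" if w: "w \<in> carrier L" for w
  proof -
    have "ip L ?u w = (\<Sum>e\<in>E. l e * ip L e w)"
      using E' w by (intro linear_functional_finsum linear_functional_ip) auto
    also have "\<dots> = (\<Sum>e\<in>E. ip L w e * l e)"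
      using E' w by (intro sum.cong) (auto simp: ip_sym[of _ w] subset_iff)
    also have "\<dots> = l (\<Oplus>e\<in>E. ip L w e \<odot> e)"
      using E' assms by (simp add: linear_functional_finsum)
    finally show ?thesis using orthonormal_basis_expand[OF E w] by simp
  qed
  then show "\<exists>u. u \<in> carrier L \<and> (\<forall>w\<in>carrier L. ip L u w = l w)" using E' by blast
next
  fix u v
  assume "u \<in> carrier L \<and> (\<forall>w\<in>carrier L. ip L u w = l w)"
    and "v \<in> carrier L \<and> (\<forall>w\<in>carrier L. ip L v w = l w)"
  then show "u = v" by (intro ip_eqI) auto
qed

text \<open>With both arguments equal, [u, u] vanishes and the two remaining terms of the defining
  condition coincide, which cancels the factor 2. The tension field and the mean curvature involve
  only this diagonal.\<close>

lemma levi_civita_self: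
  assumes u: "u \<in> carrier L"
  shows "levi_civita L u u \<in> carrier L"
    and "w \<in> carrier L \<Longrightarrow> ip L (levi_civita L u u) w = ip L (w \<otimes> u) u"
proof -
  let ?P = "\<lambda>a. a \<in> carrier L \<and> (\<forall>w\<in>carrier L. ip L a w = ip L (w \<otimes> u) u)"
  have "linear_functional L (\<lambda>w. ip L (w \<otimes> u) u)"
    using u by (simp add: linear_functional_def ip_add_left ip_smult_left bracket_add_left bracket_smult_left)
  from riesz[OF this] have ex: "\<exists>!a. ?P a" .
  have "levi_civita L u u = (THE a. ?P a)"
    unfolding levi_civita_def using u by (intro arg_cong[where f=The] ext) (auto simp: bracket_self)
  with theI'[OF ex] have "?P (levi_civita L u u)" by metis
  then show "levi_civita L u u \<in> carrier L"
    and "w \<in> carrier L \<Longrightarrow> ip L (levi_civita L u u) w = ip L (w \<otimes> u) u" by auto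
qed

section \<open>Coordinates and traces\<close>

lemma basis_coord_eqI:
  assumes "linear_basis L B" "a \<in> B \<rightarrow>\<^sub>E UNIV" "(\<Oplus>b\<in>B. a b \<odot> b) = v"
  shows "basis_coord L B v = a"
proof -
  have v: "v \<in> carrier L" using assms by (auto simp: linear_basis_def)
  then have "\<exists>!a. a \<in> B \<rightarrow>\<^sub>E UNIV \<and> v = (\<Oplus>b\<in>B. a b \<odot> b)"
    using assms by (auto simp: linear_basis_def)
  then show ?thesis unfolding basis_coord_def using assms by (intro the1_equality) auto
qed

lemma basis_coord:
  assumes "linear_basis L B" "v \<in> carrier L"
  shows "basis_coord L B v \<in> B \<rightarrow>\<^sub>E UNIV" "(\<Oplus>b\<in>B. basis_coord L B v b \<odot> b) = v"
proof -
  have "\<exists>!a. a \<in> B \<rightarrow>\<^sub>E UNIV \<and> v = (\<Oplus>b\<in>B. a b \<odot> b)"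
    using assms by (auto simp: linear_basis_def)
  from theI'[OF this] show "basis_coord L B v \<in> B \<rightarrow>\<^sub>E UNIV" "(\<Oplus>b\<in>B. basis_coord L B v b \<odot> b) = v"
    unfolding basis_coord_def by auto
qed

lemma finsum_smult:
  assumes "finite A" "f \<in> A \<rightarrow> carrier L"
  shows "r \<odot> (\<Oplus>a\<in>A. f a) = (\<Oplus>a\<in>A. r \<odot> f a)"
proof -
  have z: "r \<odot> \<zero> = \<zero>"
    by (rule ip_eqI) (auto simp: ip_smult_left)
  show ?thesis using assms
    by (induction A rule: finite_induct) (auto simp: z Pi_iff smult_r_distr)
qed

lemma linear_functional_basis_coord:
  assumes B: "linear_basis L B" and b: "b \<in> B"
  shows "linear_functional L (\<lambda>v. basis_coord L B v b)"
  unfolding linear_functional_def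
proof (intro conjI ballI allI)
  have fin: "finite B" and sub: "B \<subseteq> carrier L" using B by (auto simp: linear_basis_def)
  fix u assume u: "u \<in> carrier L"
  note cu = basis_coord[OF B u]
  {
    fix v assume v: "v \<in> carrier L"
    note cv = basis_coord[OF B v]
    let ?a = "restrict (\<lambda>b. basis_coord L B u b + basis_coord L B v b) B"
    have "(\<Oplus>b\<in>B. ?a b \<odot> b) = (\<Oplus>b\<in>B. basis_coord L B u b \<odot> b \<oplus> basis_coord L B v b \<odot> b)"
      using sub by (intro finsum_cong') (auto simp: smult_l_distr)
    also have "\<dots> = (\<Oplus>b\<in>B. basis_coord L B u b \<odot> b) \<oplus> (\<Oplus>b\<in>B. basis_coord L B v b \<odot> b)"
      using sub by (intro finsum_addf) auto
    finally have "basis_coord L B (u \<oplus> v) = ?a"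
      using cu cv by (intro basis_coord_eqI[OF B]) auto
    then show "basis_coord L B (u \<oplus> v) b = basis_coord L B u b + basis_coord L B v b"
      using b by simp
  }
  fix r
  let ?a = "restrict (\<lambda>b. r * basis_coord L B u b) B"
  have "(\<Oplus>b\<in>B. ?a b \<odot> b) = (\<Oplus>b\<in>B. r \<odot> (basis_coord L B u b \<odot> b))"
    using sub by (intro finsum_cong') (auto simp: smult_assoc)
  also have "\<dots> = r \<odot> (\<Oplus>b\<in>B. basis_coord L B u b \<odot> b)"
    using sub fin by (intro finsum_smult[symmetric]) auto
  finally have "basis_coord L B (r \<odot> u) = ?a"
    using cu by (intro basis_coord_eqI[OF B]) auto
  then show "basis_coord L B (r \<odot> u) b = r * basis_coord L B u b"
    using b by simp
qed

text \<open>The trace is defined with some unknown linear basis B. Expand each b in E, swap the two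
  sums, and reassemble T e from its coordinates in B; what remains refers to E alone.\<close>

lemma endo_trace_orthonormal:
  assumes E: "orthonormal_basis L E"
    and T: "\<And>v. v \<in> carrier L \<Longrightarrow> T v \<in> carrier L"
      "\<And>u v. u \<in> carrier L \<Longrightarrow> v \<in> carrier L \<Longrightarrow> T (u \<oplus> v) = T u \<oplus> T v"
      "\<And>r v. v \<in> carrier L \<Longrightarrow> T (r \<odot> v) = r \<odot> T v"
  shows "endo_trace L T = (\<Sum>e\<in>E. ip L (T e) e)"
proof -
  note E' = orthonormal_basisD[OF E]
  define B where "B = (SOME B. linear_basis L B)"
  have "\<exists>B. linear_basis L B" using E by (auto simp: orthonormal_basis_def)
  then have B: "linear_basis L B" unfolding B_def by (rule someI_ex)
  have fin: "finite B" and sub: "B \<subseteq> carrier L" using B by (auto simp: linear_basis_def)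
  have "endo_trace L T = (\<Sum>b\<in>B. basis_coord L B (T b) b)"
    by (simp add: endo_trace_def B_def Let_def)
  also have "\<dots> = (\<Sum>b\<in>B. \<Sum>e\<in>E. ip L b e * basis_coord L B (T e) b)"
  proof (rule sum.cong[OF refl])
    fix b assume b: "b \<in> B"
    have "linear_functional L (\<lambda>v. basis_coord L B (T v) b)"
      using linear_functional_basis_coord[OF B b] T by (auto simp: linear_functional_def)
    from linear_functional_finsum[OF this E'(2,3), of "ip L b"]
    show "basis_coord L B (T b) b = (\<Sum>e\<in>E. ip L b e * basis_coord L B (T e) b)"
      using orthonormal_basis_expand[OF E, of b] b sub by auto
  qed
  also have "\<dots> = (\<Sum>e\<in>E. \<Sum>b\<in>B. basis_coord L B (T e) b * ip L b e)"
    by (subst sum.swap) (simp add: mult.commute)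
  also have "\<dots> = (\<Sum>e\<in>E. ip L (T e) e)"
  proof (rule sum.cong[OF refl])
    fix e assume e: "e \<in> E"
    then have eL: "e \<in> carrier L" using E' by blast
    from linear_functional_finsum[OF linear_functional_ip[OF eL] fin sub, of "basis_coord L B (T e)"]
    show "(\<Sum>b\<in>B. basis_coord L B (T e) b * ip L b e) = ip L (T e) e"
      using basis_coord[OF B T(1)[OF eL]] by simp
  qed
  finally show ?thesis .
qed

lemma U_alg_props:
  assumes E: "orthonormal_basis L E"
  shows "U_alg L \<in> carrier L"
    and "v \<in> carrier L \<Longrightarrow> ip L (U_alg L) v = (\<Sum>e\<in>E. ip L (v \<otimes> e) e)"
proof -
  note E' = orthonormal_basisD[OF E]
  have tr: "endo_trace L (\<lambda>w. v \<otimes> w) = (\<Sum>e\<in>E. ip L (v \<otimes> e) e)" if "v \<in> carrier L" for v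
    using that by (intro endo_trace_orthonormal[OF E]) (auto simp: bracket_add_right bracket_smult_right)
  have "linear_functional L (\<lambda>v. endo_trace L (\<lambda>w. v \<otimes> w))"
    unfolding linear_functional_def using E'(3)
    by (auto simp: tr sum.distrib[symmetric] sum_distrib_left bracket_add_left bracket_smult_left
        ip_add_left ip_smult_left subset_iff intro!: sum.cong)
  from theI'[OF riesz[OF this]] show "U_alg L \<in> carrier L"
    and "v \<in> carrier L \<Longrightarrow> ip L (U_alg L) v = (\<Sum>e\<in>E. ip L (v \<otimes> e) e)"
    using tr unfolding U_alg_def by auto
qed

text \<open>Expand e in F in the second argument, then use the symmetry \<langle>e, f\<rangle> =
  \<langle>f, e\<rangle> to contract over E in the first. This is why the basis chosen inside
  \<open>U_hom\<close> can be exchanged for any other.\<close>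

lemma bilinear_trace_unique:
  assumes E: "orthonormal_basis L E" and F: "orthonormal_basis L F"
    and left: "\<And>w. w \<in> carrier L \<Longrightarrow> linear_functional L (\<lambda>v. \<beta> v w)"
    and right: "\<And>w. w \<in> carrier L \<Longrightarrow> linear_functional L (\<beta> w)"
  shows "(\<Sum>e\<in>E. \<beta> e e) = (\<Sum>f\<in>F. \<beta> f f)"
proof -
  note E' = orthonormal_basisD[OF E] and F' = orthonormal_basisD[OF F]
  have "(\<Sum>e\<in>E. \<beta> e e) = (\<Sum>e\<in>E. \<Sum>f\<in>F. ip L e f * \<beta> e f)"
  proof (rule sum.cong[OF refl])
    fix e assume "e \<in> E"
    then have e: "e \<in> carrier L" using E' by blast
    from linear_functional_finsum[OF right[OF e] F'(2,3), of "ip L e"]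
    show "\<beta> e e = (\<Sum>f\<in>F. ip L e f * \<beta> e f)" using orthonormal_basis_expand[OF F e] by simp
  qed
  also have "\<dots> = (\<Sum>f\<in>F. \<Sum>e\<in>E. ip L f e * \<beta> e f)"
    using E'(3) F'(3) by (subst sum.swap) (auto intro!: sum.cong simp: ip_sym subset_iff)
  also have "\<dots> = (\<Sum>f\<in>F. \<beta> f f)"
  proof (rule sum.cong[OF refl])
    fix f assume "f \<in> F"
    then have f: "f \<in> carrier L" using F' by blast
    from linear_functional_finsum[OF left[OF f] E'(2,3), of "ip L f"]
    show "(\<Sum>e\<in>E. ip L f e * \<beta> e f) = \<beta> f f" using orthonormal_basis_expand[OF E f] by simp
  qed
  finally show ?thesis .
qed

lemma smult_zero_left: "v \<in> carrier L \<Longrightarrow> 0 \<odot> v = \<zero>"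
  by (rule ip_eqI) (auto simp: ip_smult_left)

lemma smult_zero_right [simp]: "r \<odot> \<zero> = \<zero>"
  by (rule ip_eqI) (auto simp: ip_smult_left)

lemma smult_uminus: "v \<in> carrier L \<Longrightarrow> (-1) \<odot> v \<oplus> v = \<zero>"
  by (rule ip_eqI) (auto simp: ip_smult_left ip_add_left)

lemma smult_minus_one: "v \<in> carrier L \<Longrightarrow> (-1) \<odot> v = \<ominus> v"
  by (metis minus_equality smult_closed smult_uminus)

lemma smult_minus: 
  "u \<in> carrier L \<Longrightarrow> v \<in> carrier L \<Longrightarrow> r \<odot> (u \<ominus> v) = r \<odot> u \<ominus> r \<odot> v"
  by (rule ip_eqI) (auto simp: ip_smult_left ip_minus_left algebra_simps)

lemma minus_add_cancel: "u \<in> carrier L \<Longrightarrow> v \<in> carrier L \<Longrightarrow> (u \<ominus> v) \<oplus> v = u"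
  by (simp add: minus_eq a_assoc l_neg)

lemma orth_complementD:
  assumes "n \<in> orth_complement L K"
  shows "n \<in> carrier L" "k \<in> K \<Longrightarrow> ip L n k = 0"
  using assms by (auto simp: orth_complement_def)

text \<open>Paired with w, the chosen sum is the diagonal sum of the bilinear form
  \<langle>[w, \<xi> u], \<xi> v\<rangle>, which does not depend on the basis.\<close>

lemma U_hom_props:
  fixes M :: "'w euclidean_lie_algebra"
  assumes "euclidean_algebra M"
    and \<xi>: "\<And>v. v \<in> carrier L \<Longrightarrow> \<xi> v \<in> carrier M"
      "\<And>u v. u \<in> carrier L \<Longrightarrow> v \<in> carrier L \<Longrightarrow> \<xi> (u \<oplus> v) = \<xi> u \<oplus>\<^bsub>M\<^esub> \<xi> v"
      "\<And>r v. v \<in> carrier L \<Longrightarrow> \<xi> (r \<odot> v) = r \<odot>\<^bsub>M\<^esub> \<xi> v"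
    and E: "orthonormal_basis L E"
  shows "U_hom L M \<xi> \<in> carrier M"
    and "w \<in> carrier M \<Longrightarrow> ip M (U_hom L M \<xi>) w = (\<Sum>e\<in>E. ip M (w \<otimes>\<^bsub>M\<^esub> \<xi> e) (\<xi> e))"
proof -
  interpret M: euclidean_algebra M by fact
  define F where "F = (SOME F. orthonormal_basis L F)"
  have F: "orthonormal_basis L F" unfolding F_def by (rule some_orthonormal_basis)
  note F' = orthonormal_basisD[OF F]
  have U: "U_hom L M \<xi> = (\<Oplus>\<^bsub>M\<^esub>e\<in>F. levi_civita M (\<xi> e) (\<xi> e))"
    by (simp add: U_hom_def F_def Let_def)
  have cl: "(\<lambda>e. levi_civita M (\<xi> e) (\<xi> e)) \<in> F \<rightarrow> carrier M"
    using F' \<xi>(1) M.levi_civita_self(1) by blast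
  then show "U_hom L M \<xi> \<in> carrier M" unfolding U by (rule M.finsum_closed)
  assume w: "w \<in> carrier M"
  have "ip M (U_hom L M \<xi>) w = (\<Sum>e\<in>F. ip M (levi_civita M (\<xi> e) (\<xi> e)) w)"
    unfolding U using w F'(2) cl by (intro M.functional_finsum) (auto simp: M.ip_add_left)
  also have "\<dots> = (\<Sum>e\<in>F. ip M (w \<otimes>\<^bsub>M\<^esub> \<xi> e) (\<xi> e))"
    using w F' \<xi>(1) by (intro sum.cong) (auto simp: M.levi_civita_self(2) subset_iff)
  also have "\<dots> = (\<Sum>e\<in>E. ip M (w \<otimes>\<^bsub>M\<^esub> \<xi> e) (\<xi> e))"
    using w \<xi> by (intro bilinear_trace_unique[OF F E, of "\<lambda>u v. ip M (w \<otimes>\<^bsub>M\<^esub> \<xi> u) (\<xi> v)"])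
     (auto simp: linear_functional_def M.bracket_add_right M.bracket_smult_right 
        M.ip_add_left M.ip_add_right M.ip_smult_left M.ip_smult_right)
  finally show "ip M (U_hom L M \<xi>) w = (\<Sum>e\<in>E. ip M (w \<otimes>\<^bsub>M\<^esub> \<xi> e) (\<xi> e))" .
qed

end

section \<open>Ideals, orthogonal projection and mean curvature\<close>

locale euclidean_ideal = euclidean_algebra L for L :: "'v euclidean_lie_algebra" (structure) +
  fixes K :: "'v set"
  assumes K_subset: "K \<subseteq> carrier L"
    and K_zero: "\<zero> \<in> K"
    and K_add: "u \<in> K \<Longrightarrow> v \<in> K \<Longrightarrow> u \<oplus> v \<in> K"
    and K_smult: "u \<in> K \<Longrightarrow> r \<odot> u \<in> K"
    and K_bracket_left: "u \<in> K \<Longrightarrow> v \<in> carrier L \<Longrightarrow> u \<otimes> v \<in> K"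
    and K_bracket_right: "u \<in> carrier L \<Longrightarrow> v \<in> K \<Longrightarrow> u \<otimes> v \<in> K"
begin

abbreviation K_algebra :: "'v euclidean_lie_algebra" where
  "K_algebra \<equiv> L\<lparr>carrier := K\<rparr>"

lemma K_carrier [simp]: "u \<in> K \<Longrightarrow> u \<in> carrier L"
  using K_subset by blast

lemma abelian_group_K: "abelian_group K_algebra"
proof (rule abelian_groupI)
  fix u assume "u \<in> carrier K_algebra"
  then show "\<exists>v\<in>carrier K_algebra. v \<oplus>\<^bsub>K_algebra\<^esub> u = \<zero>\<^bsub>K_algebra\<^esub>"
    using K_smult[of u "-1"] smult_uminus[of u] by auto
qed (simp_all add: K_zero K_add a_assoc, simp add: a_comm)

lemma euclidean_algebra_K: "euclidean_algebra K_algebra"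
proof (rule euclidean_algebra.intro[OF abelian_group_K], unfold_locales)
  obtain n where n: "\<And>E. orthonormal_set L E \<Longrightarrow> card E \<le> n" using orthonormal_set_bounded by blast
  have "orthonormal_set K_algebra E \<Longrightarrow> orthonormal_set L E" for E
    using K_subset by (auto simp: orthonormal_set_def)
  with n show "\<exists>n. \<forall>E. orthonormal_set K_algebra E \<longrightarrow> card E \<le> n" by blast
next
  fix u v assume "u \<in> carrier K_algebra" "v \<in> carrier K_algebra"
  then show "ip K_algebra u v = ip K_algebra v u" by (simp add: ip_sym)
qed (simp_all add: K_smult K_add K_bracket_left K_zero smult_l_distr smult_r_distr smult_assoc smult_one
    bracket_add_left bracket_add_right bracket_smult_left bracket_smult_right bracket_self
    ip_pos ip_add_left ip_smult_left)

text \<open>The tangential part of v is the vector of K that represents the restriction to K of the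
  functional \<langle>v, -\<rangle>, by Riesz in K itself.\<close>

lemma orth_projection:
  assumes v: "v \<in> carrier L"
  obtains n where "n \<in> orth_complement L K" "v \<ominus> n \<in> K"
proof -
  interpret K: euclidean_algebra K_algebra by (rule euclidean_algebra_K)
  have "linear_functional K_algebra (ip L v)"
    using v by (simp add: linear_functional_def ip_add_right ip_smult_right)
  from K.riesz[OF this] obtain k where k: "k \<in> K" "\<And>w. w \<in> K \<Longrightarrow> ip L k w = ip L v w" by auto
  have "v \<ominus> k \<in> orth_complement L K"
    using v k by (auto simp: orth_complement_def ip_minus_left)
  moreover have "v \<ominus> (v \<ominus> k) = k" using v k
    by (intro ip_eqI) (auto simp: ip_minus_left)
  ultimately show thesis using that[of "v \<ominus> k"] k by simp
qed

lemma orth_complement_add: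
  "u \<in> orth_complement L K \<Longrightarrow> v \<in> orth_complement L K \<Longrightarrow> u \<oplus> v \<in> orth_complement L K"
  by (auto simp: orth_complement_def ip_add_left)

lemma orth_complement_smult:
  "u \<in> orth_complement L K \<Longrightarrow> r \<odot> u \<in> orth_complement L K"
  by (auto simp: orth_complement_def ip_smult_left)

lemma orth_complement_unique:
  assumes "u \<in> orth_complement L K" "v \<in> orth_complement L K" "u \<ominus> v \<in> K"
  shows "u = v"
proof -
  have "ip L (u \<ominus> v) (u \<ominus> v) = 0"
    using assms by (simp add: orth_complement_def ip_minus_left)
  then have "u \<ominus> v = \<zero>" using assms(3) by (intro ip_self_eq_zero) simp
  then show ?thesis using assms minus_eq_zeroD by (auto simp: orth_complement_def)
qed

text \<open>The correction terms of the Levi-Civita product of K lie in K and vanish against a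
  normal v. The remaining sum is the trace of ad v on the ideal K. Here F is the very basis chosen
  in \<open>mean_curvature\<close>; the adapted basis of the whole algebra is later built on the
  same F.\<close>

lemma mean_curvature_props:
  assumes F: "F = (SOME F. orthonormal_basis K_algebra F)"
  shows "mean_curvature L K \<in> carrier L"
    and "v \<in> orth_complement L K \<Longrightarrow> ip L (mean_curvature L K) v = (\<Sum>f\<in>F. ip L (v \<otimes> f) f)"
proof -
  interpret K: euclidean_algebra K_algebra by (rule euclidean_algebra_K)
  have "orthonormal_basis K_algebra F" unfolding F by (rule K.some_orthonormal_basis)
  from K.orthonormal_basisD[OF this] have fin: "finite F" and sub: "F \<subseteq> K" by auto
  have H: "mean_curvature L K = (\<Oplus>f\<in>F. levi_civita L f f \<ominus> levi_civita K_algebra f f)"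
    by (simp add: mean_curvature_def F Let_def)
  have lcK: "levi_civita K_algebra f f \<in> K" if "f \<in> F" for f
    using K.levi_civita_self(1)[of f] that sub by auto
  have cl: "(\<lambda>f. levi_civita L f f \<ominus> levi_civita K_algebra f f) \<in> F \<rightarrow> carrier L"
    using sub lcK levi_civita_self(1) by auto
  then show "mean_curvature L K \<in> carrier L" unfolding H by (rule finsum_closed)
  assume v: "v \<in> orth_complement L K"
  note vL = orth_complementD(1)[OF v]
  have "ip L (mean_curvature L K) v = (\<Sum>f\<in>F. ip L (levi_civita L f f \<ominus> levi_civita K_algebra f f) v)"
    unfolding H using vL fin cl by (intro functional_finsum) (auto simp: ip_add_left)
  also have "\<dots> = (\<Sum>f\<in>F. ip L (v \<otimes> f) f)"
  proof (rule sum.cong[OF refl])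
    fix f assume f: "f \<in> F"
    then have fL: "f \<in> carrier L" using sub by auto
    have "ip L (levi_civita K_algebra f f) v = 0"
      using orth_complementD(2)[OF v lcK[OF f]] lcK[OF f] vL ip_sym by auto
    then show "ip L (levi_civita L f f \<ominus> levi_civita K_algebra f f) v = ip L (v \<otimes> f) f"
      using fL vL lcK[OF f] by (simp add: ip_minus_left levi_civita_self)
  qed
  finally show "ip L (mean_curvature L K) v = (\<Sum>f\<in>F. ip L (v \<otimes> f) f)" .
qed

section \<open>The quotient by an ideal\<close>

abbreviation Q where "Q \<equiv> quotient_lie_algebra L K"
abbreviation proj where "proj v \<equiv> K +> v"

lemma abelian_subgroup_K: "abelian_subgroup K L"
proof (rule abelian_subgroupI3)
  show "additive_subgroup K L"
  proof (rule additive_subgroupI, rule subgroup.intro)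
    fix u assume u: "u \<in> K"
    have "inv\<^bsub>add_monoid L\<^esub> u = \<ominus> u" by (simp add: a_inv_def)
    then show "inv\<^bsub>add_monoid L\<^esub> u \<in> K"
      using u K_smult[of u "-1"] by (simp add: smult_minus_one)
  qed (auto simp: K_zero K_add)
qed (rule abelian_group_axioms)

lemma proj_eq_iff: 
  assumes "u \<in> carrier L" "v \<in> carrier L"
  shows "proj u = proj v \<longleftrightarrow> u \<ominus> v \<in> K"
proof -
  interpret S: abelian_subgroup K L by (rule abelian_subgroup_K)
  have "proj u = proj v \<longleftrightarrow> u \<in> proj v"
    using S.a_rcos_self[OF assms(1)] S.a_repr_independence'[OF _ assms(2), of u] by metis
  also have "\<dots> \<longleftrightarrow> u \<ominus> v \<in> K"
    using S.a_rcos_module[OF assms(2,1)] assms by (simp add: minus_eq)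
  finally show ?thesis .
qed

lemma in_proj: "v \<in> carrier L \<Longrightarrow> a \<in> proj v \<longleftrightarrow> a \<in> carrier L \<and> a \<ominus> v \<in> K"
  using abelian_subgroup.a_elemrcos_carrier[OF abelian_subgroup_K, of v a]
    abelian_subgroup.a_rcos_module[OF abelian_subgroup_K, of v a]
  by (auto simp: minus_eq)

lemma self_in_proj: "v \<in> carrier L \<Longrightarrow> v \<in> proj v"
  by (simp add: in_proj K_zero minus_eq r_neg)

lemma carrier_Q: "carrier Q = proj ` carrier L"
  by (auto simp: quotient_lie_algebra_def FactRing_def A_RCOSETS_defs a_r_coset_def)

lemma proj_carrier [simp]: "v \<in> carrier L \<Longrightarrow> proj v \<in> carrier Q"
  by (simp add: carrier_Q)

lemma proj_add: "u \<in> carrier L \<Longrightarrow> v \<in> carrier L \<Longrightarrow> proj u \<oplus>\<^bsub>Q\<^esub> proj v = proj (u \<oplus> v)"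
  using abelian_subgroup.a_rcos_sum[OF abelian_subgroup_K]
  by (simp add: quotient_lie_algebra_def FactRing_def)

lemma zero_Q: "\<zero>\<^bsub>Q\<^esub> = proj \<zero>"
proof -
  interpret S: abelian_subgroup K L by (rule abelian_subgroup_K)
  show ?thesis using K_subset by (simp add: quotient_lie_algebra_def FactRing_def)
qed

text \<open>The product of cosets in \<open>FactRing\<close> is a union over all representatives. It
  collapses to one coset because [a, b] - [u, v] = [a - u, b] + [u, b - v], and both summands lie in
  the ideal.\<close>

lemma proj_bracket:
  assumes "u \<in> carrier L" "v \<in> carrier L"
  shows "proj u \<otimes>\<^bsub>Q\<^esub> proj v = proj (u \<otimes> v)"
proof -
  have "proj (a \<otimes> b) = proj (u \<otimes> v)" if "a \<in> proj u" "b \<in> proj v" for a b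
  proof -
    from that have a: "a \<in> carrier L" "a \<ominus> u \<in> K" and b: "b \<in> carrier L" "b \<ominus> v \<in> K"
      using assms by (auto simp: in_proj)
    have "a \<otimes> b = ((a \<ominus> u) \<oplus> u) \<otimes> b" using a assms by (simp add: minus_add_cancel)
    also have "\<dots> = (a \<ominus> u) \<otimes> b \<oplus> u \<otimes> b"
      using a b assms by (intro bracket_add_left) auto
    also have "u \<otimes> b = u \<otimes> ((b \<ominus> v) \<oplus> v)" using b assms by (simp add: minus_add_cancel)
    also have "\<dots> = u \<otimes> (b \<ominus> v) \<oplus> u \<otimes> v"
      using b assms by (intro bracket_add_right) auto
    finally have "a \<otimes> b \<ominus> u \<otimes> v = (a \<ominus> u) \<otimes> b \<oplus> u \<otimes> (b \<ominus> v)"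
      using a b assms by (simp add: minus_eq a_assoc r_neg)
    also have "\<dots> \<in> K" using a b assms by (intro K_add K_bracket_left K_bracket_right)
    finally show ?thesis using a b assms by (simp add: proj_eq_iff)
  qed
  then have "(\<Union>a\<in>proj u. \<Union>b\<in>proj v. proj (a \<otimes> b)) = (\<Union>a\<in>proj u. \<Union>b\<in>proj v. proj (u \<otimes> v))"
    by simp
  also have "\<dots> = proj (u \<otimes> v)" using self_in_proj assms by blast
  finally show ?thesis by (simp add: quotient_lie_algebra_def FactRing_def rcoset_mult_def)
qed

lemma proj_smult:
  assumes "v \<in> carrier L"
  shows "r \<odot>\<^bsub>Q\<^esub> proj v = proj (r \<odot> v)"
proof -
  have "proj (r \<odot> a) = proj (r \<odot> v)" if "a \<in> proj v" for a
  proof -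
    from that have a: "a \<in> carrier L" "a \<ominus> v \<in> K" using assms by (auto simp: in_proj)
    have "r \<odot> a \<ominus> r \<odot> v \<in> K"
      using a assms K_smult[OF a(2), of r] by (simp add: smult_minus)
    then show ?thesis using a assms by (simp add: proj_eq_iff)
  qed
  then have "(\<Union>a\<in>proj v. proj (r \<odot> a)) = (\<Union>a\<in>proj v. proj (r \<odot> v))" by simp
  also have "\<dots> = proj (r \<odot> v)" using self_in_proj assms by blast
  finally show ?thesis by (simp add: quotient_lie_algebra_def)
qed

lemma orth_lift_proj: 
  assumes "n \<in> orth_complement L K"
  shows "orth_lift L K (proj n) = n"
proof -
  have "inj_on (\<lambda>v. proj v) (orth_complement L K)"
  proof (rule inj_onI)
    fix u v assume uv: "u \<in> orth_complement L K" "v \<in> orth_complement L K" "proj u = proj v"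
    then have "u \<ominus> v \<in> K" using proj_eq_iff orth_complementD(1) by blast
    with uv show "u = v" by (intro orth_complement_unique)
  qed
  then show ?thesis using assms by (simp add: orth_lift_def the_inv_into_f_f)
qed

lemma orth_rep:
  assumes "C \<in> carrier Q"
  obtains n where "n \<in> orth_complement L K" "C = proj n"
proof -
  from assms obtain v where v: "v \<in> carrier L" "C = proj v" by (auto simp: carrier_Q)
  then obtain n where "n \<in> orth_complement L K" "v \<ominus> n \<in> K" using orth_projection by blast
  with v that show thesis by (metis orth_complementD(1) proj_eq_iff)
qed

lemma ip_proj_orth:
  assumes "m \<in> orth_complement L K" "n \<in> orth_complement L K"
  shows "ip Q (proj m) (proj n) = ip L m n"
  using assms by (simp add: quotient_lie_algebra_def orth_lift_proj)

text \<open>The part of u in K is orthogonal to n, so u itself may be arbitrary. This matters for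
  brackets [n, e], which in general are not normal even when n and e are.\<close>

lemma ip_proj:
  assumes u: "u \<in> carrier L" and n: "n \<in> orth_complement L K"
  shows "ip Q (proj u) (proj n) = ip L u n"
proof -
  note nL = orth_complementD(1)[OF n]
  obtain m where m: "m \<in> orth_complement L K" "u \<ominus> m \<in> K" using orth_projection u by blast
  note mL = orth_complementD(1)[OF m(1)]
  have "ip L (u \<ominus> m) n = 0"
    using orth_complementD(2)[OF n m(2)] u nL mL ip_sym[of n "u \<ominus> m"] by simp
  moreover have "proj u = proj m" using u m mL by (simp add: proj_eq_iff)
  ultimately show ?thesis using u nL mL m n by (simp add: ip_proj_orth ip_minus_left)
qed

lemma abelian_group_Q: "abelian_group Q"
proof (rule abelian_groupI)
  fix C assume "C \<in> carrier Q"
  then obtain v where v: "v \<in> carrier L" "C = proj v" by (auto simp: carrier_Q)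
  then have "proj (\<ominus> v) \<oplus>\<^bsub>Q\<^esub> C = \<zero>\<^bsub>Q\<^esub>" by (simp add: proj_add zero_Q l_neg)
  then show "\<exists>D\<in>carrier Q. D \<oplus>\<^bsub>Q\<^esub> C = \<zero>\<^bsub>Q\<^esub>" using v by (intro bexI) auto
next
  fix C D assume "C \<in> carrier Q" "D \<in> carrier Q"
  then obtain u v where "u \<in> carrier L" "v \<in> carrier L" "C = proj u" "D = proj v"
    by (auto simp: carrier_Q)
  then show "C \<oplus>\<^bsub>Q\<^esub> D = D \<oplus>\<^bsub>Q\<^esub> C" using a_comm[of u v] by (simp add: proj_add)
qed (auto simp: carrier_Q proj_add zero_Q a_assoc)

text \<open>Every coset has a normal representative, and on these the inner product is that of L;
  positivity and linearity are inherited through them. Lifting an orthonormal set of cosets gives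
  one of the same size in L, so the dimension bound carries over.\<close>

lemma euclidean_algebra_Q: "euclidean_algebra Q"
proof (rule euclidean_algebra.intro[OF abelian_group_Q], unfold_locales)
  obtain n where n: "\<And>E. orthonormal_set L E \<Longrightarrow> card E \<le> n" using orthonormal_set_bounded by blast
  have "card E \<le> n" if E: "orthonormal_set Q E" for E
  proof -
    let ?l = "orth_lift L K"
    have lift: "?l C \<in> orth_complement L K" "proj (?l C) = C" if "C \<in> E" for C
      using E that by (auto simp: orthonormal_set_def subset_iff orth_lift_proj elim!: orth_rep)
    have inj: "inj_on ?l E" using lift(2) by (metis inj_onI)
    have "orthonormal_set L (?l ` E)"
      unfolding orthonormal_set_def
    proof (intro conjI ballI)
      show "finite (?l ` E)" using E by (auto simp: orthonormal_set_def)
      show "?l ` E \<subseteq> carrier L" using lift(1) orth_complementD(1) by blast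
      fix e f assume "e \<in> ?l ` E" "f \<in> ?l ` E"
      then obtain C D where CD: "C \<in> E" "D \<in> E" "e = ?l C" "f = ?l D" by blast
      then have "ip L e f = ip Q C D" using lift ip_proj_orth by metis
      then show "ip L e f = (if e = f then 1 else 0)"
        using CD E inj by (auto simp: orthonormal_set_def dest: inj_onD)
    qed
    then have "card (?l ` E) \<le> n" by (rule n)
    then show ?thesis using card_image[OF inj] by simp
  qed
  then show "\<exists>n. \<forall>E. orthonormal_set Q E \<longrightarrow> card E \<le> n" by blast
next
  fix u v assume "u \<in> carrier Q" "v \<in> carrier Q"
  then show "ip Q u v = ip Q v u"
    by (auto elim!: orth_rep simp: ip_proj_orth ip_sym orth_complementD(1))
next
  fix u assume u: "u \<in> carrier Q" "u \<noteq> \<zero>\<^bsub>Q\<^esub>"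
  then obtain n where n: "n \<in> orth_complement L K" "u = proj n" by (auto elim!: orth_rep)
  then show "0 < ip Q u u" using u ip_pos[of n] by (auto simp: ip_proj_orth zero_Q orth_complementD(1))
next
  fix u v w assume "u \<in> carrier Q" "v \<in> carrier Q" "w \<in> carrier Q"
  then show "ip Q (u \<oplus>\<^bsub>Q\<^esub> v) w = ip Q u w + ip Q v w"
    by (auto elim!: orth_rep simp: ip_proj_orth proj_add orth_complement_add ip_add_left orth_complementD(1))
next
  fix u w r assume "u \<in> carrier Q" "w \<in> carrier Q"
  then show "ip Q (r \<odot>\<^bsub>Q\<^esub> u) w = r * ip Q u w"
    by (auto elim!: orth_rep simp: ip_proj_orth proj_smult orth_complement_smult ip_smult_left orth_complementD(1))
qed (auto simp: carrier_Q proj_add proj_smult proj_bracket zero_Q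
    smult_l_distr smult_r_distr smult_assoc smult_one
    bracket_add_left bracket_add_right bracket_smult_left bracket_smult_right bracket_self)

text \<open>Completeness comes in two stages: a vector orthogonal to the lifts has a class
  orthogonal to D, so it lies in K; being orthogonal to F as well, it is zero.\<close>

lemma orthonormal_basis_adapted:
  assumes F: "orthonormal_basis K_algebra F" and D: "orthonormal_basis Q D"
  shows "orthonormal_basis L (F \<union> orth_lift L K ` D)" "F \<inter> orth_lift L K ` D = {}"
    "inj_on (orth_lift L K) D" "finite F" "finite D" "F \<subseteq> K"
    "\<And>d. d \<in> D \<Longrightarrow> orth_lift L K d \<in> orth_complement L K \<and> proj (orth_lift L K d) = d"
proof -
  interpret K: euclidean_algebra K_algebra by (rule euclidean_algebra_K)
  interpret Q: euclidean_algebra Q by (rule euclidean_algebra_Q)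
  note F' = K.orthonormal_basisD[OF F] and D' = Q.orthonormal_basisD[OF D]
  let ?l = "orth_lift L K"
  show finF: "finite F" and finD: "finite D" and FK: "F \<subseteq> K" using F' D' by auto
  show lift: "?l d \<in> orth_complement L K \<and> proj (?l d) = d" if "d \<in> D" for d
    using D' that by (auto simp: subset_iff orth_lift_proj elim!: orth_rep)
  show inj: "inj_on ?l D" using lift by (metis inj_onI)
  have ipF: "ip L e f = (if e = f then 1 else 0)" if "e \<in> F" "f \<in> F" for e f
    using F' that by (auto simp: orthonormal_set_def)
  have ipD: "ip L (?l d) (?l d') = (if ?l d = ?l d' then 1 else 0)" if "d \<in> D" "d' \<in> D" for d d'
  proof -
    have "ip L (?l d) (?l d') = ip Q d d'" using lift that ip_proj_orth by metis
    then show ?thesis using D' that inj by (auto simp: orthonormal_set_def dest: inj_onD)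
  qed
  have ipDF: "ip L (?l d) f = 0" "ip L f (?l d) = 0" if "d \<in> D" "f \<in> F" for d f
    using lift[OF that(1)] that FK by (auto simp: orth_complement_def ip_sym[of f])
  show disj: "F \<inter> ?l ` D = {}" using ipDF ipF by force
  have "orthonormal_set L (F \<union> ?l ` D)"
    unfolding orthonormal_set_def
  proof (intro conjI ballI)
    show "finite (F \<union> ?l ` D)" using finF finD by simp
    show "F \<union> ?l ` D \<subseteq> carrier L" using FK lift by (auto simp: orth_complement_def)
    fix e f assume ef: "e \<in> F \<union> ?l ` D" "f \<in> F \<union> ?l ` D"
    show "ip L e f = (if e = f then 1 else 0)"
    proof (cases "e \<in> F"; cases "f \<in> F")
      assume "e \<in> F" "f \<in> F" then show ?thesis by (rule ipF)
    next
      assume "e \<notin> F" "f \<notin> F" then show ?thesis using ef ipD by auto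
    next
      assume "e \<in> F" "f \<notin> F" then show ?thesis using ef ipDF by auto
    next
      assume "e \<notin> F" "f \<in> F" then show ?thesis using ef ipDF by auto
    qed
  qed
  then show "orthonormal_basis L (F \<union> ?l ` D)"
  proof (rule orthonormal_basisI)
    fix v assume v: "v \<in> carrier L" and orth: "\<And>e. e \<in> F \<union> ?l ` D \<Longrightarrow> ip L v e = 0"
    have "proj v = \<zero>\<^bsub>Q\<^esub>"
    proof (rule Q.orthonormal_basis_complete[OF D])
      show "proj v \<in> carrier Q" using v by simp
      fix d assume d: "d \<in> D"
      then have "ip Q (proj v) (proj (?l d)) = 0" using lift orth v by (subst ip_proj) auto
      then show "ip Q (proj v) d = 0" using lift d by simp
    qed
    moreover have "v \<ominus> \<zero> = v" using v by (intro ip_eqI) (auto simp: ip_minus_left)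
    ultimately have "v \<in> K" using v proj_eq_iff[of v \<zero>] by (simp add: zero_Q)
    then show "v = \<zero>" using K.orthonormal_basis_complete[OF F, of v] orth by auto
  qed
qed

text \<open>The trace of \<open>ad v\<close> splits into its trace on \<open>K\<close>, which is \<open>\<langle>H, v\<rangle>\<close> when \<open>v\<close> is orthogonal
  to \<open>K\<close>, and its trace on the quotient.\<close>

lemma proj_U_alg: "proj (U_alg L) = U_alg Q \<oplus>\<^bsub>Q\<^esub> proj (mean_curvature L K)"
proof -
  interpret K: euclidean_algebra K_algebra by (rule euclidean_algebra_K)
  interpret Q: euclidean_algebra Q by (rule euclidean_algebra_Q)
  define F where "F = (SOME F. orthonormal_basis K_algebra F)"
  have F: "orthonormal_basis K_algebra F" unfolding F_def by (rule K.some_orthonormal_basis)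
  obtain D where D: "orthonormal_basis Q D" using Q.orthonormal_basis_exists by blast
  let ?l = "orth_lift L K"
  note A = orthonormal_basis_adapted[OF F D]
  note U = U_alg_props[OF A(1)] and UQ = Q.U_alg_props[OF D]
  note H = mean_curvature_props[OF F_def]
  show ?thesis
  proof (rule Q.ip_eqI)
    show "proj (U_alg L) \<in> carrier Q" "U_alg Q \<oplus>\<^bsub>Q\<^esub> proj (mean_curvature L K) \<in> carrier Q"
      using U UQ H by auto
    \<comment> \<open>Testing on a normal representative n of C makes both the pairing with the mean
      curvature and \<open>ip_proj\<close> available.\<close>
    fix C assume C: "C \<in> carrier Q"
    then obtain n where n: "n \<in> orth_complement L K" "C = proj n" by (auto elim!: orth_rep)
    note nL = orth_complementD(1)[OF n(1)]
    have "ip Q (C \<otimes>\<^bsub>Q\<^esub> d) d = ip L (n \<otimes> ?l d) (?l d)" if d: "d \<in> D" for d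
    proof -
      from A(7)[OF d] have ld: "?l d \<in> orth_complement L K" "d = proj (?l d)" by auto
      have "ip Q (C \<otimes>\<^bsub>Q\<^esub> proj (?l d)) (proj (?l d)) = ip L (n \<otimes> ?l d) (?l d)"
        using ld(1) orth_complementD(1)[OF ld(1)] nL n(2) by (simp add: proj_bracket ip_proj)
      then show ?thesis using ld(2) by simp
    qed
    then have "(\<Sum>d\<in>D. ip Q (C \<otimes>\<^bsub>Q\<^esub> d) d) = (\<Sum>e\<in>?l ` D. ip L (n \<otimes> e) e)"
      using A(3) by (simp add: sum.reindex)
    then have "ip L (U_alg L) n = ip Q (U_alg Q) C + ip L (mean_curvature L K) n"
      using U(2)[OF nL] UQ(2)[OF C] H(2)[OF n(1)] A by (simp add: sum.union_disjoint)
    then show "ip Q (proj (U_alg L)) C = ip Q (U_alg Q \<oplus>\<^bsub>Q\<^esub> proj (mean_curvature L K)) C"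
      using n C U(1) UQ(1) H(1) by (simp add: Q.ip_add_left ip_proj)
  qed
qed

end

text \<open>The algebraic core, stated for any map \<xi>' that factors \<xi> through the cosets, so
  that the induced differential need only be evaluated on cosets to be inserted here.\<close>

theorem tension_quotient:
  fixes L :: "'v euclidean_lie_algebra" and M :: "'w euclidean_lie_algebra"
  assumes L: "euclidean_algebra L" and M: "euclidean_algebra M"
    and \<xi>: "\<And>v. v \<in> carrier L \<Longrightarrow> \<xi> v \<in> carrier M"
      "\<And>u v. u \<in> carrier L \<Longrightarrow> v \<in> carrier L \<Longrightarrow> \<xi> (u \<oplus>\<^bsub>L\<^esub> v) = \<xi> u \<oplus>\<^bsub>M\<^esub> \<xi> v"
      "\<And>r v. v \<in> carrier L \<Longrightarrow> \<xi> (r \<odot>\<^bsub>L\<^esub> v) = r \<odot>\<^bsub>M\<^esub> \<xi> v"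
      "\<And>u v. u \<in> carrier L \<Longrightarrow> v \<in> carrier L \<Longrightarrow> \<xi> (u \<otimes>\<^bsub>L\<^esub> v) = \<xi> u \<otimes>\<^bsub>M\<^esub> \<xi> v"
    and K: "K = a_kernel L M \<xi>"
    and \<xi>': "\<And>v. v \<in> carrier L \<Longrightarrow> \<xi>' (K +>\<^bsub>L\<^esub> v) = \<xi> v"
  shows "tension L M \<xi> =
    tension (quotient_lie_algebra L K) M \<xi>' \<ominus>\<^bsub>M\<^esub> \<xi> (mean_curvature L K)"
proof -
  interpret L: euclidean_algebra L by fact
  interpret M: euclidean_algebra M by fact
  have K_iff: "v \<in> K \<longleftrightarrow> v \<in> carrier L \<and> \<xi> v = \<zero>\<^bsub>M\<^esub>" for v
    by (simp add: K a_kernel_def')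
  \<comment> \<open>Brackets with zero vanish by homogeneity with the scalar 0; this makes the
    kernel an ideal and kills the kernel vectors in \<open>U_hom\<close>.\<close>
  have bz: "\<zero>\<^bsub>M\<^esub> \<otimes>\<^bsub>M\<^esub> w = \<zero>\<^bsub>M\<^esub>" "w \<otimes>\<^bsub>M\<^esub> \<zero>\<^bsub>M\<^esub> = \<zero>\<^bsub>M\<^esub>" if w: "w \<in> carrier M" for w
    using M.bracket_smult_left[of "\<zero>\<^bsub>M\<^esub>" w 0] M.bracket_smult_right[of w "\<zero>\<^bsub>M\<^esub>" 0] w
    by (simp_all add: M.smult_zero_left)
  have z: "\<xi> \<zero>\<^bsub>L\<^esub> = \<zero>\<^bsub>M\<^esub>"
    using \<xi>(3)[of "\<zero>\<^bsub>L\<^esub>" 0] \<xi>(1) by (simp add: M.smult_zero_left)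
  interpret I: euclidean_ideal L K
    by unfold_locales (auto simp: K_iff \<xi> z bz)
  interpret Q: euclidean_algebra I.Q by (rule I.euclidean_algebra_Q)
  interpret KA: euclidean_algebra I.K_algebra by (rule I.euclidean_algebra_K)
  let ?H = "mean_curvature L K"
  obtain F where F: "orthonormal_basis I.K_algebra F" using KA.orthonormal_basis_exists by blast
  obtain D where D: "orthonormal_basis I.Q D" using Q.orthonormal_basis_exists by blast
  note A = I.orthonormal_basis_adapted[OF F D]
  let ?l = "orth_lift L K"
  have \<xi>'Q: "\<And>C. C \<in> carrier I.Q \<Longrightarrow> \<xi>' C \<in> carrier M"
    "\<And>C D. C \<in> carrier I.Q \<Longrightarrow> D \<in> carrier I.Q \<Longrightarrow> \<xi>' (C \<oplus>\<^bsub>I.Q\<^esub> D) = \<xi>' C \<oplus>\<^bsub>M\<^esub> \<xi>' D"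
    "\<And>r C. C \<in> carrier I.Q \<Longrightarrow> \<xi>' (r \<odot>\<^bsub>I.Q\<^esub> C) = r \<odot>\<^bsub>M\<^esub> \<xi>' C"
    by (auto simp: I.carrier_Q I.proj_add I.proj_smult \<xi>' \<xi>)
  have U: "U_hom L M \<xi> \<in> carrier M"
    "\<And>w. w \<in> carrier M \<Longrightarrow>
      ip M (U_hom L M \<xi>) w = (\<Sum>e\<in>F \<union> ?l ` D. ip M (w \<otimes>\<^bsub>M\<^esub> \<xi> e) (\<xi> e))"
    by (rule L.U_hom_props[OF M _ _ _ A(1)]; simp add: \<xi>)+
  have UQ: "U_hom I.Q M \<xi>' \<in> carrier M"
    "\<And>w. w \<in> carrier M \<Longrightarrow> ip M (U_hom I.Q M \<xi>') w = (\<Sum>d\<in>D. ip M (w \<otimes>\<^bsub>M\<^esub> \<xi>' d) (\<xi>' d))"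
    by (rule Q.U_hom_props[OF M _ _ _ D]; simp add: \<xi>'Q)+
  have "U_hom L M \<xi> = U_hom I.Q M \<xi>'"
  proof (rule M.ip_eqI[OF U(1) UQ(1)])
    fix w assume w: "w \<in> carrier M"
    have FK: "ip M (w \<otimes>\<^bsub>M\<^esub> \<xi> f) (\<xi> f) = 0" if "f \<in> F" for f
      using A(6) that w by (auto simp: K_iff bz subset_iff)
    have "\<xi>' d = \<xi> (?l d)" if d: "d \<in> D" for d
      using A(7)[OF d] \<xi>'[of "?l d"] by (auto dest: L.orth_complementD(1))
    then have "(\<Sum>d\<in>D. ip M (w \<otimes>\<^bsub>M\<^esub> \<xi>' d) (\<xi>' d)) = (\<Sum>e\<in>?l ` D. ip M (w \<otimes>\<^bsub>M\<^esub> \<xi> e) (\<xi> e))"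
      using A(3) by (simp add: sum.reindex)
    then show "ip M (U_hom L M \<xi>) w = ip M (U_hom I.Q M \<xi>') w"
      using U(2)[OF w] UQ(2)[OF w] A FK by (simp add: sum.union_disjoint)
  qed
  \<comment> \<open>The image under \<xi>' of the trace splitting \<open>proj_U_alg\<close>.\<close>
  moreover have "\<xi> (U_alg L) = \<xi>' (U_alg I.Q) \<oplus>\<^bsub>M\<^esub> \<xi> ?H"
    using I.proj_U_alg L.U_alg_props(1)[OF A(1)] Q.U_alg_props(1)[OF D]
      I.mean_curvature_props(1)[OF refl] \<xi>' \<xi>'Q(2) I.proj_carrier by metis
  moreover have "a \<ominus>\<^bsub>M\<^esub> (b \<oplus>\<^bsub>M\<^esub> c) = (a \<ominus>\<^bsub>M\<^esub> b) \<ominus>\<^bsub>M\<^esub> c"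
    if "a \<in> carrier M" "b \<in> carrier M" "c \<in> carrier M" for a b c
    using that by (intro M.ip_eqI) (auto simp: M.ip_minus_left M.ip_add_left)
  ultimately show ?thesis
    unfolding tension_def using UQ(1) \<xi>'Q(1)[OF Q.U_alg_props(1)[OF D]]
      \<xi>(1)[OF I.mean_curvature_props(1)[OF refl]] by simp
qed

section \<open>Smooth functions on Euclidean space\<close>

text \<open>R^n consists of the sequences vanishing from index n on. As a \<open>top_of_set\<close>
  it gives access to \<open>continuous_on\<close> and to metric neighbourhoods on coordinate
  lines.\<close>

lemma Euclidean_space_eq: "Euclidean_space n = top_of_set {x. \<forall>i\<ge>n. x i = 0}"
  by (simp add: Euclidean_space_def euclidean_product_topology)

lemma openin_Euclidean_subset: "openin (Euclidean_space n) V \<Longrightarrow> V \<subseteq> {x. \<forall>i\<ge>n. x i = 0}"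
  using openin_subset topspace_Euclidean_space by blast

lemma continuous_map_Euclidean_subtopology:
  assumes "openin (Euclidean_space n) V"
  shows "continuous_map (subtopology (Euclidean_space n) V) euclideanreal f \<longleftrightarrow> continuous_on V f"
  using openin_Euclidean_subset[OF assms]
  by (simp add: Euclidean_space_eq subtopology_subtopology Int_absorb1)

lemma continuous_on_fun_upd_line: "continuous_on S (\<lambda>t::real. (x::nat \<Rightarrow> real)(i := t))"
proof (rule continuous_on_coordinatewise_then_product)
  show "continuous_on S (\<lambda>t. (x(i := t)) j)" for j
    by (cases "j = i") (auto intro: continuous_intros)
qed

lemma openin_Euclidean_line:
  assumes "openin (Euclidean_space n) V" "x \<in> V" "i < n"
  obtains e where "e > 0" "\<And>t. \<bar>t - x i\<bar> < e \<Longrightarrow> x(i := t) \<in> V"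
proof -
  obtain T where T: "open T" "V = T \<inter> {x. \<forall>i\<ge>n. x i = 0}"
    using assms(1) by (auto simp: Euclidean_space_eq openin_open)
  have "open ((\<lambda>t. x(i := t)) -` T)"
    by (rule open_vimage[OF T(1) continuous_on_fun_upd_line])
  moreover have "x i \<in> (\<lambda>t. x(i := t)) -` T" using assms T by simp
  ultimately obtain e where e: "e > 0" "ball (x i) e \<subseteq> (\<lambda>t. x(i := t)) -` T"
    using open_contains_ball by blast
  have "x(i := t) \<in> V" if "\<bar>t - x i\<bar> < e" for t
  proof -
    have "t \<in> ball (x i) e" using that by (simp add: dist_real_def abs_minus_commute)
    then show ?thesis using e(2) T assms by auto
  qed
  with e(1) show thesis by (rule that)
qed

lemma eventually_line:
  assumes "openin (Euclidean_space n) V" "x \<in> V" "i < n"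
  shows "\<forall>\<^sub>F t in nhds (x i). x(i := t) \<in> V"
proof -
  obtain e where "e > 0" "\<And>t. \<bar>t - x i\<bar> < e \<Longrightarrow> x(i := t) \<in> V"
    using openin_Euclidean_line[OF assms] by blast
  then show ?thesis unfolding eventually_nhds_metric by (auto simp: dist_real_def)
qed

lemma Ck_on_continuous: 
  assumes "openin (Euclidean_space n) V" "Ck_on k n V f" 
  shows "continuous_on V f"
  using assms continuous_map_Euclidean_subtopology by (cases k) auto

lemma Ck_on_SucD:
  assumes "openin (Euclidean_space n) V" "Ck_on (Suc k) n V f" "i < n"
  shows "Ck_on k n V (partial_deriv i f)"
    and "x \<in> V \<Longrightarrow> ((\<lambda>t. f (x(i := t))) has_field_derivative partial_deriv i f x) (at (x i))"
  using assms by (auto simp: partial_deriv_def field_differentiable_derivI)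

text \<open>A partial derivative is taken along a whole coordinate line, but near a point of the
  open set V that line stays in V, so values outside V have no influence.\<close>

lemma Ck_on_cong:
  assumes "openin (Euclidean_space n) V" "\<And>x. x \<in> V \<Longrightarrow> f x = g x"
  shows "Ck_on k n V f \<longleftrightarrow> Ck_on k n V g"
  using assms(2)
proof (induction k arbitrary: f g)
  case 0
  then show ?case
    by (simp add: continuous_map_Euclidean_subtopology[OF assms(1)] cong: continuous_on_cong)
next
  case (Suc k)
  have ev: "\<forall>\<^sub>F t in nhds (x i). f (x(i := t)) = g (x(i := t))" if "x \<in> V" "i < n" for x i
    using eventually_line[OF assms(1) that] by eventually_elim (rule Suc.prems)
  have "(\<lambda>t. f (x(i := t))) field_differentiable at (x i) \<longleftrightarrow>
      (\<lambda>t. g (x(i := t))) field_differentiable at (x i)" if "x \<in> V" "i < n" for x i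
    unfolding field_differentiable_def using DERIV_cong_ev[OF refl ev[OF that] refl] by simp
  moreover have "Ck_on k n V (partial_deriv i f) \<longleftrightarrow> Ck_on k n V (partial_deriv i g)" if "i < n" for i
    by (rule Suc.IH) (simp add: partial_deriv_def deriv_cong_ev[OF ev[OF _ that] refl])
  moreover have "continuous_on V f \<longleftrightarrow> continuous_on V g"
    using Suc.prems by (simp cong: continuous_on_cong)
  ultimately show ?case by (auto simp: continuous_map_Euclidean_subtopology[OF assms(1)])
qed

text \<open>The introduction rule for all regularity proofs by induction on k: the partial
  derivatives may be given by explicit formulas f', which agree with \<open>partial_deriv\<close> on
  V only.\<close>

lemma Ck_on_SucI:
  assumes V: "openin (Euclidean_space n) V"
    and cont: "continuous_on V f"
    and deriv: "\<And>i x. i < n \<Longrightarrow> x \<in> V \<Longrightarrow>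
      ((\<lambda>t. f (x(i := t))) has_field_derivative f' i x) (at (x i))"
    and Ck: "\<And>i. i < n \<Longrightarrow> Ck_on k n V (f' i)"
  shows "Ck_on (Suc k) n V f"
proof -
  have "Ck_on k n V (partial_deriv i f)" if i: "i < n" for i
  proof -
    have "partial_deriv i f x = f' i x" if "x \<in> V" for x
      unfolding partial_deriv_def using deriv[OF i that] by (rule DERIV_imp_deriv)
    then show ?thesis using Ck[OF i] Ck_on_cong[OF V] by blast
  qed
  then show ?thesis
    using cont deriv by (auto simp: continuous_map_Euclidean_subtopology[OF V] field_differentiable_def)
qed

lemma Ck_on_Suc_imp:
  assumes V: "openin (Euclidean_space n) V"
  shows "Ck_on (Suc k) n V f \<Longrightarrow> Ck_on k n V f"
  by (induction k arbitrary: f) auto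

lemma Ck_on_subset:
  assumes V: "openin (Euclidean_space n) V" and W: "openin (Euclidean_space n) W" "W \<subseteq> V"
  shows "Ck_on k n V f \<Longrightarrow> Ck_on k n W f"
proof (induction k arbitrary: f)
  case 0
  then show ?case
    using continuous_on_subset W by (simp add: continuous_map_Euclidean_subtopology V) blast
next
  case (Suc k)
  then show ?case
    using W continuous_on_subset by (auto simp: continuous_map_Euclidean_subtopology V)
qed

lemma Ck_on_const:
  assumes V: "openin (Euclidean_space n) V"
  shows "Ck_on k n V (\<lambda>_. c)"
proof (induction k arbitrary: c)
  case 0
  then show ?case by simp
next
  case (Suc k)
  show ?case by (rule Ck_on_SucI[OF V _ _ Suc[of 0]]) (auto intro!: continuous_intros)
qed

lemma Ck_on_coord:
  assumes V: "openin (Euclidean_space n) V"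
  shows "Ck_on k n V (\<lambda>x. x j)"
proof -
  have cont: "continuous_on V (\<lambda>x. x j)"
    by (rule continuous_on_product_coordinates[THEN continuous_on_subset]) simp
  show ?thesis
  proof (cases k)
    case 0
    then show ?thesis using cont by (simp add: continuous_map_Euclidean_subtopology[OF V])
  next
    case (Suc l)
    show ?thesis unfolding Suc
    proof (rule Ck_on_SucI[OF V cont _ Ck_on_const[OF V]])
      fix i and x :: "nat \<Rightarrow> real"
      show "((\<lambda>t. (x(i := t)) j) has_field_derivative (if i = j then 1 else 0)) (at (x i))"
        by auto
    qed
  qed
qed

lemma Ck_on_add:
  assumes V: "openin (Euclidean_space n) V"
  shows "Ck_on k n V f \<Longrightarrow> Ck_on k n V g \<Longrightarrow> Ck_on k n V (\<lambda>x. f x + g x)"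
proof (induction k arbitrary: f g)
  case 0
  then show ?case by (auto simp: continuous_map_Euclidean_subtopology[OF V] intro!: continuous_intros)
next
  case (Suc k)
  note f = Ck_on_SucD[OF V Suc.prems(1)] and g = Ck_on_SucD[OF V Suc.prems(2)]
  show ?case
  proof (rule Ck_on_SucI[OF V])
    show "continuous_on V (\<lambda>x. f x + g x)"
      by (intro continuous_intros Ck_on_continuous[OF V Suc.prems(1)] Ck_on_continuous[OF V Suc.prems(2)])
    show "((\<lambda>t. f (x(i := t)) + g (x(i := t))) has_field_derivative
        partial_deriv i f x + partial_deriv i g x) (at (x i))" if "i < n" "x \<in> V" for i x
      using that by (intro DERIV_add f(2) g(2))
    show "Ck_on k n V (\<lambda>x. partial_deriv i f x + partial_deriv i g x)" if "i < n" for i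
      using that by (intro Suc.IH f(1) g(1))
  qed
qed

lemma Ck_on_mult:
  assumes V: "openin (Euclidean_space n) V"
  shows "Ck_on k n V f \<Longrightarrow> Ck_on k n V g \<Longrightarrow> Ck_on k n V (\<lambda>x. f x * g x)"
proof (induction k arbitrary: f g)
  case 0
  then show ?case by (auto simp: continuous_map_Euclidean_subtopology[OF V] intro!: continuous_intros)
next
  case (Suc k)
  note f = Ck_on_SucD[OF V Suc.prems(1)] and g = Ck_on_SucD[OF V Suc.prems(2)]
  show ?case
  proof (rule Ck_on_SucI[OF V])
    show "continuous_on V (\<lambda>x. f x * g x)"
      by (intro continuous_intros Ck_on_continuous[OF V Suc.prems(1)] Ck_on_continuous[OF V Suc.prems(2)])
    show "((\<lambda>t. f (x(i := t)) * g (x(i := t))) has_field_derivative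
        partial_deriv i f x * g x + partial_deriv i g x * f x) (at (x i))" if "i < n" "x \<in> V" for i x
      by (rule DERIV_cong[OF DERIV_mult[OF f(2)[OF that] g(2)[OF that]]]) simp
    show "Ck_on k n V (\<lambda>x. partial_deriv i f x * g x + partial_deriv i g x * f x)" if "i < n" for i
      using that by (intro Ck_on_add[OF V] Suc.IH f(1) g(1) Ck_on_Suc_imp[OF V Suc.prems(1)]
          Ck_on_Suc_imp[OF V Suc.prems(2)])
  qed
qed

text \<open>Contracts the j-th coordinate towards p by the factor s: s = 0 freezes it at p, s = 1 is
  the identity. Moving one coordinate at a time keeps the chain rule one-dimensional.\<close>

definition shrink :: "nat \<Rightarrow> real \<Rightarrow> real \<Rightarrow> (nat \<Rightarrow> real) \<Rightarrow> nat \<Rightarrow> real" where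
  "shrink j p s x = x(j := p + s * (x j - p))"

lemma shrink_upd:
  "shrink j p s (x(i := t)) = (shrink j p s x)(i := if i = j then p + s * (t - p) else t)"
  by (auto simp: shrink_def fun_eq_iff)

lemma continuous_on_shrink: "continuous_on S (\<lambda>(x, s). shrink j p s x)"
proof (rule continuous_on_coordinatewise_then_product)
  fix i
  have c: "continuous_on S (\<lambda>z. fst z i)" for i :: nat
    by (rule continuous_on_compose2[where g = "\<lambda>x. x i" and f = fst and t = UNIV])
      (auto intro: continuous_intros)
  show "continuous_on S (\<lambda>z. (case z of (x, s) \<Rightarrow> shrink j p s x) i)"
    by (cases "i = j") (auto simp: shrink_def split_beta intro!: continuous_intros c)
qed

lemma has_partial_shrink:
  assumes V: "openin (Euclidean_space n) V" and f: "Ck_on (Suc k) n V f"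
    and x: "shrink j p s x \<in> V" and i: "i < n"
  shows "((\<lambda>t. f (shrink j p s (x(i := t)))) has_field_derivative
    (if i = j then s else 1) * partial_deriv i f (shrink j p s x)) (at (x i))"
proof -
  let ?y = "shrink j p s x" and ?h = "\<lambda>t. if i = j then p + s * (t - p) else t"
  have "((\<lambda>t. f (?y(i := t))) has_field_derivative partial_deriv i f ?y) (at (?h (x i)))"
    using Ck_on_SucD(2)[OF V f i x] by (simp add: shrink_def split: if_splits)
  moreover have "(?h has_field_derivative (if i = j then s else 1)) (at (x i))"
    by (auto intro!: derivative_eq_intros)
  ultimately have "((\<lambda>t. f (?y(i := ?h t))) has_field_derivative
      partial_deriv i f ?y * (if i = j then s else 1)) (at (x i))"
    by (rule DERIV_chain2)
  then show ?thesis by (simp add: shrink_upd mult.commute)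
qed

lemma Ck_on_shrink:
  assumes V: "openin (Euclidean_space n) V" and sub: "\<And>x. x \<in> V \<Longrightarrow> shrink j p s x \<in> V"
  shows "Ck_on k n V f \<Longrightarrow> Ck_on k n V (\<lambda>x. f (shrink j p s x))"
proof -
  have cont: "continuous_on V (\<lambda>x. f (shrink j p s x))" if "continuous_on V f" for f :: "_ \<Rightarrow> real"
  proof (rule continuous_on_compose2[OF that])
    show "continuous_on V (shrink j p s)"
      using continuous_on_compose2[OF continuous_on_shrink[of UNIV], of V "\<lambda>x. (x, s)"]
      by (simp add: continuous_on_Pair)
  qed (use sub in auto)
  show "Ck_on k n V f \<Longrightarrow> Ck_on k n V (\<lambda>x. f (shrink j p s x))"
  proof (induction k arbitrary: f)
    case 0
    then show ?case using cont by (simp add: continuous_map_Euclidean_subtopology[OF V])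
  next
    case (Suc k)
    show ?case
    proof (rule Ck_on_SucI[OF V])
      show "continuous_on V (\<lambda>x. f (shrink j p s x))"
        by (intro cont Ck_on_continuous[OF V Suc.prems])
      show "((\<lambda>t. f (shrink j p s (x(i := t)))) has_field_derivative
        (if i = j then s else 1) * partial_deriv i f (shrink j p s x)) (at (x i))"
        if "i < n" "x \<in> V" for i x
        using that by (intro has_partial_shrink[OF V Suc.prems] sub)
      show "Ck_on k n V (\<lambda>x. (if i = j then s else 1) * partial_deriv i f (shrink j p s x))"
        if "i < n" for i
        using that by (intro Ck_on_mult[OF V] Ck_on_const[OF V] Suc.IH Ck_on_SucD(1)[OF V Suc.prems])
    qed
  qed
qed

text \<open>Differentiating under the integral in direction i produces a further factor s exactly
  when i = j. The weight \<open>s ^ m\<close>, with m arbitrary in the induction, absorbs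
  it.\<close>

lemma Ck_on_integral_shrink:
  assumes V: "openin (Euclidean_space n) V"
    and sub: "\<And>x s. x \<in> V \<Longrightarrow> s \<in> {0..1} \<Longrightarrow> shrink j p s x \<in> V"
  shows "Ck_on k n V f \<Longrightarrow> Ck_on k n V (\<lambda>x. integral {0..1} (\<lambda>s. s ^ m * f (shrink j p s x)))"
proof -
  have joint: "continuous_on (V \<times> {0..1}) (\<lambda>(x, s). s ^ m * f (shrink j p s x))"
    if "continuous_on V f" for f :: "_ \<Rightarrow> real" and m
  proof -
    have "continuous_on (V \<times> {0..1}) (\<lambda>z. f ((\<lambda>(x, s). shrink j p s x) z))"
      by (rule continuous_on_compose2[OF that continuous_on_shrink]) (use sub in auto)
    then show ?thesis by (auto simp: split_beta intro!: continuous_intros)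
  qed
  show "Ck_on k n V f \<Longrightarrow> Ck_on k n V (\<lambda>x. integral {0..1} (\<lambda>s. s ^ m * f (shrink j p s x)))"
  proof (induction k arbitrary: f m)
    case 0
    then show ?case
      using integral_continuous_on_param[of V 0 1 "\<lambda>x s. s ^ m * f (shrink j p s x)"] joint[of f m]
      by (simp add: continuous_map_Euclidean_subtopology[OF V])
  next
    case (Suc k)
    have cf: "continuous_on V f" by (rule Ck_on_continuous[OF V Suc.prems])
    show ?case
    proof (rule Ck_on_SucI[OF V])
      show "continuous_on V (\<lambda>x. integral {0..1} (\<lambda>s. s ^ m * f (shrink j p s x)))"
        using integral_continuous_on_param[of V 0 1 "\<lambda>x s. s ^ m * f (shrink j p s x)"] joint[OF cf, of m]
        by simp
    next
      fix i x assume i: "i < n" and x: "x \<in> V"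
      let ?m = "if i = j then Suc m else m"
      let ?f' = "partial_deriv i f"
      obtain e where e: "e > 0" "\<And>t. \<bar>t - x i\<bar> < e \<Longrightarrow> x(i := t) \<in> V"
        using openin_Euclidean_line[OF V x i] by blast
      let ?U = "ball (x i) e"
      have inV: "x(i := t) \<in> V" if "t \<in> ?U" for t
        using e(2) that by (simp add: dist_real_def abs_minus_commute)
      have cf': "continuous_on V ?f'"
        by (rule Ck_on_continuous[OF V Ck_on_SucD(1)[OF V Suc.prems i]])
      have "((\<lambda>t. integral (cbox 0 1) (\<lambda>s. s ^ m * f (shrink j p s (x(i := t)))))
        has_field_derivative
          integral (cbox 0 1) (\<lambda>s. s ^ ?m * ?f' (shrink j p s (x(i := x i))))) (at (x i) within ?U)"
      proof (rule leibniz_rule_field_derivative)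
        fix t s :: real assume t: "t \<in> ?U" and s: "s \<in> cbox 0 1"
        let ?y = "x(i := t)"
        have "((\<lambda>u. f (shrink j p s (?y(i := u)))) has_field_derivative
          (if i = j then s else 1) * ?f' (shrink j p s ?y)) (at (?y i))"
          using s inV[OF t] by (intro has_partial_shrink[OF V Suc.prems] sub i) auto
        then have "((\<lambda>u. s ^ m * f (shrink j p s (x(i := u)))) has_field_derivative
          s ^ m * ((if i = j then s else 1) * ?f' (shrink j p s ?y))) (at t)"
          by (intro DERIV_cmult) simp
        moreover have "s ^ m * ((if i = j then s else 1) * ?f' (shrink j p s ?y)) =
          s ^ ?m * ?f' (shrink j p s ?y)" by simp
        ultimately show "((\<lambda>u. s ^ m * f (shrink j p s (x(i := u)))) has_field_derivative
          s ^ ?m * ?f' (shrink j p s ?y)) (at t within ?U)"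
          using has_field_derivative_at_within by metis
      next
        fix t assume t: "t \<in> ?U"
        have "continuous_on (cbox 0 1) (\<lambda>s. (\<lambda>(x, s). s ^ m * f (shrink j p s x)) (x(i := t), s))"
          by (rule continuous_on_compose2[OF joint[OF cf, of m]])
            (use inV[OF t] in \<open>auto intro!: continuous_intros\<close>)
        then show "(\<lambda>s. s ^ m * f (shrink j p s (x(i := t)))) integrable_on cbox 0 1"
          by (intro integrable_continuous) simp
      next
        have "continuous_on (?U \<times> cbox 0 1)
          (\<lambda>z. (\<lambda>(x, s). s ^ ?m * ?f' (shrink j p s x)) (x(i := fst z), snd z))"
        proof (rule continuous_on_compose2[OF joint[OF cf', of ?m]])
          show "continuous_on (?U \<times> cbox 0 1) (\<lambda>z. (x(i := fst z), snd z))"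
            by (intro continuous_on_Pair continuous_intros
              continuous_on_compose2[OF continuous_on_fun_upd_line[of UNIV x i]]) auto
          show "(\<lambda>z. (x(i := fst z), snd z)) ` (?U \<times> cbox 0 (1::real)) \<subseteq> V \<times> {0..1}"
            using inV by (auto simp: cbox_interval)
        qed
        then show "continuous_on (?U \<times> cbox 0 1) (\<lambda>(t, s). s ^ ?m * ?f' (shrink j p s (x(i := t))))"
          by (simp add: split_beta)
      qed (use e in auto)
      then show "((\<lambda>t. integral {0..1} (\<lambda>s. s ^ m * f (shrink j p s (x(i := t)))))
        has_field_derivative integral {0..1} (\<lambda>s. s ^ ?m * ?f' (shrink j p s x))) (at (x i))"
        using e(1) at_within_open[of "x i" ?U] by (simp only: fun_upd_triv cbox_interval open_ball centre_in_ball)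
    next
      fix i assume i: "i < n"
      show "Ck_on k n V (\<lambda>x. integral {0..1}
        (\<lambda>s. s ^ (if i = j then Suc m else m) * partial_deriv i f (shrink j p s x)))"
        by (rule Suc.IH[OF Ck_on_SucD(1)[OF V Suc.prems i]])
    qed
  qed
qed

lemma shrink_integral:
  assumes V: "openin (Euclidean_space n) V"
    and sub: "\<And>s. s \<in> {0..1} \<Longrightarrow> shrink j p s x \<in> V"
    and f: "Ck_on (Suc k) n V f" and j: "j < n"
  shows "f x = f (shrink j p 0 x) + (x j - p) * integral {0..1} (\<lambda>s. partial_deriv j f (shrink j p s x))"
proof -
  have "((\<lambda>s. f (shrink j p s x)) has_vector_derivative
      (x j - p) * partial_deriv j f (shrink j p s x)) (at s within {0..1})" if s: "s \<in> {0..1}" for s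
  proof -
    let ?y = "shrink j p s x"
    have "((\<lambda>t. f (?y(j := t))) has_field_derivative partial_deriv j f ?y) (at (p + s * (x j - p)))"
      using Ck_on_SucD(2)[OF V f j sub[OF s]] by (simp add: shrink_def)
    moreover have "((\<lambda>s. p + s * (x j - p)) has_field_derivative (x j - p)) (at s)"
      by (auto intro!: derivative_eq_intros)
    ultimately have "((\<lambda>s. f (?y(j := p + s * (x j - p)))) has_field_derivative
        partial_deriv j f ?y * (x j - p)) (at s)"
      by (rule DERIV_chain2)
    then have "((\<lambda>s. f (shrink j p s x)) has_field_derivative (x j - p) * partial_deriv j f ?y) (at s)"
      by (simp add: shrink_def mult.commute)
    then show ?thesis
      using has_field_derivative_at_within has_real_derivative_iff_has_vector_derivative by blast
  qed
  then have "((\<lambda>s. (x j - p) * partial_deriv j f (shrink j p s x)) has_integral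
      f (shrink j p 1 x) - f (shrink j p 0 x)) {0..1}"
    by (intro fundamental_theorem_of_calculus) auto
  then have "integral {0..1} (\<lambda>s. (x j - p) * partial_deriv j f (shrink j p s x)) =
      f (shrink j p 1 x) - f (shrink j p 0 x)"
    by (rule integral_unique)
  then show ?thesis by (simp add: shrink_def)
qed

lemma smooth_on_const: "openin (Euclidean_space n) V \<Longrightarrow> smooth_on n V (\<lambda>_. c)"
  by (simp add: smooth_on_def Ck_on_const)

lemma smooth_on_coord: "openin (Euclidean_space n) V \<Longrightarrow> smooth_on n V (\<lambda>x. x i)"
  by (simp add: smooth_on_def Ck_on_coord)

lemma smooth_on_add: "smooth_on n V f \<Longrightarrow> smooth_on n V g \<Longrightarrow> smooth_on n V (\<lambda>x. f x + g x)"
  by (simp add: smooth_on_def Ck_on_add)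

lemma smooth_on_mult: "smooth_on n V f \<Longrightarrow> smooth_on n V g \<Longrightarrow> smooth_on n V (\<lambda>x. f x * g x)"
  by (simp add: smooth_on_def Ck_on_mult)

lemma smooth_on_sum:
  assumes "openin (Euclidean_space n) V" "\<And>i. i \<in> I \<Longrightarrow> smooth_on n V (f i)"
  shows "smooth_on n V (\<lambda>x. \<Sum>i\<in>I. f i x)"
  using assms(2)
  by (induction I rule: infinite_finite_induct) (auto intro: smooth_on_const[OF assms(1)] smooth_on_add)

lemma smooth_on_cong:
  "(\<And>x. x \<in> V \<Longrightarrow> f x = g x) \<Longrightarrow> smooth_on n V f \<longleftrightarrow> smooth_on n V g"
  using Ck_on_cong[of n V f g] by (auto simp: smooth_on_def)

lemma smooth_on_subset:
  "smooth_on n V f \<Longrightarrow> openin (Euclidean_space n) W \<Longrightarrow> W \<subseteq> V \<Longrightarrow> smooth_on n W f"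
  using Ck_on_subset by (auto simp: smooth_on_def)

lemma smooth_on_partial_deriv: "smooth_on n V f \<Longrightarrow> i < n \<Longrightarrow> smooth_on n V (partial_deriv i f)"
  unfolding smooth_on_def using Ck_on_SucD(1) by blast

text \<open>The single-coordinate form of Hadamard's lemma. On the hyperplane x j = p shrinking does
  nothing, so the integrand is constant in s and h is the partial derivative there.\<close>

lemma hadamard:
  assumes f: "smooth_on n V f" and j: "j < n"
    and sub: "\<And>x s. x \<in> V \<Longrightarrow> s \<in> {0..1} \<Longrightarrow> shrink j p s x \<in> V"
  obtains h where "smooth_on n V h"
    "\<And>x. x \<in> V \<Longrightarrow> f x = f (shrink j p 0 x) + (x j - p) * h x"
    "\<And>x. x j = p \<Longrightarrow> h x = partial_deriv j f x"
proof
  \<comment> \<open>The factor \<open>s ^ 0\<close> matches the weighted integral at m = 0.\<close>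
  let ?h = "\<lambda>x. integral {0..1} (\<lambda>s. s ^ 0 * partial_deriv j f (shrink j p s x))"
  have V: "openin (Euclidean_space n) V" using f by (simp add: smooth_on_def)
  show "smooth_on n V ?h"
    using Ck_on_integral_shrink[where m=0, OF V sub] smooth_on_partial_deriv[OF f j]
    by (auto simp: smooth_on_def)
  show "f x = f (shrink j p 0 x) + (x j - p) * ?h x" if x: "x \<in> V" for x
  proof -
    have "Ck_on (Suc 0) n V f" using f unfolding smooth_on_def by blast
    from shrink_integral[OF V sub[OF x] this j] show ?thesis by simp
  qed
  show "?h x = partial_deriv j f x" if "x j = p" for x
  proof -
    have "shrink j p s x = x" for s using that by (auto simp: shrink_def)
    then show ?thesis by simp
  qed
qed

section \<open>Derivations at a point of Euclidean space\<close>

definition open_box :: "nat \<Rightarrow> (nat \<Rightarrow> real) \<Rightarrow> real \<Rightarrow> (nat \<Rightarrow> real) set" where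
  "open_box n p e = {x. (\<forall>i\<ge>n. x i = 0) \<and> (\<forall>i<n. \<bar>x i - p i\<bar> < e)}"

lemma openin_open_box: "openin (Euclidean_space n) (open_box n p e)"
proof -
  have "open (\<Inter>i\<in>{..<n}. {x::nat \<Rightarrow> real. \<bar>x i - p i\<bar> < e})"
    by (intro open_INT ballI open_Collect_less continuous_intros continuous_on_product_coordinates) auto
  moreover have "open_box n p e =
      (\<Inter>i\<in>{..<n}. {x. \<bar>x i - p i\<bar> < e}) \<inter> {x. \<forall>i\<ge>n. x i = 0}"
    by (auto simp: open_box_def)
  ultimately show ?thesis by (auto simp: Euclidean_space_eq openin_open)
qed

text \<open>Boxes are used because they are stable under shrinking any single coordinate towards the
  centre, which is what \<open>hadamard\<close> demands of its domain.\<close>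

lemma open_box_shrink:
  assumes "x \<in> open_box n p e" "j < n" "s \<in> {0..1}"
  shows "shrink j (p j) s x \<in> open_box n p e"
proof -
  have "\<bar>s * (x j - p j)\<bar> \<le> 1 * \<bar>x j - p j\<bar>"
    using assms(3) unfolding abs_mult by (intro mult_right_mono) auto
  also have "\<dots> < e" using assms by (simp add: open_box_def)
  finally show ?thesis using assms by (auto simp: open_box_def shrink_def)
qed

lemma open_box_exists:
  assumes V: "openin (Euclidean_space n) V" and p: "p \<in> V"
  obtains e where "e > 0" "open_box n p e \<subseteq> V"
proof -
  obtain T where T: "openin (product_topology (\<lambda>i. euclideanreal) UNIV) T" "V = T \<inter> {x. \<forall>i\<ge>n. x i = 0}"
    using V by (auto simp: Euclidean_space_def openin_subtopology)
  obtain X where X: "p \<in> (\<Pi>\<^sub>E i\<in>UNIV. X i)" "\<And>i. open (X i)" "(\<Pi>\<^sub>E i\<in>UNIV. X i) \<subseteq> T"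
    using product_topology_open_contains_basis[OF T(1), of p] p T(2) by auto
  have "\<exists>e>0. ball (p i) e \<subseteq> X i" for i
    using X(1) X(2)[of i] open_contains_ball by (auto simp: PiE_UNIV_domain)
  then obtain e where e: "\<And>i. e i > 0" "\<And>i. ball (p i) (e i) \<subseteq> X i" by metis
  \<comment> \<open>Inserting 1 keeps the minimum meaningful when n = 0.\<close>
  let ?e = "Min (insert 1 (e ` {..<n}))"
  have "?e > 0" using e(1) by simp
  moreover have "open_box n p ?e \<subseteq> V"
  proof
    fix x assume x: "x \<in> open_box n p ?e"
    have "x i \<in> X i" for i
    proof (cases "i < n")
      case True
      then have "?e \<le> e i" by (intro Min_le) auto
      moreover have "\<bar>x i - p i\<bar> < ?e" using x True unfolding open_box_def by blast
      ultimately have "\<bar>x i - p i\<bar> < e i" by linarith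
      then have "x i \<in> ball (p i) (e i)" by (simp add: dist_real_def abs_minus_commute)
      then show ?thesis using e(2) by blast
    next
      case False
      then have "x i = p i" using x p T(2) by (simp add: open_box_def)
      then show ?thesis using X(1) by (auto simp: PiE_UNIV_domain)
    qed
    then have "x \<in> T" using X(3) by (auto simp: PiE_UNIV_domain)
    then show "x \<in> V" using x T(2) by (auto simp: open_box_def)
  qed
  ultimately show thesis by (rule that)
qed

text \<open>The coordinates of \<open>F\<close> are frozen at \<open>p\<close> one after the other.\<close>

lemma derivation_euclidean:
  fixes D :: "((nat \<Rightarrow> real) \<Rightarrow> real) \<Rightarrow> real"
  assumes S_def: "S = {F. \<exists>V. p \<in> V \<and> smooth_on n V F}"
    and add: "\<And>f g. f \<in> S \<Longrightarrow> g \<in> S \<Longrightarrow> D (\<lambda>x. f x + g x) = D f + D g"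
    and mult: "\<And>f g. f \<in> S \<Longrightarrow> g \<in> S \<Longrightarrow> D (\<lambda>x. f x * g x) = f p * D g + g p * D f"
    and const: "\<And>c. D (\<lambda>_. c) = 0"
    and local: "\<And>V f g. p \<in> V \<Longrightarrow> smooth_on n V f \<Longrightarrow> smooth_on n V g \<Longrightarrow>
      (\<And>x. x \<in> V \<Longrightarrow> f x = g x) \<Longrightarrow> D f = D g"
    and V: "p \<in> V" and F: "smooth_on n V F"
  shows "D F = (\<Sum>i<n. D (\<lambda>x. x i) * partial_deriv i F p)"
proof -
  obtain e where e: "e > 0" "open_box n p e \<subseteq> V"
    using open_box_exists[of n V p] V F by (auto simp: smooth_on_def)
  let ?B = "open_box n p e"
  have p0: "\<forall>i\<ge>n. p i = 0"
    using F V openin_Euclidean_subset[of n V] by (auto simp: smooth_on_def)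
  have pB: "p \<in> ?B" using p0 e by (simp add: open_box_def)
  note B = openin_open_box[of n p e]
  have S: "smooth_on n ?B f \<Longrightarrow> f \<in> S" for f using pB by (auto simp: S_def)
  \<comment> \<open>\<open>Fk 0\<close> is F, and on the box \<open>Fk n\<close> is the constant F
    p, which D kills. Each passage from k to k + 1 contributes one summand of the formula.\<close>
  define Fk where "Fk k = (\<lambda>x. F (\<lambda>i. if i < k then p i else x i))" for k
  have Fk_Suc: "Fk (Suc k) = (\<lambda>x. Fk k (shrink k (p k) 0 x))" for k
  proof -
    have "(\<lambda>i. if i < Suc k then p i else x i) = (\<lambda>i. if i < k then p i else (shrink k (p k) 0 x) i)" for x
      by (auto simp: shrink_def fun_eq_iff)
    then show ?thesis by (simp add: Fk_def)
  qed
  have smooth: "smooth_on n ?B (Fk k)" if "k \<le> n" for k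
    using that
  proof (induction k)
    case 0
    then show ?case using smooth_on_subset[OF F B e(2)] by (simp add: Fk_def)
  next
    case (Suc k)
    then show ?case
      using Ck_on_shrink[OF B, of k "p k" 0 _ "Fk k"] open_box_shrink[of _ n p e k 0]
      by (auto simp: Fk_Suc smooth_on_def)
  qed
  have "D F = D (Fk k) + (\<Sum>i<k. D (\<lambda>x. x i) * partial_deriv i F p)" if "k \<le> n" for k
    using that
  proof (induction k)
    case 0
    then show ?case by (simp add: Fk_def)
  next
    case (Suc k)
    then have k: "k < n" by simp
    obtain h where h: "smooth_on n ?B h"
      "\<And>x. x \<in> ?B \<Longrightarrow> Fk k x = Fk k (shrink k (p k) 0 x) + (x k - p k) * h x"
      "\<And>x. x k = p k \<Longrightarrow> h x = partial_deriv k (Fk k) x"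
      using hadamard[OF smooth[of k] k, of "p k"] open_box_shrink[OF _ k] k by auto
    have l: "smooth_on n ?B (\<lambda>x. x k + - p k)"
      by (intro smooth_on_add smooth_on_coord smooth_on_const B)
    have lh: "smooth_on n ?B (\<lambda>x. (x k + - p k) * h x)" by (rule smooth_on_mult[OF l h(1)])
    \<comment> \<open>Hadamard's identity holds on the box only, so D has to be compared through
      locality.\<close>
    have "D (Fk k) = D (\<lambda>x. Fk (Suc k) x + (x k + - p k) * h x)"
      using h(2) k by (intro local[OF pB] smooth smooth_on_add lh Suc.prems) (auto simp: Fk_Suc)
    also have "\<dots> = D (Fk (Suc k)) + D (\<lambda>x. (x k + - p k) * h x)"
      by (intro add S smooth lh Suc.prems)
    \<comment> \<open>The factor x k - p k vanishes at p, so one term of the product rule drops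
      out.\<close>
    also have "D (\<lambda>x. (x k + - p k) * h x) = h p * D (\<lambda>x. x k + - p k)"
      using mult[OF S[OF l] S[OF h(1)]] by simp
    also have "D (\<lambda>x. x k + - p k) = D (\<lambda>x. x k)"
      using add[OF S[OF smooth_on_coord[OF B]] S[OF smooth_on_const[OF B]], of k "- p k"] const by simp
    also have "h p = partial_deriv k F p"
    proof -
      have "(\<lambda>i. if i < k then p i else (p(k := t)) i) = p(k := t)" for t by (auto simp: fun_eq_iff)
      then show ?thesis using h(3)[of p] by (simp add: partial_deriv_def Fk_def)
    qed
    finally show ?case using Suc by (simp add: mult.commute)
  qed
  from this[of n] have "D F = D (Fk n) + (\<Sum>i<n. D (\<lambda>x. x i) * partial_deriv i F p)" by simp
  moreover have "D (Fk n) = D (\<lambda>_. F p)"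
  proof (rule local[OF pB smooth[OF order_refl] smooth_on_const[OF B]])
    fix x assume "x \<in> ?B"
    then have "(\<lambda>i. if i < n then p i else x i) = p" using p0 by (auto simp: open_box_def fun_eq_iff)
    then show "Fk n x = F p" by (simp add: Fk_def)
  qed
  ultimately show ?thesis by (simp add: const)
qed

section \<open>Slices of functions of two groups of coordinates\<close>

definition join_coords :: "nat \<Rightarrow> (nat \<Rightarrow> real) \<Rightarrow> (nat \<Rightarrow> real) \<Rightarrow> nat \<Rightarrow> real" where
  "join_coords n x y = (\<lambda>i. if i < n then x i else y (i - n))"

lemma head_join [simp]: "\<forall>i\<ge>n. x i = 0 \<Longrightarrow> head_coords n (join_coords n x y) = x"
  by (auto simp: head_coords_def join_coords_def fun_eq_iff)

lemma tail_join [simp]: "tail_coords n (join_coords n x y) = y"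
  by (auto simp: tail_coords_def join_coords_def fun_eq_iff)

lemma join_coords_head: "i < n \<Longrightarrow> join_coords n x y i = x i"
  by (simp add: join_coords_def)

lemma join_coords_tail: "join_coords n x y (n + i) = y i"
  by (simp add: join_coords_def)

lemma join_upd_head: "i < n \<Longrightarrow> join_coords n (x(i := t)) y = (join_coords n x y)(i := t)"
  by (auto simp: join_coords_def fun_eq_iff)

lemma join_upd_tail: "join_coords n x (y(i := t)) = (join_coords n x y)(n + i := t)"
  by (auto simp: join_coords_def fun_eq_iff)

lemma continuous_on_join_head: "continuous_on S (\<lambda>x. join_coords n x y)"
  and continuous_on_join_tail: "continuous_on S (join_coords n x)"
proof -
  have c: "continuous_on S (\<lambda>x. x i)" for i :: nat and S :: "(nat \<Rightarrow> real) set"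
    by (rule continuous_on_product_coordinates[THEN continuous_on_subset]) simp
  show "continuous_on S (\<lambda>x. join_coords n x y)" "continuous_on S (join_coords n x)"
    by (rule continuous_on_coordinatewise_then_product, rename_tac i, case_tac "i < n";
        simp add: join_coords_def c)+
qed

text \<open>Freezing the tail commutes with the first n partial derivatives, because updating x and
  then joining is updating the joined point. Hence the induction on k can move from F to its partial
  derivatives.\<close>

lemma smooth_on_head_slice:
  assumes F: "smooth_on (n + m) Z F" and S: "openin (Euclidean_space n) S"
    and sub: "\<And>x. x \<in> S \<Longrightarrow> join_coords n x y \<in> Z"
  shows "smooth_on n S (\<lambda>x. F (join_coords n x y))"
proof -
  have Z: "openin (Euclidean_space (n + m)) Z" using F by (simp add: smooth_on_def)
  have cont: "continuous_on S (\<lambda>x. f (join_coords n x y))" if "continuous_on Z f" for f :: "_ \<Rightarrow> real"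
    by (rule continuous_on_compose2[OF that continuous_on_join_head]) (use sub in auto)
  have "Ck_on k (n + m) Z F \<Longrightarrow> Ck_on k n S (\<lambda>x. F (join_coords n x y))" for k
  proof (induction k arbitrary: F)
    case 0
    then show ?case
      using cont by (simp add: continuous_map_Euclidean_subtopology[OF S] continuous_map_Euclidean_subtopology[OF Z])
  next
    case (Suc k)
    show ?case
    proof (rule Ck_on_SucI[OF S cont[OF Ck_on_continuous[OF Z Suc.prems]]])
      show "((\<lambda>t. F (join_coords n (x(i := t)) y)) has_field_derivative
        partial_deriv i F (join_coords n x y)) (at (x i))" if "i < n" "x \<in> S" for i x
        using Ck_on_SucD(2)[OF Z Suc.prems _ sub[OF that(2)], of i] that(1)
        by (simp only: join_upd_head join_coords_head trans_less_add1)
      show "Ck_on k n S (\<lambda>x. partial_deriv i F (join_coords n x y))" if "i < n" for i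
        using that by (intro Suc.IH Ck_on_SucD(1)[OF Z Suc.prems]) simp
    qed
  qed
  then show ?thesis using F S by (simp add: smooth_on_def)
qed

lemma smooth_on_tail_slice:
  assumes F: "smooth_on (n + m) Z F" and S: "openin (Euclidean_space m) S"
    and sub: "\<And>y. y \<in> S \<Longrightarrow> join_coords n x y \<in> Z"
  shows "smooth_on m S (\<lambda>y. F (join_coords n x y))"
proof -
  have Z: "openin (Euclidean_space (n + m)) Z" using F by (simp add: smooth_on_def)
  have cont: "continuous_on S (\<lambda>y. f (join_coords n x y))" if "continuous_on Z f" for f :: "_ \<Rightarrow> real"
    by (rule continuous_on_compose2[OF that continuous_on_join_tail]) (use sub in auto)
  have "Ck_on k (n + m) Z F \<Longrightarrow> Ck_on k m S (\<lambda>y. F (join_coords n x y))" for k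
  proof (induction k arbitrary: F)
    case 0
    then show ?case
      using cont by (simp add: continuous_map_Euclidean_subtopology[OF S] continuous_map_Euclidean_subtopology[OF Z])
  next
    case (Suc k)
    show ?case
    proof (rule Ck_on_SucI[OF S cont[OF Ck_on_continuous[OF Z Suc.prems]]])
      show "((\<lambda>t. F (join_coords n x (y(i := t)))) has_field_derivative
        partial_deriv (n + i) F (join_coords n x y)) (at (y i))" if "i < m" "y \<in> S" for i y
        using Ck_on_SucD(2)[OF Z Suc.prems _ sub[OF that(2)], of "n + i"] that(1)
        by (simp only: join_upd_tail join_coords_tail nat_add_left_cancel_less)
      show "Ck_on k m S (\<lambda>y. partial_deriv (n + i) F (join_coords n x y))" if "i < m" for i
        using that by (intro Suc.IH Ck_on_SucD(1)[OF Z Suc.prems]) simp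
    qed
  qed
  then show ?thesis using F S by (simp add: smooth_on_def)
qed

section \<open>Tangent vectors\<close>

lemma chart_openin: "chart n X U c \<Longrightarrow> openin (topo X) U"
  by (simp add: chart_def)

lemma chart_topspace_Int: "chart n X U c \<Longrightarrow> topspace (topo X) \<inter> U = U"
  using chart_openin openin_subset by blast

lemma chart_inj_on:
  assumes "chart n X U c" shows "inj_on c U"
proof -
  have "homeomorphic_map (subtopology (topo X) U) (subtopology (Euclidean_space n) (c ` U)) c"
    using assms by (simp add: chart_def)
  then have "inj_on c (topspace (subtopology (topo X) U))" by (rule homeomorphic_imp_injective_map)
  then show ?thesis using chart_topspace_Int[OF assms] by simp
qed

lemma chart_inverse: "chart n X U c \<Longrightarrow> x \<in> U \<Longrightarrow> the_inv_into U c (c x) = x"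
  by (simp add: chart_inj_on the_inv_into_f_f)

lemma chart_openin_image:
  assumes c: "chart n X U c" and W: "openin (topo X) W" "W \<subseteq> U"
  shows "openin (Euclidean_space n) (c ` W)"
proof -
  have h: "homeomorphic_map (subtopology (topo X) U) (subtopology (Euclidean_space n) (c ` U)) c"
    and o: "openin (Euclidean_space n) (c ` U)"
    using c by (simp_all add: chart_def)
  have "openin (subtopology (topo X) U) W"
    using W chart_openin[OF c] by (simp add: openin_open_subtopology)
  then have "openin (subtopology (Euclidean_space n) (c ` U)) (c ` W)"
    using homeomorphic_imp_open_map[OF h] by (simp add: open_map_def)
  then show ?thesis using o by (simp add: openin_open_subtopology)
qed

lemma chart_openin_preimage:
  assumes c: "chart n X U c" and V: "openin (Euclidean_space n) V"
  shows "openin (topo X) {x \<in> U. c x \<in> V}"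
proof -
  have h: "homeomorphic_map (subtopology (topo X) U) (subtopology (Euclidean_space n) (c ` U)) c"
    using c by (simp add: chart_def)
  have "continuous_map (subtopology (topo X) U) (Euclidean_space n) c"
    using homeomorphic_imp_continuous_map[OF h] continuous_map_into_fulltopology by blast
  from openin_continuous_map_preimage[OF this V]
  have "openin (subtopology (topo X) U) {x \<in> U. c x \<in> V}"
    using chart_topspace_Int[OF c] by simp
  then show ?thesis using chart_openin[OF c] by (simp add: openin_open_subtopology)
qed

lemma chart_smooth_funs:
  "chart n X U c \<Longrightarrow> openin (topo X) W \<Longrightarrow> W \<subseteq> U \<Longrightarrow>
    f \<in> smooth_funs X W \<longleftrightarrow> smooth_on n (c ` W) (f \<circ> the_inv_into U c)"
  by (simp add: chart_def)

text \<open>The delicate point is that \<open>the_inv_into U c\<close> and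
  \<open>the_inv_into W c\<close> are different total functions; they agree on the image of W, and
  smoothness there sees nothing else.\<close>

lemma chart_subset:
  assumes c: "chart n X U c" and W: "openin (topo X) W" "W \<subseteq> U"
  shows "chart n X W c"
  unfolding chart_def
proof (intro conjI allI impI)
  have h: "homeomorphic_map (subtopology (topo X) U) (subtopology (Euclidean_space n) (c ` U)) c"
    using c by (simp add: chart_def)
  show "openin (topo X) W" by fact
  show o: "openin (Euclidean_space n) (c ` W)" by (rule chart_openin_image[OF assms])
  have "homeomorphic_map (subtopology (subtopology (topo X) U) W)
      (subtopology (subtopology (Euclidean_space n) (c ` U)) (c ` W)) c"
  proof (rule homeomorphic_map_subtopologies[OF h])
    have "c ` W \<subseteq> topspace (Euclidean_space n)" using o openin_subset by blast
    then show "c ` (topspace (subtopology (topo X) U) \<inter> W) =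
      topspace (subtopology (Euclidean_space n) (c ` U)) \<inter> c ` W"
      using W(2) chart_topspace_Int[OF c] by (simp add: Int_absorb1) blast
  qed
  moreover have "U \<inter> W = W" "c ` U \<inter> c ` W = c ` W" using W(2) by auto
  ultimately show "homeomorphic_map (subtopology (topo X) W) (subtopology (Euclidean_space n) (c ` W)) c"
    by (simp add: subtopology_subtopology)
  fix W' f assume W': "openin (topo X) W' \<and> W' \<subseteq> W"
  have "f \<in> smooth_funs X W' \<longleftrightarrow> smooth_on n (c ` W') (f \<circ> the_inv_into U c)"
    using W' W by (intro chart_smooth_funs[OF c]) auto
  also have "\<dots> \<longleftrightarrow> smooth_on n (c ` W') (f \<circ> the_inv_into W c)"
  proof (rule smooth_on_cong)
    have "inj_on c W" using chart_inj_on[OF c] W(2) inj_on_subset by blast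
    then show "(f \<circ> the_inv_into U c) x = (f \<circ> the_inv_into W c) x" if "x \<in> c ` W'" for x
      using that W' W(2) chart_inj_on[OF c] by (auto simp: the_inv_into_f_f subset_iff)
  qed
  finally show "f \<in> smooth_funs X W' \<longleftrightarrow> smooth_on n (c ` W') (f \<circ> the_inv_into W c)" .
qed

section \<open>Smooth germs and tangent vectors\<close>

lemma smooth_map_smooth_funs:
  "smooth_map X Y \<phi> \<Longrightarrow> f \<in> smooth_funs Y V \<Longrightarrow>
    f \<circ> \<phi> \<in> smooth_funs X {x \<in> topspace (topo X). \<phi> x \<in> V}"
  by (simp add: smooth_map_def)

lemma smooth_atI: "a \<in> W \<Longrightarrow> f \<in> smooth_funs X W \<Longrightarrow> f \<in> smooth_at X a"
  unfolding smooth_at_def by auto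

lemma smooth_map_smooth_at:
  assumes "smooth_map X Y \<phi>" "a \<in> topspace (topo X)" "f \<in> smooth_at Y (\<phi> a)"
  shows "f \<circ> \<phi> \<in> smooth_at X a"
proof -
  obtain V where V: "\<phi> a \<in> V" "f \<in> smooth_funs Y V" using assms(3) by (auto simp: smooth_at_def)
  have "a \<in> {x \<in> topspace (topo X). \<phi> x \<in> V}" using assms(2) V(1) by simp
  then show ?thesis by (rule smooth_atI[OF _ smooth_map_smooth_funs[OF assms(1) V(2)]])
qed

lemma
  assumes "v \<in> tangent_space X a"
  shows tangent_add: "f \<in> smooth_at X a \<Longrightarrow> g \<in> smooth_at X a \<Longrightarrow> v (\<lambda>x. f x + g x) = v f + v g"
    and tangent_scale: "f \<in> smooth_at X a \<Longrightarrow> v (\<lambda>x. r * f x) = r * v f"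
    and tangent_mult: "f \<in> smooth_at X a \<Longrightarrow> g \<in> smooth_at X a \<Longrightarrow>
      v (\<lambda>x. f x * g x) = f a * v g + g a * v f"
    and tangent_nonsmooth: "f \<notin> smooth_at X a \<Longrightarrow> v f = 0"
  using assms by (simp_all add: tangent_space_def)

lemma tangent_spaceI:
  assumes "\<And>f g. f \<in> smooth_at X a \<Longrightarrow> g \<in> smooth_at X a \<Longrightarrow> v (\<lambda>x. f x + g x) = v f + v g"
    and "\<And>r f. f \<in> smooth_at X a \<Longrightarrow> v (\<lambda>x. r * f x) = r * v f"
    and "\<And>f g. f \<in> smooth_at X a \<Longrightarrow> g \<in> smooth_at X a \<Longrightarrow>
      v (\<lambda>x. f x * g x) = f a * v g + g a * v f"
    and "\<And>f. f \<notin> smooth_at X a \<Longrightarrow> v f = 0"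
  shows "v \<in> tangent_space X a"
  using assms by (simp add: tangent_space_def)

lemma tangent_space_zero: "(\<lambda>f. 0) \<in> tangent_space X a"
  by (simp add: tangent_space_def)

lemma tangent_space_add:
  "u \<in> tangent_space X a \<Longrightarrow> v \<in> tangent_space X a \<Longrightarrow> (\<lambda>f. u f + v f) \<in> tangent_space X a"
  by (simp add: tangent_space_def algebra_simps)

lemma tangent_space_scale: "v \<in> tangent_space X a \<Longrightarrow> (\<lambda>f. r * v f) \<in> tangent_space X a"
  by (simp add: tangent_space_def algebra_simps)

lemma tangent_space_sum:
  "finite E \<Longrightarrow> E \<subseteq> tangent_space X a \<Longrightarrow> (\<lambda>f. \<Sum>e\<in>E. c e * e f) \<in> tangent_space X a"
  by (induction E rule: finite_induct) (simp_all add: tangent_space_zero tangent_space_add tangent_space_scale)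

locale manifold =
  fixes n :: nat and X :: "'a smooth_space"
  assumes smooth_manifold: "smooth_manifold n X"
begin

lemma smooth_funs_openin: "f \<in> smooth_funs X U \<Longrightarrow> openin (topo X) U"
  using smooth_manifold unfolding smooth_manifold_def by metis

lemma smooth_funs_Union:
  "(\<And>U. U \<in> \<U> \<Longrightarrow> openin (topo X) U) \<Longrightarrow> f \<in> smooth_funs X (\<Union>\<U>) \<longleftrightarrow> (\<forall>U\<in>\<U>. f \<in> smooth_funs X U)"
  using smooth_manifold by (simp add: smooth_manifold_def)

text \<open>Restriction follows from the gluing axiom, applied to the cover of U by U and W.\<close>

lemma smooth_funs_subset:
  assumes "f \<in> smooth_funs X U" "openin (topo X) W" "W \<subseteq> U"
  shows "f \<in> smooth_funs X W"
proof -
  have "\<Union>{U, W} = U" using assms(3) by auto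
  then show ?thesis
    using smooth_funs_Union[of "{U, W}" f] assms smooth_funs_openin[OF assms(1)] by auto
qed

lemma chart_exists:
  assumes "openin (topo X) W" "a \<in> W"
  obtains U c where "a \<in> U" "U \<subseteq> W" "chart n X U c"
proof -
  have "a \<in> topspace (topo X)" using assms openin_subset by blast
  then obtain U c where U: "a \<in> U" "chart n X U c"
    using smooth_manifold by (auto simp: smooth_manifold_def)
  then have "chart n X (U \<inter> W) c"
    using assms by (intro chart_subset[OF U(2)]) (auto simp: chart_openin)
  then show thesis using that[of "U \<inter> W" c] U assms by auto
qed

lemma smooth_funsI:
  assumes W: "openin (topo X) W"
    and "\<And>a. a \<in> W \<Longrightarrow> \<exists>U. a \<in> U \<and> U \<subseteq> W \<and> f \<in> smooth_funs X U"
  shows "f \<in> smooth_funs X W"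
proof -
  let ?\<U> = "{U. U \<subseteq> W \<and> f \<in> smooth_funs X U}"
  have "\<Union>?\<U> = W" using assms(2) by blast
  moreover have "f \<in> smooth_funs X (\<Union>?\<U>)"
    by (rule smooth_funs_Union[THEN iffD2]) (auto intro: smooth_funs_openin)
  ultimately show ?thesis by (simp only:)
qed

text \<open>Testing in all charts contained in W reduces sums, products and changes of values
  outside W to the corresponding facts on R^n.\<close>

lemma smooth_funs_iff_charts:
  assumes W: "openin (topo X) W"
  shows "f \<in> smooth_funs X W \<longleftrightarrow>
    (\<forall>U c. chart n X U c \<and> U \<subseteq> W \<longrightarrow> smooth_on n (c ` U) (f \<circ> the_inv_into U c))"
proof
  assume f: "f \<in> smooth_funs X W"
  show "\<forall>U c. chart n X U c \<and> U \<subseteq> W \<longrightarrow> smooth_on n (c ` U) (f \<circ> the_inv_into U c)"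
  proof (intro allI impI, elim conjE)
    fix U c assume c: "chart n X U c" and U: "U \<subseteq> W"
    have "f \<in> smooth_funs X U" by (rule smooth_funs_subset[OF f chart_openin[OF c] U])
    then show "smooth_on n (c ` U) (f \<circ> the_inv_into U c)"
      using chart_smooth_funs[OF c chart_openin[OF c] order_refl] by blast
  qed
next
  assume r: "\<forall>U c. chart n X U c \<and> U \<subseteq> W \<longrightarrow> smooth_on n (c ` U) (f \<circ> the_inv_into U c)"
  show "f \<in> smooth_funs X W"
  proof (rule smooth_funsI[OF W])
    fix a assume "a \<in> W"
    then obtain U c where "a \<in> U" "U \<subseteq> W" "chart n X U c" using chart_exists[OF W] by blast
    moreover from this have "f \<in> smooth_funs X U"
      using r chart_smooth_funs[OF _ chart_openin order_refl, of n X U c] by blast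
    ultimately show "\<exists>U. a \<in> U \<and> U \<subseteq> W \<and> f \<in> smooth_funs X U" by blast
  qed
qed

lemma smooth_funs_cong:
  assumes "\<And>x. x \<in> W \<Longrightarrow> f x = g x" "f \<in> smooth_funs X W"
  shows "g \<in> smooth_funs X W"
proof -
  note W = smooth_funs_openin[OF assms(2)]
  have "smooth_on n (c ` U) (f \<circ> the_inv_into U c) = smooth_on n (c ` U) (g \<circ> the_inv_into U c)"
    if "chart n X U c" "U \<subseteq> W" for U c
    using that assms(1) by (intro smooth_on_cong) (auto simp: chart_inverse subset_iff)
  then show ?thesis using assms(2) by (simp add: smooth_funs_iff_charts[OF W])
qed

lemma smooth_funs_const: "openin (topo X) W \<Longrightarrow> (\<lambda>_. r) \<in> smooth_funs X W"
  by (auto simp: smooth_funs_iff_charts comp_def chart_openin chart_openin_image intro: smooth_on_const)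

lemma smooth_funs_add:
  assumes "f \<in> smooth_funs X W" "g \<in> smooth_funs X W"
  shows "(\<lambda>x. f x + g x) \<in> smooth_funs X W"
  using assms smooth_funs_openin[OF assms(1)]
  by (auto simp: smooth_funs_iff_charts comp_def intro: smooth_on_add)

lemma smooth_funs_mult:
  assumes "f \<in> smooth_funs X W" "g \<in> smooth_funs X W"
  shows "(\<lambda>x. f x * g x) \<in> smooth_funs X W"
  using assms smooth_funs_openin[OF assms(1)]
  by (auto simp: smooth_funs_iff_charts comp_def intro: smooth_on_mult)

lemma smooth_at_topspace: "f \<in> smooth_at X a \<Longrightarrow> a \<in> topspace (topo X)"
  using smooth_funs_openin openin_subset by (fastforce simp: smooth_at_def)

lemma smooth_at_common:
  assumes "f \<in> smooth_at X a" "g \<in> smooth_at X a"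
  obtains W where "a \<in> W" "f \<in> smooth_funs X W" "g \<in> smooth_funs X W"
proof -
  obtain U V where U: "a \<in> U" "f \<in> smooth_funs X U" and V: "a \<in> V" "g \<in> smooth_funs X V"
    using assms by (auto simp: smooth_at_def)
  have UV: "openin (topo X) (U \<inter> V)"
    by (intro openin_Int smooth_funs_openin[OF U(2)] smooth_funs_openin[OF V(2)])
  show thesis
    using U V by (intro that[of "U \<inter> V"] smooth_funs_subset[OF U(2) UV] smooth_funs_subset[OF V(2) UV]) auto
qed

lemma smooth_at_const: "a \<in> topspace (topo X) \<Longrightarrow> (\<lambda>_. r) \<in> smooth_at X a"
  by (rule smooth_atI[OF _ smooth_funs_const[OF openin_topspace]])

lemma smooth_at_add: "f \<in> smooth_at X a \<Longrightarrow> g \<in> smooth_at X a \<Longrightarrow> (\<lambda>x. f x + g x) \<in> smooth_at X a"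
  by (erule (1) smooth_at_common) (rule smooth_atI[OF _ smooth_funs_add])

lemma smooth_at_mult: "f \<in> smooth_at X a \<Longrightarrow> g \<in> smooth_at X a \<Longrightarrow> (\<lambda>x. f x * g x) \<in> smooth_at X a"
  by (erule (1) smooth_at_common) (rule smooth_atI[OF _ smooth_funs_mult])

lemma smooth_at_scale: "f \<in> smooth_at X a \<Longrightarrow> (\<lambda>x. r * f x) \<in> smooth_at X a"
  by (rule smooth_at_mult[OF smooth_at_const[OF smooth_at_topspace]])

lemma smooth_at_cong:
  assumes "openin (topo X) W" "a \<in> W" "\<And>x. x \<in> W \<Longrightarrow> f x = g x" "f \<in> smooth_at X a"
  shows "g \<in> smooth_at X a"
proof -
  obtain U where U: "a \<in> U" "f \<in> smooth_funs X U" using assms(4) by (auto simp: smooth_at_def)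
  have "openin (topo X) (U \<inter> W)" using smooth_funs_openin[OF U(2)] assms(1) by blast
  then have "f \<in> smooth_funs X (U \<inter> W)" using smooth_funs_subset[OF U(2)] by blast
  then have "g \<in> smooth_funs X (U \<inter> W)" by (rule smooth_funs_cong[rotated]) (simp add: assms(3))
  then show ?thesis using U(1) assms(2) by (intro smooth_atI[of a "U \<inter> W"]) auto
qed

text \<open>The indicator function of a neighbourhood is smooth at the point, because its values outside
  the neighbourhood are irrelevant; this replaces the usual bump functions.\<close>

lemma tangent_local:
  assumes v: "v \<in> tangent_space X a" and W: "openin (topo X) W" "a \<in> W"
    and f: "f \<in> smooth_at X a" and eq: "\<And>x. x \<in> W \<Longrightarrow> f x = g x"
  shows "v f = v g"
proof -
  let ?i = "\<lambda>x. if x \<in> W then 1 else 0 :: real"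
  have a: "a \<in> topspace (topo X)" using f by (rule smooth_at_topspace)
  have i: "?i \<in> smooth_at X a"
    by (rule smooth_at_cong[OF W _ smooth_at_const[OF a, of 1]]) simp
  \<comment> \<open>The indicator is idempotent with value 1 at a, so v takes a value equal to twice
    itself on it, that is 0. Multiplying h by the indicator then leaves v h unchanged.\<close>
  have "v (\<lambda>x. ?i x * ?i x) = v ?i + v ?i" using tangent_mult[OF v i i] W by simp
  moreover have "(\<lambda>x. ?i x * ?i x) = ?i" by auto
  ultimately have "v ?i = 0" by simp
  then have loc: "v (\<lambda>x. ?i x * h x) = v h" if "h \<in> smooth_at X a" for h
    using tangent_mult[OF v i that] W by simp
  have g: "g \<in> smooth_at X a" using smooth_at_cong[OF W eq f] .
  have "(\<lambda>x. ?i x * f x) = (\<lambda>x. ?i x * g x)" using eq by auto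
  then show ?thesis using loc[OF f] loc[OF g] by simp
qed

lemma tangent_const:
  assumes v: "v \<in> tangent_space X a" and a: "a \<in> topspace (topo X)"
  shows "v (\<lambda>_. r) = 0"
proof -
  note c = smooth_at_const[OF a, of 1]
  have "v (\<lambda>x. 1) = 0" using tangent_mult[OF v c c] by simp
  then show ?thesis using tangent_scale[OF v c, of r] by simp
qed

lemma smooth_at_chart_comp:
  assumes c: "chart n X U c" and a: "a \<in> U" and F: "c a \<in> V" "smooth_on n V F"
  shows "(\<lambda>x. F (c x)) \<in> smooth_at X a"
proof -
  have V: "openin (Euclidean_space n) V" using F by (simp add: smooth_on_def)
  let ?W = "{x \<in> U. c x \<in> V}"
  have W: "openin (topo X) ?W" by (rule chart_openin_preimage[OF c V])
  have "smooth_on n (c ` ?W) F"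
    by (rule smooth_on_subset[OF F(2) chart_openin_image[OF c W]]) auto
  moreover have "F x = ((\<lambda>x. F (c x)) \<circ> the_inv_into U c) x" if "x \<in> c ` ?W" for x
    using that by (auto simp: chart_inverse[OF c])
  ultimately have "smooth_on n (c ` ?W) ((\<lambda>x. F (c x)) \<circ> the_inv_into U c)"
    using smooth_on_cong[of "c ` ?W" F] by blast
  then have "(\<lambda>x. F (c x)) \<in> smooth_funs X ?W"
    using chart_smooth_funs[OF c W] by auto
  then show ?thesis using a F(1) by (intro smooth_atI[of a ?W]) auto
qed

text \<open>Composition with the chart turns v into a derivation on R^n at c a. Its locality, and
  the replacement of f by its coordinate expression, which agrees with f on U only, both rest on
  \<open>tangent_local\<close>.\<close>

lemma tangent_coordinates:
  assumes v: "v \<in> tangent_space X a" and c: "chart n X U c" and a: "a \<in> U" and f: "f \<in> smooth_at X a"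
  shows "v f = (\<Sum>i<n. v (\<lambda>x. c x i) * partial_deriv i (f \<circ> the_inv_into U c) (c a))"
proof -
  let ?D = "\<lambda>F. v (\<lambda>x. F (c x))" and ?F = "f \<circ> the_inv_into U c"
  obtain W where W: "a \<in> W" "f \<in> smooth_funs X W" using f by (auto simp: smooth_at_def)
  have UW: "openin (topo X) (U \<inter> W)" using chart_openin[OF c] smooth_funs_openin[OF W(2)] by blast
  have aT: "a \<in> topspace (topo X)" using f by (rule smooth_at_topspace)
  have "?D ?F = (\<Sum>i<n. ?D (\<lambda>x. x i) * partial_deriv i ?F (c a))"
  proof (rule derivation_euclidean[where S="{F. \<exists>V. c a \<in> V \<and> smooth_on n V F}"])
    show "c a \<in> c ` (U \<inter> W)" using a W by blast
    show "smooth_on n (c ` (U \<inter> W)) ?F"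
      using smooth_funs_subset[OF W(2) UW] chart_smooth_funs[OF c UW] by auto
    show "?D (\<lambda>_. r) = 0" for r by (rule tangent_const[OF v aT])
    fix F G assume "F \<in> {F. \<exists>V. c a \<in> V \<and> smooth_on n V F}" "G \<in> {F. \<exists>V. c a \<in> V \<and> smooth_on n V F}"
    then have "(\<lambda>x. F (c x)) \<in> smooth_at X a" "(\<lambda>x. G (c x)) \<in> smooth_at X a"
      using smooth_at_chart_comp[OF c a] by auto
    then show "?D (\<lambda>x. F x + G x) = ?D F + ?D G" "?D (\<lambda>x. F x * G x) = F (c a) * ?D G + G (c a) * ?D F"
      by (rule tangent_add[OF v], rule tangent_mult[OF v])
  next
    fix V F G assume V: "c a \<in> V" "smooth_on n V F" "smooth_on n V G" "\<And>x. x \<in> V \<Longrightarrow> F x = G x"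
    have "openin (topo X) {x \<in> U. c x \<in> V}"
      using V(2) by (intro chart_openin_preimage[OF c]) (simp add: smooth_on_def)
    then show "?D F = ?D G"
      by (rule tangent_local[OF v]) (use a V smooth_at_chart_comp[OF c a V(1,2)] in auto)
  qed simp
  moreover have "v f = ?D ?F"
    by (rule tangent_local[OF v UW _ f]) (use a W in \<open>auto simp: chart_inverse[OF c]\<close>)
  ultimately show ?thesis by simp
qed

end

lemma differential_tangent:
  assumes "manifold n X" "manifold m Y" and \<phi>: "smooth_map X Y \<phi>"
    and a: "a \<in> topspace (topo X)" and v: "v \<in> tangent_space X a"
  shows "differential X Y \<phi> a v \<in> tangent_space Y (\<phi> a)"
proof -
  interpret X: manifold n X by fact
  interpret Y: manifold m Y by fact
  have s: "(\<lambda>x. f (\<phi> x)) \<in> smooth_at X a" if "f \<in> smooth_at Y (\<phi> a)" for f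
    using smooth_map_smooth_at[OF \<phi> a that] by (simp add: comp_def)
  show ?thesis
    by (rule tangent_spaceI)
      (simp_all add: differential_def comp_def Y.smooth_at_add Y.smooth_at_mult Y.smooth_at_scale s
        tangent_add[OF v] tangent_mult[OF v] tangent_scale[OF v])
qed

text \<open>A homogeneous linear system with more unknowns than equations, solved by Gaussian
  elimination: the last equation is used to eliminate one unknown.\<close>

lemma nontrivial_combination:
  fixes x :: "nat \<Rightarrow> 'e \<Rightarrow> real"
  assumes "finite E" "card E > n"
  shows "\<exists>a. (\<exists>e\<in>E. a e \<noteq> 0) \<and> (\<forall>i<n. (\<Sum>e\<in>E. a e * x i e) = 0)"
  using assms
proof (induction n arbitrary: E x)
  case 0
  then have "E \<noteq> {}" by auto
  then show ?case by (intro exI[of _ "\<lambda>_. 1"]) auto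
next
  case (Suc n)
  show ?case
  proof (cases "\<forall>e\<in>E. x n e = 0")
    case True
    obtain a where "\<exists>e\<in>E. a e \<noteq> 0" "\<forall>i<n. (\<Sum>e\<in>E. a e * x i e) = 0"
      using Suc.IH[OF Suc.prems(1), of x] Suc.prems(2) by auto
    then show ?thesis using True by (intro exI[of _ a]) (auto simp: less_Suc_eq)
  next
    case False
    then obtain e0 where e0: "e0 \<in> E" "x n e0 \<noteq> 0" by blast
    \<comment> \<open>From each column e the multiple of the pivot column e0 that clears row n is
      subtracted.\<close>
    let ?E = "E - {e0}" and ?x = "\<lambda>i e. x i e - x i e0 * x n e / x n e0"
    have "finite ?E" "card ?E > n" using Suc.prems e0 by auto
    from Suc.IH[OF this, of ?x]
    obtain b where b: "\<exists>e\<in>?E. b e \<noteq> 0" "\<And>i. i < n \<Longrightarrow> (\<Sum>e\<in>?E. b e * ?x i e) = 0" by blast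
    \<comment> \<open>The coefficient of e0 must be -s for equation n to hold.\<close>
    define s where "s = (\<Sum>e\<in>?E. b e * x n e) / x n e0"
    define a where "a = b(e0 := - s)"
    have split: "(\<Sum>e\<in>E. a e * x i e) = - s * x i e0 + (\<Sum>e\<in>?E. b e * x i e)" for i
    proof -
      have "(\<Sum>e\<in>E. a e * x i e) = a e0 * x i e0 + (\<Sum>e\<in>?E. a e * x i e)"
        using Suc.prems(1) e0(1) by (rule sum.remove)
      also have "(\<Sum>e\<in>?E. a e * x i e) = (\<Sum>e\<in>?E. b e * x i e)"
        by (intro sum.cong) (auto simp: a_def)
      finally show ?thesis by (simp add: a_def)
    qed
    have "(\<Sum>e\<in>E. a e * x i e) = 0" if "i < Suc n" for i
    proof (cases "i = n")
      case True
      then show ?thesis using e0(2) by (simp add: split s_def)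
    next
      case False
      then have i: "i < n" using that by simp
      have "(\<Sum>e\<in>?E. b e * ?x i e) = (\<Sum>e\<in>?E. b e * x i e - x i e0 / x n e0 * (b e * x n e))"
        by (intro sum.cong) (auto simp: field_simps)
      also have "\<dots> = (\<Sum>e\<in>?E. b e * x i e) - x i e0 / x n e0 * (\<Sum>e\<in>?E. b e * x n e)"
        by (simp add: sum_subtractf sum_distrib_left)
      also have "\<dots> = (\<Sum>e\<in>E. a e * x i e)" by (simp add: split s_def)
      finally show ?thesis using b(2)[OF i] by simp
    qed
    moreover have "\<exists>e\<in>E. a e \<noteq> 0" using b(1) by (auto simp: a_def)
    ultimately show ?thesis by blast
  qed
qed

text \<open>A tangent vector that kills the n chart coordinates is zero, so more than n vectors
  leave a nontrivial solution of n linear equations. This bounds the size of orthonormal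
  sets.\<close>

lemma (in manifold) tangent_dependent:
  assumes a: "a \<in> topspace (topo X)" and E: "finite E" "E \<subseteq> tangent_space X a" "card E > n"
  shows "\<exists>r. (\<exists>e\<in>E. r e \<noteq> 0) \<and> (\<lambda>f. \<Sum>e\<in>E. r e * e f) = (\<lambda>f. 0)"
proof -
  obtain U c where c: "a \<in> U" "U \<subseteq> topspace (topo X)" "chart n X U c"
    by (rule chart_exists[OF openin_topspace a])
  obtain r where r: "\<exists>e\<in>E. r e \<noteq> 0" "\<forall>i<n. (\<Sum>e\<in>E. r e * e (\<lambda>x. c x i)) = 0"
    using nontrivial_combination[OF E(1,3), of "\<lambda>i e. e (\<lambda>x. c x i)"] by (elim exE conjE)
  let ?u = "\<lambda>f. \<Sum>e\<in>E. r e * e f"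
  have u: "?u \<in> tangent_space X a" using E(1,2) by (rule tangent_space_sum)
  have "?u = (\<lambda>f. 0)"
  proof
    fix f show "?u f = 0"
    proof (cases "f \<in> smooth_at X a")
      case True
      then show ?thesis using tangent_coordinates[OF u c(3,1) True] r(2) by simp
    next
      case False
      then show ?thesis by (rule tangent_nonsmooth[OF u])
    qed
  qed
  with r(1) show ?thesis by (intro exI conjI)
qed

section \<open>Lie groups\<close>

locale lie_group_manifold = manifold n "mfd G" for n :: nat and G :: "'a lie_group_data" +
  assumes lie_group: "lie_group G"
begin

sublocale group G using lie_group by (simp add: lie_group_def)

lemma topspace_mfd [simp]: "topspace (topo (mfd G)) = carrier G"
  using lie_group by (simp add: lie_group_def)

lemma smooth_mult: "smooth_map (prod_space (mfd G) (mfd G)) (mfd G) (\<lambda>(a, b). a \<otimes>\<^bsub>G\<^esub> b)"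
  using lie_group by (simp add: lie_group_def)

text \<open>In product charts, \<open>v (\<lambda>y. f (x \<otimes> y))\<close> is a combination with constant coefficients of the
  partial derivatives of \<open>f (x \<otimes> y)\<close> with respect to \<open>y\<close>, at \<open>y = \<one>\<close>.\<close>

lemma translate_smooth_locally:
  assumes v: "v \<in> tangent_space (mfd G) \<one>\<^bsub>G\<^esub>" and f: "f \<in> smooth_funs (mfd G) W" and x0: "x0 \<in> W"
  obtains U where "x0 \<in> U" "U \<subseteq> W" "(\<lambda>x. v (\<lambda>y. f (x \<otimes>\<^bsub>G\<^esub> y))) \<in> smooth_funs (mfd G) U"
    "(\<lambda>y. f (x0 \<otimes>\<^bsub>G\<^esub> y)) \<in> smooth_at (mfd G) \<one>\<^bsub>G\<^esub>"
proof -
  let ?X = "mfd G" and ?mult = "\<lambda>(a, b). a \<otimes>\<^bsub>G\<^esub> b"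
  let ?W = "{z \<in> topspace (topo (prod_space ?X ?X)). ?mult z \<in> W}"
  have W: "openin (topo ?X) W" by (rule smooth_funs_openin[OF f])
  then have x0G: "x0 \<in> carrier G" using x0 openin_subset by fastforce
  have F: "f \<circ> ?mult \<in> smooth_funs (prod_space ?X ?X) ?W"
    by (rule smooth_map_smooth_funs[OF smooth_mult f])
  have "continuous_map (topo (prod_space ?X ?X)) (topo ?X) ?mult"
    using smooth_mult by (simp add: smooth_map_def)
  from openin_continuous_map_preimage[OF this W]
  have "openin (prod_topology (topo ?X) (topo ?X)) ?W" by (simp add: prod_space_def)
  moreover have "(x0, \<one>\<^bsub>G\<^esub>) \<in> ?W" using x0 x0G by (simp add: prod_space_def)
  ultimately have "\<exists>U V. openin (topo ?X) U \<and> openin (topo ?X) V \<and> x0 \<in> U \<and> \<one>\<^bsub>G\<^esub> \<in> V \<and> U \<times> V \<subseteq> ?W"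
    by (rule openin_prod_topology_alt[THEN iffD1, rule_format])
  then obtain U0 V0 where UV0: "openin (topo ?X) U0" "openin (topo ?X) V0" "x0 \<in> U0" "\<one>\<^bsub>G\<^esub> \<in> V0"
    "U0 \<times> V0 \<subseteq> ?W"
    by (elim exE conjE)
  obtain U c where U: "x0 \<in> U" "U \<subseteq> U0" and c: "chart n ?X U c"
    by (rule chart_exists[OF UV0(1,3)])
  obtain V d where V: "\<one>\<^bsub>G\<^esub> \<in> V" "V \<subseteq> V0" and d: "chart n ?X V d"
    by (rule chart_exists[OF UV0(2,4)])
  have UV: "U \<times> V \<subseteq> ?W" using UV0 U V by blast
  have UG: "U \<subseteq> carrier G" using chart_openin[OF c] openin_subset by fastforce
  have UW: "U \<subseteq> W"
  proof
    fix x assume x: "x \<in> U"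
    then have "(x, \<one>\<^bsub>G\<^esub>) \<in> ?W" using UV V by blast
    then show "x \<in> W" using x UG by auto
  qed
  let ?Z = "{z \<in> topspace (Euclidean_space (n + n)). head_coords n z \<in> c ` U \<and> tail_coords n z \<in> d ` V}"
  let ?F = "\<lambda>z. f (the_inv_into U c (head_coords n z) \<otimes>\<^bsub>G\<^esub> the_inv_into V d (tail_coords n z))"
  \<comment> \<open>The definition of the product structure, read in the pair of charts c and
    d.\<close>
  have sF: "smooth_on (n + n) ?Z ?F"
    using F c d UV by (simp add: prod_space_def)
  have cU: "openin (Euclidean_space n) (c ` U)" and dV: "openin (Euclidean_space n) (d ` V)"
    using c d by (simp_all add: chart_def)
  have join: "join_coords n x y \<in> ?Z" if "x \<in> c ` U" "y \<in> d ` V" for x y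
  proof -
    have "\<forall>i\<ge>n. x i = 0" "\<forall>i\<ge>n. y i = 0"
      using that openin_Euclidean_subset[OF cU] openin_Euclidean_subset[OF dV] by blast+
    moreover from this have "\<forall>i\<ge>n + n. join_coords n x y i = 0" by (simp add: join_coords_def)
    ultimately show ?thesis using that by (simp add: topspace_Euclidean_space)
  qed
  have Fjoin: "?F (join_coords n (c x) y) = f (x \<otimes>\<^bsub>G\<^esub> the_inv_into V d y)" if "x \<in> U" for x y
    using that openin_Euclidean_subset[OF cU] by (simp add: chart_inverse[OF c] subset_iff)
  have at_one: "(\<lambda>y. f (x \<otimes>\<^bsub>G\<^esub> y)) \<in> smooth_at ?X \<one>\<^bsub>G\<^esub>" if x: "x \<in> U" for x
  proof -
    have "smooth_on n (d ` V) (\<lambda>y. ?F (join_coords n (c x) y))"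
      by (rule smooth_on_tail_slice[OF sF dV join]) (use x in auto)
    then have "smooth_on n (d ` V) ((\<lambda>y. f (x \<otimes>\<^bsub>G\<^esub> y)) \<circ> the_inv_into V d)"
      unfolding Fjoin[OF x] by (simp add: comp_def)
    then have "(\<lambda>y. f (x \<otimes>\<^bsub>G\<^esub> y)) \<in> smooth_funs ?X V"
      using chart_smooth_funs[OF d chart_openin[OF d] order_refl] by blast
    then show ?thesis using V by (intro smooth_atI)
  qed
  let ?v = "\<lambda>x. v (\<lambda>y. f (x \<otimes>\<^bsub>G\<^esub> y))"
  let ?s = "\<lambda>x. \<Sum>i<n. v (\<lambda>y. d y i) * partial_deriv (n + i) ?F (join_coords n x (d \<one>\<^bsub>G\<^esub>))"
  have vs: "?v x = ?s (c x)" if x: "x \<in> U" for x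
  proof -
    have "partial_deriv i ((\<lambda>y. f (x \<otimes>\<^bsub>G\<^esub> y)) \<circ> the_inv_into V d) (d \<one>\<^bsub>G\<^esub>) =
      partial_deriv (n + i) ?F (join_coords n (c x) (d \<one>\<^bsub>G\<^esub>))" for i
      unfolding partial_deriv_def join_upd_tail[symmetric] Fjoin[OF x] join_coords_tail
      by (simp add: comp_def)
    then show ?thesis using tangent_coordinates[OF v d V(1) at_one[OF x]] by simp
  qed
  have "smooth_on n (c ` U) ?s"
  proof (intro smooth_on_sum[OF cU] smooth_on_mult smooth_on_const[OF cU])
    fix i assume "i \<in> {..<n}"
    then show "smooth_on n (c ` U) (\<lambda>x. partial_deriv (n + i) ?F (join_coords n x (d \<one>\<^bsub>G\<^esub>)))"
      using V by (intro smooth_on_head_slice[OF smooth_on_partial_deriv[OF sF] cU] join) auto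
  qed
  moreover have "?s x = (?v \<circ> the_inv_into U c) x" if "x \<in> c ` U" for x
    using that by (auto simp: chart_inverse[OF c] vs)
  ultimately have "smooth_on n (c ` U) (?v \<circ> the_inv_into U c)"
    using smooth_on_cong[of "c ` U" ?s] by blast
  then have "?v \<in> smooth_funs ?X U"
    using chart_smooth_funs[OF c chart_openin[OF c] order_refl] by blast
  with U(1) UW show thesis using at_one[OF U(1)] by (intro that)
qed

lemma smooth_funs_carrier: "f \<in> smooth_funs (mfd G) W \<Longrightarrow> W \<subseteq> carrier G"
  using smooth_funs_openin openin_subset by fastforce

lemma translate_smooth:
  assumes "v \<in> tangent_space (mfd G) \<one>\<^bsub>G\<^esub>" and f: "f \<in> smooth_funs (mfd G) W"
  shows "(\<lambda>x. v (\<lambda>y. f (x \<otimes>\<^bsub>G\<^esub> y))) \<in> smooth_funs (mfd G) W"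
  by (rule smooth_funsI[OF smooth_funs_openin[OF f]]) (metis translate_smooth_locally[OF assms])

lemma translate_smooth_at:
  assumes f: "f \<in> smooth_funs (mfd G) W" and x: "x \<in> W"
  shows "(\<lambda>y. f (x \<otimes>\<^bsub>G\<^esub> y)) \<in> smooth_at (mfd G) \<one>\<^bsub>G\<^esub>"
  \<comment> \<open>The zero vector is a placeholder: the conclusion at the identity does not
    mention v.\<close>
  using translate_smooth_locally[OF tangent_space_zero f x] by blast

lemma left_invariant_field_eq:
  assumes f: "f \<in> smooth_funs (mfd G) W" and x: "x \<in> W"
  shows "left_invariant_field G v x f = v (\<lambda>y. f (x \<otimes>\<^bsub>G\<^esub> y))"
proof -
  have "x \<in> carrier G" using x smooth_funs_carrier[OF f] by blast
  moreover have "f \<in> smooth_at (mfd G) x" using x f by (rule smooth_atI)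
  ultimately show ?thesis
    by (simp add: left_invariant_field_def left_transport_def differential_def comp_def)
qed

lemma left_invariant_field_smooth:
  assumes "v \<in> tangent_space (mfd G) \<one>\<^bsub>G\<^esub>" and f: "f \<in> smooth_funs (mfd G) W"
  shows "(\<lambda>x. left_invariant_field G v x f) \<in> smooth_funs (mfd G) W"
  by (rule smooth_funs_cong[OF _ translate_smooth[OF assms]]) (simp add: left_invariant_field_eq[OF f])

lemma left_invariant_field_smooth_at:
  assumes "v \<in> tangent_space (mfd G) \<one>\<^bsub>G\<^esub>" and f: "f \<in> smooth_at (mfd G) \<one>\<^bsub>G\<^esub>"
  shows "(\<lambda>x. left_invariant_field G v x f) \<in> smooth_at (mfd G) \<one>\<^bsub>G\<^esub>"
  using f left_invariant_field_smooth[OF assms(1)] by (auto simp: smooth_at_def)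

lemma left_invariant_field_one:
  assumes v: "v \<in> tangent_space (mfd G) \<one>\<^bsub>G\<^esub>"
  shows "left_invariant_field G v \<one>\<^bsub>G\<^esub> = v"
proof
  fix f show "left_invariant_field G v \<one>\<^bsub>G\<^esub> f = v f"
  proof (cases "f \<in> smooth_at (mfd G) \<one>\<^bsub>G\<^esub>")
    case True
    \<comment> \<open>f (\<one> y) = f y is known on the carrier only, so locality is needed even
      here.\<close>
    then have "v f = v (\<lambda>y. f (\<one>\<^bsub>G\<^esub> \<otimes>\<^bsub>G\<^esub> y))"
      by (rule tangent_local[OF v openin_topspace, rotated]) auto
    then show ?thesis using True
      by (simp add: left_invariant_field_def left_transport_def differential_def comp_def)
  next
    case False
    then show ?thesis using tangent_nonsmooth[OF v False]
      by (simp add: left_invariant_field_def left_transport_def differential_def)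
  qed
qed

lemma left_invariant_field_combine:
  "left_invariant_field G (\<lambda>f. u f + v f) x f = left_invariant_field G u x f + left_invariant_field G v x f"
  "left_invariant_field G (\<lambda>f. r * v f) x f = r * left_invariant_field G v x f"
  by (auto simp: left_invariant_field_def left_transport_def differential_def)

section \<open>The bracket of left invariant fields\<close>

abbreviation bracket where
  "bracket u v \<equiv> field_bracket (mfd G) (left_invariant_field G u) (left_invariant_field G v) \<one>\<^bsub>G\<^esub>"

lemma bracket_eq:
  assumes "u \<in> tangent_space (mfd G) \<one>\<^bsub>G\<^esub>" "v \<in> tangent_space (mfd G) \<one>\<^bsub>G\<^esub>"
  shows "bracket u v f = (if f \<in> smooth_at (mfd G) \<one>\<^bsub>G\<^esub>
    then u (\<lambda>x. left_invariant_field G v x f) - v (\<lambda>x. left_invariant_field G u x f) else 0)"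
  using assms by (simp add: field_bracket_def left_invariant_field_one)

text \<open>D is a second-order operator, and its failure to be a derivation is the term v f * u g +
  v g * u f. That term is symmetric in u and v, so it cancels in the commutator and the bracket is
  again a tangent vector.\<close>

lemma derivative_of_field:
  assumes u: "u \<in> tangent_space (mfd G) \<one>\<^bsub>G\<^esub>" and v: "v \<in> tangent_space (mfd G) \<one>\<^bsub>G\<^esub>"
    and f: "f \<in> smooth_at (mfd G) \<one>\<^bsub>G\<^esub>" and g: "g \<in> smooth_at (mfd G) \<one>\<^bsub>G\<^esub>"
  defines "D \<equiv> \<lambda>f. u (\<lambda>x. left_invariant_field G v x f)"
  shows "D (\<lambda>x. f x + g x) = D f + D g"
    and "D (\<lambda>x. r * f x) = r * D f"
    and "D (\<lambda>x. f x * g x) = f \<one>\<^bsub>G\<^esub> * D g + g \<one>\<^bsub>G\<^esub> * D f + (v f * u g + v g * u f)"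
proof -
  let ?V = "left_invariant_field G v"
  obtain W where W: "\<one>\<^bsub>G\<^esub> \<in> W" and fW: "f \<in> smooth_funs (mfd G) W" and gW: "g \<in> smooth_funs (mfd G) W"
    using smooth_at_common[OF f g] .
  note Wo = smooth_funs_openin[OF fW]
  note s = translate_smooth_at[OF fW] translate_smooth_at[OF gW]
  note Vf = left_invariant_field_smooth_at[OF v f] and Vg = left_invariant_field_smooth_at[OF v g]
  have rW: "(\<lambda>x. r * f x) \<in> smooth_funs (mfd G) W"
    by (intro smooth_funs_mult smooth_funs_const Wo fW)
  have WG: "W \<subseteq> carrier G" by (rule smooth_funs_carrier[OF fW])
  \<comment> \<open>Linearity of the field at x requires f and g to be smooth near x, which holds on
    W; u is insensitive to the rest.\<close>
  have "D (\<lambda>x. f x + g x) = u (\<lambda>x. ?V x f + ?V x g)"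
    unfolding D_def
  proof (rule tangent_local[OF u Wo W, symmetric])
    show "(\<lambda>x. ?V x f + ?V x g) \<in> smooth_at (mfd G) \<one>\<^bsub>G\<^esub>" by (intro smooth_at_add Vf Vg)
    show "?V x f + ?V x g = ?V x (\<lambda>x. f x + g x)" if "x \<in> W" for x
      using that s[OF that] tangent_add[OF v]
      by (simp add: left_invariant_field_eq[OF fW] left_invariant_field_eq[OF gW]
          left_invariant_field_eq[OF smooth_funs_add[OF fW gW]])
  qed
  then show "D (\<lambda>x. f x + g x) = D f + D g" unfolding D_def by (simp add: tangent_add[OF u Vf Vg])
  have "D (\<lambda>x. r * f x) = u (\<lambda>x. r * ?V x f)"
    unfolding D_def
  proof (rule tangent_local[OF u Wo W, symmetric])
    show "(\<lambda>x. r * ?V x f) \<in> smooth_at (mfd G) \<one>\<^bsub>G\<^esub>" by (intro smooth_at_scale Vf)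
    show "r * ?V x f = ?V x (\<lambda>x. r * f x)" if "x \<in> W" for x
      using that s[OF that] tangent_scale[OF v]
      by (simp add: left_invariant_field_eq[OF fW] left_invariant_field_eq[OF rW])
  qed
  then show "D (\<lambda>x. r * f x) = r * D f" unfolding D_def by (simp add: tangent_scale[OF u Vf])
  have "D (\<lambda>x. f x * g x) = u (\<lambda>x. f x * ?V x g + g x * ?V x f)"
    unfolding D_def
  proof (rule tangent_local[OF u Wo W, symmetric])
    show "(\<lambda>x. f x * ?V x g + g x * ?V x f) \<in> smooth_at (mfd G) \<one>\<^bsub>G\<^esub>"
      by (intro smooth_at_add smooth_at_mult f g Vf Vg)
    show "f x * ?V x g + g x * ?V x f = ?V x (\<lambda>x. f x * g x)" if x: "x \<in> W" for x
      using x WG tangent_mult[OF v s(1)[OF x] s(2)[OF x]]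
      by (simp add: left_invariant_field_eq[OF fW] left_invariant_field_eq[OF gW]
          left_invariant_field_eq[OF smooth_funs_mult[OF fW gW]] subset_iff)
  qed
  also have "\<dots> = u (\<lambda>x. f x * ?V x g) + u (\<lambda>x. g x * ?V x f)"
    by (intro tangent_add[OF u] smooth_at_mult f g Vf Vg)
  finally show "D (\<lambda>x. f x * g x) = f \<one>\<^bsub>G\<^esub> * D g + g \<one>\<^bsub>G\<^esub> * D f + (v f * u g + v g * u f)"
    unfolding D_def
    by (simp add: tangent_mult[OF u f Vg] tangent_mult[OF u g Vf] left_invariant_field_one[OF v])
qed

lemma bracket_tangent:
  assumes u: "u \<in> tangent_space (mfd G) \<one>\<^bsub>G\<^esub>" and v: "v \<in> tangent_space (mfd G) \<one>\<^bsub>G\<^esub>"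
  shows "bracket u v \<in> tangent_space (mfd G) \<one>\<^bsub>G\<^esub>"
  by (rule tangent_spaceI)
    (simp_all add: bracket_eq[OF u v] smooth_at_add smooth_at_mult smooth_at_scale
      derivative_of_field[OF u v] derivative_of_field[OF v u] algebra_simps)

lemma bracket_add_left:
  assumes u: "u \<in> tangent_space (mfd G) \<one>\<^bsub>G\<^esub>" and v: "v \<in> tangent_space (mfd G) \<one>\<^bsub>G\<^esub>"
    and w: "w \<in> tangent_space (mfd G) \<one>\<^bsub>G\<^esub>"
  shows "bracket (\<lambda>f. u f + v f) w = (\<lambda>f. bracket u w f + bracket v w f)"
  by (rule ext)
    (simp add: bracket_eq u v w tangent_space_add left_invariant_field_combine
      tangent_add[OF w] left_invariant_field_smooth_at)

lemma bracket_scale_left: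
  assumes u: "u \<in> tangent_space (mfd G) \<one>\<^bsub>G\<^esub>" and w: "w \<in> tangent_space (mfd G) \<one>\<^bsub>G\<^esub>"
  shows "bracket (\<lambda>f. r * u f) w = (\<lambda>f. r * bracket u w f)"
  by (rule ext)
    (simp add: bracket_eq u w tangent_space_scale left_invariant_field_combine
      tangent_scale[OF w] left_invariant_field_smooth_at right_diff_distrib)

lemma bracket_swap: "bracket u v = (\<lambda>f. - bracket v u f)"
  by (auto simp: field_bracket_def)

end

text \<open>A homomorphism intertwines left translations, so the fields of v and of \<xi> v are
  \<phi>-related: differentiating f \<circ> \<phi> along the first is differentiating f along the
  second and composing with \<phi>. Commutators of related fields are related.\<close>

lemma differential_bracket:
  assumes "lie_group_manifold n G" "lie_group_manifold m H"
    and hom: "\<phi> \<in> hom G H" and \<phi>: "smooth_map (mfd G) (mfd H) \<phi>"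
    and u: "u \<in> tangent_space (mfd G) \<one>\<^bsub>G\<^esub>" and v: "v \<in> tangent_space (mfd G) \<one>\<^bsub>G\<^esub>"
  defines "\<xi> \<equiv> differential (mfd G) (mfd H) \<phi> \<one>\<^bsub>G\<^esub>"
  shows "\<xi> (field_bracket (mfd G) (left_invariant_field G u) (left_invariant_field G v) \<one>\<^bsub>G\<^esub>) =
    field_bracket (mfd H) (left_invariant_field H (\<xi> u)) (left_invariant_field H (\<xi> v)) \<one>\<^bsub>H\<^esub>"
proof
  interpret G: lie_group_manifold n G by fact
  interpret H: lie_group_manifold m H by fact
  have one: "\<phi> \<one>\<^bsub>G\<^esub> = \<one>\<^bsub>H\<^esub>" using hom G.group_axioms H.group_axioms hom_one by blast
  have \<xi>: "\<xi> w \<in> tangent_space (mfd H) \<one>\<^bsub>H\<^esub>" if "w \<in> tangent_space (mfd G) \<one>\<^bsub>G\<^esub>" for w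
    using differential_tangent[OF G.manifold_axioms H.manifold_axioms \<phi> _ that] one
    by (simp add: \<xi>_def)
  have eq: "\<xi> w f = w (f \<circ> \<phi>)" if "f \<in> smooth_at (mfd H) \<one>\<^bsub>H\<^esub>" for w f
    using that by (simp add: \<xi>_def differential_def one)
  fix f
  show "\<xi> (G.bracket u v) f = H.bracket (\<xi> u) (\<xi> v) f"
  proof (cases "f \<in> smooth_at (mfd H) \<one>\<^bsub>H\<^esub>")
    case False
    then show ?thesis by (simp add: \<xi>_def differential_def one field_bracket_def)
  next
    case f: True
    have f\<phi>: "f \<circ> \<phi> \<in> smooth_at (mfd G) \<one>\<^bsub>G\<^esub>"
      using smooth_map_smooth_at[OF \<phi>, of "\<one>\<^bsub>G\<^esub>"] f one by simp
    \<comment> \<open>One half of the commutator; the other half is the same statement with u and v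
      exchanged.\<close>
    have D: "u (\<lambda>x. left_invariant_field G v x (f \<circ> \<phi>)) = \<xi> u (\<lambda>x. left_invariant_field H (\<xi> v) x f)"
      if u: "u \<in> tangent_space (mfd G) \<one>\<^bsub>G\<^esub>" and v: "v \<in> tangent_space (mfd G) \<one>\<^bsub>G\<^esub>" for u v
    proof -
      obtain W where W: "\<one>\<^bsub>H\<^esub> \<in> W" "f \<in> smooth_funs (mfd H) W" using f by (auto simp: smooth_at_def)
      let ?W = "{x \<in> topspace (topo (mfd G)). \<phi> x \<in> W}"
      have fW: "f \<circ> \<phi> \<in> smooth_funs (mfd G) ?W" by (rule smooth_map_smooth_funs[OF \<phi> W(2)])
      have "u (\<lambda>x. left_invariant_field G v x (f \<circ> \<phi>)) =
        u ((\<lambda>x. left_invariant_field H (\<xi> v) x f) \<circ> \<phi>)"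
      proof (rule G.tangent_local[OF u G.smooth_funs_openin[OF fW]])
        show "\<one>\<^bsub>G\<^esub> \<in> ?W" using W one by simp
        show "(\<lambda>x. left_invariant_field G v x (f \<circ> \<phi>)) \<in> smooth_at (mfd G) \<one>\<^bsub>G\<^esub>"
          by (rule G.left_invariant_field_smooth_at[OF v f\<phi>])
        fix x assume x: "x \<in> ?W"
        then have xG: "x \<in> carrier G" and xW: "\<phi> x \<in> W" by auto
        have "left_invariant_field G v x (f \<circ> \<phi>) = v (\<lambda>y. (f \<circ> \<phi>) (x \<otimes>\<^bsub>G\<^esub> y))"
          by (rule G.left_invariant_field_eq[OF fW x])
        also have "\<dots> = v ((\<lambda>y. f (\<phi> x \<otimes>\<^bsub>H\<^esub> y)) \<circ> \<phi>)"
          by (rule G.tangent_local[OF v openin_topspace _ G.translate_smooth_at[OF fW x]])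
            (use xG hom in \<open>auto simp: hom_mult\<close>)
        also have "\<dots> = \<xi> v (\<lambda>y. f (\<phi> x \<otimes>\<^bsub>H\<^esub> y))"
          by (rule eq[symmetric, OF H.translate_smooth_at[OF W(2) xW]])
        also have "\<dots> = left_invariant_field H (\<xi> v) (\<phi> x) f"
          by (rule H.left_invariant_field_eq[symmetric, OF W(2) xW])
        finally show "left_invariant_field G v x (f \<circ> \<phi>) =
          ((\<lambda>x. left_invariant_field H (\<xi> v) x f) \<circ> \<phi>) x" by simp
      qed
      also have "\<dots> = \<xi> u (\<lambda>x. left_invariant_field H (\<xi> v) x f)"
        by (rule eq[symmetric, OF H.left_invariant_field_smooth_at[OF \<xi>[OF v] f]])
      finally show ?thesis .
    qed
    show ?thesis
      using D[OF u v] D[OF v u] f f\<phi>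
      by (simp add: eq G.bracket_eq[OF u v] H.bracket_eq[OF \<xi>[OF u] \<xi>[OF v]])
  qed
qed

section \<open>The Lie algebra of a Riemannian Lie group\<close>

lemma riemannian_metricD:
  assumes "riemannian_metric X g" "a \<in> topspace (topo X)"
    and "u \<in> tangent_space X a" "v \<in> tangent_space X a"
  shows "g a u v = g a v u"
    and "u \<noteq> (\<lambda>f. 0) \<Longrightarrow> g a u u > 0"
    and "w \<in> tangent_space X a \<Longrightarrow> g a (\<lambda>f. u f + r * v f) w = g a u w + r * g a v w"
  using assms by (auto simp: riemannian_metric_def)

lemma (in lie_group_manifold) euclidean_algebra_lie_algebra:
  assumes g: "riemannian_metric (mfd G) g"
  shows "euclidean_algebra (lie_algebra G g)"
proof (rule euclidean_algebra.intro)
  let ?T = "tangent_space (mfd G) \<one>\<^bsub>G\<^esub>" and ?L = "lie_algebra G g"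
  have simps: "carrier ?L = ?T" "\<And>u v. u \<otimes>\<^bsub>?L\<^esub> v = bracket u v" "\<zero>\<^bsub>?L\<^esub> = (\<lambda>f. 0)"
    "\<And>u v. u \<oplus>\<^bsub>?L\<^esub> v = (\<lambda>f. u f + v f)" "\<And>r v. r \<odot>\<^bsub>?L\<^esub> v = (\<lambda>f. r * v f)" "ip ?L = g \<one>\<^bsub>G\<^esub>"
    by (simp_all add: lie_algebra_def)
  show "abelian_group ?L"
  proof (rule abelian_groupI; unfold simps)
    fix v assume "v \<in> ?T"
    then show "\<exists>u\<in>?T. (\<lambda>f. u f + v f) = (\<lambda>f. 0)"
      using tangent_space_scale[of v _ _ "-1"] by (intro bexI[of _ "\<lambda>f. - 1 * v f"]) auto
  qed (auto simp: tangent_space_zero tangent_space_add add_ac)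
  have one: "\<one>\<^bsub>G\<^esub> \<in> topspace (topo (mfd G))" by simp
  note gD = riemannian_metricD[OF g one]
  \<comment> \<open>The metric is linear in the combined form u + r v; r = 1 gives additivity here,
    and u = 0 gives homogeneity below.\<close>
  have add: "g \<one>\<^bsub>G\<^esub> (\<lambda>f. u f + v f) w = g \<one>\<^bsub>G\<^esub> u w + g \<one>\<^bsub>G\<^esub> v w"
    if "u \<in> ?T" "v \<in> ?T" "w \<in> ?T" for u v w
    using gD(3)[OF that, of 1] by simp
  have zero: "g \<one>\<^bsub>G\<^esub> (\<lambda>f. 0) w = 0" if "w \<in> ?T" for w
    using add[OF tangent_space_zero tangent_space_zero that] by simp
  have scale: "g \<one>\<^bsub>G\<^esub> (\<lambda>f. r * v f) w = r * g \<one>\<^bsub>G\<^esub> v w" if "v \<in> ?T" "w \<in> ?T" for r v w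
    using gD(3)[OF tangent_space_zero that, of r] zero[OF that(2)] by simp
  have sum: "g \<one>\<^bsub>G\<^esub> (\<lambda>f. \<Sum>e\<in>E. r e * e f) w = (\<Sum>e\<in>E. r e * g \<one>\<^bsub>G\<^esub> e w)"
    if "finite E" "E \<subseteq> ?T" "w \<in> ?T" for E r w
    using that
    by (induction E rule: finite_induct)
      (auto simp: zero add scale tangent_space_scale tangent_space_sum)
  show "euclidean_algebra_axioms ?L"
  proof (rule euclidean_algebra_axioms.intro, unfold simps)
    have "card E \<le> n" if E: "orthonormal_set ?L E" for E
    proof (rule ccontr)
      assume "\<not> card E \<le> n"
      have fin: "finite E" and sub: "E \<subseteq> ?T" using E by (auto simp: orthonormal_set_def simps)
      obtain r e0 where r: "e0 \<in> E" "r e0 \<noteq> 0" "(\<lambda>f. \<Sum>e\<in>E. r e * e f) = (\<lambda>f. 0)"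
        using tangent_dependent[OF one fin sub] \<open>\<not> card E \<le> n\<close> by auto
      have e0: "e0 \<in> ?T" using r(1) sub by blast
      \<comment> \<open>Pairing the dependence relation with e0 isolates its nonzero
        coefficient.\<close>
      have "0 = (\<Sum>e\<in>E. r e * g \<one>\<^bsub>G\<^esub> e e0)"
        using sum[OF fin sub e0, of r] r(3) zero[OF e0] by simp
      also have "\<dots> = (\<Sum>e\<in>E. if e = e0 then r e else 0)"
        using E r(1) by (intro sum.cong) (auto simp: orthonormal_set_def simps)
      also have "\<dots> = r e0" using fin r(1) by simp
      finally show False using r(2) by simp
    qed
    then show "\<exists>n. \<forall>E. orthonormal_set ?L E \<longrightarrow> card E \<le> n" by blast
  next
    fix u v w assume u: "u \<in> ?T" and v: "v \<in> ?T" and w: "w \<in> ?T"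
    show "bracket (\<lambda>f. u f + v f) w = (\<lambda>f. bracket u w f + bracket v w f)"
      by (rule bracket_add_left[OF u v w])
    show "bracket w (\<lambda>f. u f + v f) = (\<lambda>f. bracket w u f + bracket w v f)"
      by (simp add: bracket_swap[of w] bracket_add_left[OF u v w])
  next
    fix u v r assume u: "u \<in> ?T" and v: "v \<in> ?T"
    show "bracket (\<lambda>f. r * u f) v = (\<lambda>f. r * bracket u v f)"
      by (rule bracket_scale_left[OF u v])
    show "bracket u (\<lambda>f. r * v f) = (\<lambda>f. r * bracket u v f)"
      by (simp add: bracket_swap[of u] bracket_scale_left[OF v u])
  next
    fix u assume "u \<in> ?T"
    show "bracket u u = (\<lambda>f. 0)" by (auto simp: field_bracket_def)
  next
    fix u v assume "u \<in> ?T" "v \<in> ?T"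
    then show "g \<one>\<^bsub>G\<^esub> u v = g \<one>\<^bsub>G\<^esub> v u" by (rule gD(1))
  next
    fix u assume "u \<in> ?T" "u \<noteq> (\<lambda>f. 0)"
    then show "g \<one>\<^bsub>G\<^esub> u u > 0" using gD(2) by blast
  qed (auto simp: tangent_space_scale bracket_tangent algebra_simps add scale)
qed

section \<open>The quotient group and the induced maps\<close>

lemma openin_quotient_space:
  "openin (topo (quotient_space X p)) V \<longleftrightarrow>
    V \<subseteq> p ` topspace (topo X) \<and> openin (topo X) {x \<in> topspace (topo X). p x \<in> V}"
proof -
  let ?P = "\<lambda>V. V \<subseteq> p ` topspace (topo X) \<and> openin (topo X) {x \<in> topspace (topo X). p x \<in> V}"
  have "istopology ?P"
    unfolding istopology_def
  proof (intro conjI allI impI)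
    fix S T assume S: "?P S" and T: "?P T"
    have "{x \<in> topspace (topo X). p x \<in> S \<inter> T} =
      {x \<in> topspace (topo X). p x \<in> S} \<inter> {x \<in> topspace (topo X). p x \<in> T}" by auto
    with S T show "openin (topo X) {x \<in> topspace (topo X). p x \<in> S \<inter> T}"
      by (simp only: openin_Int)
    show "S \<inter> T \<subseteq> p ` topspace (topo X)" using S by auto
  next
    fix \<K> assume K: "\<forall>K\<in>\<K>. ?P K"
    have "{x \<in> topspace (topo X). p x \<in> \<Union>\<K>} = (\<Union>K\<in>\<K>. {x \<in> topspace (topo X). p x \<in> K})" by auto
    with K show "openin (topo X) {x \<in> topspace (topo X). p x \<in> \<Union>\<K>}" by auto
    show "\<Union>\<K> \<subseteq> p ` topspace (topo X)" using K by auto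
  qed
  then show ?thesis by (simp add: quotient_space_def topology_inverse')
qed

lemma smooth_funs_quotient_space:
  "f \<in> smooth_funs (quotient_space X p) V \<longleftrightarrow> openin (topo (quotient_space X p)) V \<and>
    f \<circ> p \<in> smooth_funs X {x \<in> topspace (topo X). p x \<in> V}"
  by (simp add: quotient_space_def Let_def)

lemma quotient_lie_group_simps:
  "carrier (quotient_lie_group G N) = rcosets\<^bsub>G\<^esub> N"
  "\<one>\<^bsub>quotient_lie_group G N\<^esub> = N"
  "mfd (quotient_lie_group G N) = quotient_space (mfd G) (\<lambda>a. N #>\<^bsub>G\<^esub> a)"
  by (simp_all add: quotient_lie_group_def monoid.defs lie_group_data.defs FactGroup_def)

lemma induced_map_coset:
  assumes "group_hom G H \<phi>" and a: "a \<in> carrier G"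
  shows "induced_map G H \<phi> (kernel G H \<phi> #>\<^bsub>G\<^esub> a) = \<phi> a"
proof -
  interpret group_hom G H \<phi> by fact
  let ?N = "kernel G H \<phi>"
  have "\<phi> ` (?N #>\<^bsub>G\<^esub> a) = {\<phi> a}"
  proof (intro equalityI subsetI)
    fix y assume "y \<in> {\<phi> a}"
    moreover have "a \<in> ?N #>\<^bsub>G\<^esub> a" using a subgroup_kernel by (rule G.rcos_self)
    ultimately show "y \<in> \<phi> ` (?N #>\<^bsub>G\<^esub> a)" by blast
  qed (use a in \<open>auto simp: r_coset_def kernel_def\<close>)
  moreover have "?N #>\<^bsub>G\<^esub> a \<in> rcosets\<^bsub>G\<^esub> ?N" using a by (auto simp: RCOSETS_def)
  ultimately show ?thesis by (simp add: induced_map_def quotient_lie_group_simps)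
qed

text \<open>Smoothness on \<open>G/G\<^sub>0\<close> is defined by pullback to \<open>G\<close>, so the chain rule through \<open>G/G\<^sub>0\<close> does not
  need the quotient manifold theorem.\<close>

lemma differential_induced_map:
  assumes "lie_group_manifold n G" "lie_group_manifold m H"
    and hom: "\<phi> \<in> hom G H" and \<phi>: "smooth_map (mfd G) (mfd H) \<phi>"
    and v: "v \<in> tangent_space (mfd G) \<one>\<^bsub>G\<^esub>"
  defines "N \<equiv> kernel G H \<phi>"
  defines "Q \<equiv> quotient_lie_group G N"
  shows "differential (mfd Q) (mfd H) (induced_map G H \<phi>) \<one>\<^bsub>Q\<^esub>
      (differential (mfd G) (mfd Q) (\<lambda>a. N #>\<^bsub>G\<^esub> a) \<one>\<^bsub>G\<^esub> v) =
    differential (mfd G) (mfd H) \<phi> \<one>\<^bsub>G\<^esub> v"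
proof
  interpret G: lie_group_manifold n G by fact
  interpret H: lie_group_manifold m H by fact
  interpret \<phi>: group_hom G H \<phi>
    using hom by (simp add: group_hom_def group_hom_axioms_def G.group_axioms H.group_axioms)
  let ?p = "\<lambda>a. N #>\<^bsub>G\<^esub> a" and ?\<psi> = "induced_map G H \<phi>"
  have \<psi>: "?\<psi> (?p a) = \<phi> a" if "a \<in> carrier G" for a
    unfolding N_def using \<phi>.group_hom_axioms that by (rule induced_map_coset)
  have p1: "?p \<one>\<^bsub>G\<^esub> = N"
    by (rule G.coset_mult_one) (auto simp: N_def kernel_def)
  have \<psi>1: "?\<psi> N = \<one>\<^bsub>H\<^esub>" using \<psi>[of "\<one>\<^bsub>G\<^esub>"] p1 by simp
  have Q: "\<one>\<^bsub>Q\<^esub> = N" "mfd Q = quotient_space (mfd G) ?p"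
    by (simp_all add: Q_def quotient_lie_group_simps)
  fix f
  show "differential (mfd Q) (mfd H) ?\<psi> \<one>\<^bsub>Q\<^esub> (differential (mfd G) (mfd Q) ?p \<one>\<^bsub>G\<^esub> v) f =
    differential (mfd G) (mfd H) \<phi> \<one>\<^bsub>G\<^esub> v f"
  proof (cases "f \<in> smooth_at (mfd H) \<one>\<^bsub>H\<^esub>")
    case False
    then show ?thesis by (simp add: differential_def Q \<psi>1)
  next
    case f: True
    then obtain W where W: "\<one>\<^bsub>H\<^esub> \<in> W" "f \<in> smooth_funs (mfd H) W" by (auto simp: smooth_at_def)
    \<comment> \<open>A neighbourhood of N whose preimage in G is the preimage of W under \<phi>;
      openness and smoothness in the quotient thereby become statements about f \<circ> \<phi> on
      G.\<close>
    let ?V = "{C \<in> ?p ` carrier G. ?\<psi> C \<in> W}"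
    have pre: "{x \<in> topspace (topo (mfd G)). ?p x \<in> ?V} = {x \<in> topspace (topo (mfd G)). \<phi> x \<in> W}"
      using \<psi> by auto
    have f\<phi>: "f \<circ> \<phi> \<in> smooth_funs (mfd G) {x \<in> topspace (topo (mfd G)). \<phi> x \<in> W}"
      by (rule smooth_map_smooth_funs[OF \<phi> W(2)])
    \<comment> \<open>The two composites are compared on the carrier only, hence the appeals to
      congruence and to locality of v.\<close>
    have eq: "(f \<circ> \<phi>) x = (f \<circ> ?\<psi> \<circ> ?p) x" if "x \<in> carrier G" for x using \<psi>[OF that] by simp
    have "f \<circ> ?\<psi> \<circ> ?p \<in> smooth_funs (mfd G) {x \<in> topspace (topo (mfd G)). \<phi> x \<in> W}"
      by (rule G.smooth_funs_cong[OF _ f\<phi>]) (use eq in auto)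
    moreover have "openin (topo (mfd Q)) ?V"
      unfolding Q openin_quotient_space pre using G.smooth_funs_openin[OF f\<phi>] by auto
    ultimately have "f \<circ> ?\<psi> \<in> smooth_funs (mfd Q) ?V"
      unfolding Q smooth_funs_quotient_space pre by blast
    moreover have "N \<in> ?V" using p1 \<psi>1 W(1) by force
    ultimately have "f \<circ> ?\<psi> \<in> smooth_at (mfd Q) N" by (intro smooth_atI)
    moreover have "v (f \<circ> \<phi>) = v (f \<circ> ?\<psi> \<circ> ?p)"
      by (rule G.tangent_local[OF v openin_topspace])
        (use eq smooth_map_smooth_at[OF \<phi>, of "\<one>\<^bsub>G\<^esub>" f] f in auto)
    ultimately show ?thesis using f by (simp add: differential_def p1 \<psi>1 Q)
  qed
qed

text \<open>All elements k + v of the coset have the same image, since \<xi> k = 0 and the chain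
  rule gives \<xi> on each of them. The coset is nonempty, so its image is a singleton and
  \<open>the_elem\<close> is meaningful.\<close>

lemma induced_differential_coset:
  assumes G: "lie_group_manifold n G" and H: "lie_group_manifold m H"
    and hom: "\<phi> \<in> hom G H" and \<phi>: "smooth_map (mfd G) (mfd H) \<phi>"
    and v: "v \<in> carrier (lie_algebra G g)"
    and \<xi>_def: "\<xi> = differential (mfd G) (mfd H) \<phi> \<one>\<^bsub>G\<^esub>"
    and K_def: "K = a_kernel (lie_algebra G g) (lie_algebra H h) \<xi>"
  shows "induced_differential G H \<phi> (K +>\<^bsub>lie_algebra G g\<^esub> v) = \<xi> v"
proof -
  let ?T = "tangent_space (mfd G) \<one>\<^bsub>G\<^esub>"
  have vT: "v \<in> ?T" using v by (simp add: lie_algebra_def)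
  have K: "K = {k \<in> ?T. \<xi> k = (\<lambda>f. 0)}" by (simp add: K_def a_kernel_def' lie_algebra_def)
  have C: "K +>\<^bsub>lie_algebra G g\<^esub> v = {(\<lambda>f. k f + v f) |k. k \<in> K}"
    by (auto simp: a_r_coset_def' lie_algebra_def)
  let ?Q = "quotient_lie_group G (kernel G H \<phi>)"
  let ?d = "\<lambda>v. differential (mfd ?Q) (mfd H) (induced_map G H \<phi>) \<one>\<^bsub>?Q\<^esub>
      (differential (mfd G) (mfd ?Q) (\<lambda>a. kernel G H \<phi> #>\<^bsub>G\<^esub> a) \<one>\<^bsub>G\<^esub> v)"
  have d: "?d w = \<xi> w" if "w \<in> ?T" for w
    unfolding \<xi>_def by (rule differential_induced_map[OF G H hom \<phi> that])
  have \<xi>: "\<xi> (\<lambda>f. k f + v f) = \<xi> v" if "k \<in> K" for k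
  proof
    fix f
    have "\<xi> k f = 0" using that by (simp add: K)
    then show "\<xi> (\<lambda>f. k f + v f) f = \<xi> v f" by (auto simp: \<xi>_def differential_def split: if_splits)
  qed
  have "?d w = \<xi> v" if w: "w \<in> K +>\<^bsub>lie_algebra G g\<^esub> v" for w
  proof -
    obtain k where k: "k \<in> K" "w = (\<lambda>f. k f + v f)" using w by (auto simp: C)
    then have "w \<in> ?T" using vT by (simp add: K tangent_space_add)
    then show ?thesis using d \<xi>[OF k(1)] k(2) by simp
  qed
  moreover have "(\<lambda>f. 0) \<in> K"
    using tangent_space_zero by (auto simp: K \<xi>_def differential_def)
  then have "K +>\<^bsub>lie_algebra G g\<^esub> v \<noteq> {}" by (auto simp: C)
  ultimately have "?d ` (K +>\<^bsub>lie_algebra G g\<^esub> v) = {\<xi> v}" by force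
  then show ?thesis by (simp add: induced_differential_def Let_def)
qed

theorem proposition4p1:
  fixes G :: "'a lie_group_data" and H :: "'b lie_group_data"
    and g :: "'a \<Rightarrow> 'a tvec \<Rightarrow> 'a tvec \<Rightarrow> real" and h :: "'b \<Rightarrow> 'b tvec \<Rightarrow> 'b tvec \<Rightarrow> real"
    and \<phi> :: "'a \<Rightarrow> 'b"
    and \<xi> :: "'a tvec \<Rightarrow> 'b tvec" and \<xi>' :: "'a tvec set \<Rightarrow> 'b tvec"
    and \<gg> :: "'a tvec euclidean_lie_algebra" and \<hh> :: "'b tvec euclidean_lie_algebra"
    and \<gg>\<^sub>0 :: "'a tvec set"
  assumes "riemannian_lie_group G g" and "riemannian_lie_group H h"
    and "\<phi> \<in> hom G H" and "submersion (mfd G) (mfd H) \<phi>"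
    and "\<gg> = lie_algebra G g" and "\<hh> = lie_algebra H h"
    and "\<xi> = differential (mfd G) (mfd H) \<phi> \<one>\<^bsub>G\<^esub>"
    and "\<gg>\<^sub>0 = a_kernel \<gg> \<hh> \<xi>"
    and "\<xi>' = induced_differential G H \<phi>"
  shows "tension \<gg> \<hh> \<xi> =
         tension (quotient_lie_algebra \<gg> \<gg>\<^sub>0) \<hh> \<xi>' \<ominus>\<^bsub>\<hh>\<^esub> \<xi> (mean_curvature \<gg> \<gg>\<^sub>0)"
proof -
  obtain n m where G: "lie_group_manifold n G" and H: "lie_group_manifold m H"
    using assms(1,2)
    by (auto simp: riemannian_lie_group_def lie_group_def lie_group_manifold_def
        lie_group_manifold_axioms_def manifold_def)
  interpret G: lie_group_manifold n G by fact
  interpret H: lie_group_manifold m H by fact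
  have \<phi>: "smooth_map (mfd G) (mfd H) \<phi>" using assms(4) by (simp add: submersion_def)
  have one: "\<phi> \<one>\<^bsub>G\<^esub> = \<one>\<^bsub>H\<^esub>" using assms(3) G.group_axioms H.group_axioms hom_one by blast
  note simps = assms(5,6) lie_algebra_def
  show ?thesis
  proof (rule tension_quotient[OF _ _ _ _ _ _ assms(8)])
    show "euclidean_algebra \<gg>" "euclidean_algebra \<hh>"
      unfolding assms(5,6) using assms(1,2)
      by (auto simp: riemannian_lie_group_def
          intro: G.euclidean_algebra_lie_algebra H.euclidean_algebra_lie_algebra)
  next
    fix v assume "v \<in> carrier \<gg>"
    then show "\<xi> v \<in> carrier \<hh>"
      using differential_tangent[OF G.manifold_axioms H.manifold_axioms \<phi>, of "\<one>\<^bsub>G\<^esub>" v]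
      by (simp add: simps assms(7) one)
  next
    fix u v show "\<xi> (u \<oplus>\<^bsub>\<gg>\<^esub> v) = \<xi> u \<oplus>\<^bsub>\<hh>\<^esub> \<xi> v"
      by (auto simp: simps assms(7) differential_def)
  next
    fix r v show "\<xi> (r \<odot>\<^bsub>\<gg>\<^esub> v) = r \<odot>\<^bsub>\<hh>\<^esub> \<xi> v"
      by (auto simp: simps assms(7) differential_def)
  next
    fix u v assume "u \<in> carrier \<gg>" "v \<in> carrier \<gg>"
    then show "\<xi> (u \<otimes>\<^bsub>\<gg>\<^esub> v) = \<xi> u \<otimes>\<^bsub>\<hh>\<^esub> \<xi> v"
      using differential_bracket[OF G H assms(3) \<phi>, of u v] by (simp add: simps assms(7))
  next
    fix v assume "v \<in> carrier \<gg>"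
    then show "\<xi>' (\<gg>\<^sub>0 +>\<^bsub>\<gg>\<^esub> v) = \<xi> v"
      using induced_differential_coset[OF G H assms(3) \<phi>, of v g \<xi> \<gg>\<^sub>0 h] assms(5-9) by simp
  qed
qed

end
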